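(* Suppose that the coefficients $f,g$ of the SDDE satisfy Assumption A and that the family of time-step functions $\{h^\delta\}_{0<\delta<1}$ satisfies Assumption B (both stated in the context). Then $T$ is attainable, and for every $p>0$ there exists a constant $C>0$, dependent on $T$ and $p$ but independent of the time steps $h^\delta_n$, such that the continuous-time adaptive Euler--Maruyama approximate solution $X$ satisfies $$\mathbb E\Big[\sup_{0\le t\le T}|X_t|^p\Big]\le C .$$
   Context: Setting. Let $(\Omega,\mathcal F,\mathbb P)$ be a complete probability space with a filtration $\{\mathcal F_t\}_{t\ge0}$ satisfying the usual conditions, and let $W$ be a standard $d$-dimensional Brownian motion on it. $|\cdot|$ is the Euclidean norm, $\langle\cdot,\cdot\rangle$ the inner product, $\|A\|=\sqrt{\mathrm{trace}(A^TA)}$ for matrices. Let $\tau>0$, $T>0$; $C([-\tau,0];\mathbb R^m)$ carries the norm $\|\phi\|=\sup_{-\tau\le\theta\le0}|\phi(\theta)|$. Consider the SDDE $$dY_t=f(Y_t,Y_{t-\tau})\,dt+g(Y_t,Y_{t-\tau})\,dW_t,\quad t\ge0,\qquad Y_\theta=\xi(\theta),\ \theta\in[-\tau,0],$$ with $f:\mathbb R^m\times\mathbb R^m\to\mathbb R^m$, $g:\mathbb R^m\times\mathbb R^m\to\mathbb R^{m\times d}$ Borel measurable and $\xi$ an $\mathcal F_0$-measurable $C([-\tau,0];\mathbb R^m)$-valued random variable with $\mathbb E\|\xi\|^p<\infty$ for every $p\ge2$. Adaptive scheme. For $\delta\in(0,1)$ let $h^\delta:\mathbb R^m\to\mathbb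 R^+$. Set $t_0=0$, $\hat X_{0}=\xi(0)$, $\bar X_t=\xi(t)$ for $t\in[-\tau,0)$, and recursively (pathwise) for $n\ge0$: $h^\delta_n=h^\delta(\hat X_{t_n})$, $t_{n+1}=t_n+h^\delta_n$, $\bar X_t=\hat X_{t_n}$ for $t\in[t_n,t_{n+1})$, and $$\hat X_{t_{n+1}}=\hat X_{t_n}+f(\bar X_{t_n},\bar X_{t_n-\tau})h^\delta_n+g(\bar X_{t_n},\bar X_{t_n-\tau})(W_{t_{n+1}}-W_{t_n}).$$ The recursion is run until $t_n\ge T$. Put $\tilde X_t=\bar X_{t_n-\tau}$ for $t\in[t_n-\tau,t_{n+1}-\tau)$, $n\ge 0$. The continuous-time approximate solution is $X_t=\xi(t)$ for $t\in[-\tau,0]$ and $$X_t=X_0+\int_0^tf(\bar X_s,\tilde X_{s-\tau})\,ds+\int_0^tg(\bar X_s,\tilde X_{s-\tau})\,dW_s,\quad t>0,$$ so that $X_{t_n}=\hat X_{t_n}=\bar X_{t_n}$. All these objects depend on $\delta$. Attainability. $T$ is attainable if for almost every $\omega\in\Omega$ there is a finite $N(\omega)$ with $t_{N(\omega)}(\omega)\ge T$. Assumption A. (i) For every $R>0$ there is $C_R>0$ such that $|f(x,y)-f(\bar x,\bar y)|+\|g(x,y)-g(\bar x,\bar y)\|\le C_R(|x-\bar x|+|y-\bar y|)$ for all $x,y,\bar x,\bar y\in\mathbb R^m$ with $|x|\vee|y|\vee|\bar x|\vee|\bar y|\le R$. (ii) There exist $\alpha,\beta\ge0$ such that for all $x,y\in\mathbb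 R^m$: $\langle x,f(x,y)\rangle\le\alpha(|x|^2+|y|^2)+\beta$ and $\|g(x,y)\|^2\le\alpha(|x|^2+|y|^2)+\beta$. Assumption B. For each $\delta\in(0,1)$, $h^\delta:\mathbb R^m\to\mathbb R^+$ is continuous with $0<h^\delta(x)\le\delta T$ for all $x\in\mathbb R^m$, and there exist constants $\alpha,\beta>0$ (not depending on $\delta$) such that for all $x,y\in\mathbb R^m$: $\langle x,f(x,y)\rangle+\tfrac12h^\delta(x)|f(x,y)|^2\le\alpha(|x|^2+|y|^2)+\beta$. *)

theory Defs
  imports "HOL-Probability.Probability"
begin

section \<open>Filtered probability space and Brownian motion\<close>

text \<open>Index sets are half lines \<open>t \<ge> 0\<close> in \<^typ>\<open>real\<close>; the values of \<open>F\<close> and \<open>W\<close> at negative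
  times play no role.\<close>

definition usual_filtration :: "'w measure \<Rightarrow> (real \<Rightarrow> 'w measure) \<Rightarrow> bool" where
  "usual_filtration M F \<longleftrightarrow>
     (\<forall>t\<ge>0. subalgebra M (F t)) \<and>
     (\<forall>s t. 0 \<le> s \<and> s \<le> t \<longrightarrow> sets (F s) \<subseteq> sets (F t)) \<and>
     (\<forall>t\<ge>0. sets (F t) = (\<Inter>u\<in>{t<..}. sets (F u))) \<and>
     null_sets M \<subseteq> sets (F 0)"

definition brownian_motion ::
  "'w measure \<Rightarrow> (real \<Rightarrow> 'w measure) \<Rightarrow> (real \<Rightarrow> 'w \<Rightarrow> real ^ 'd) \<Rightarrow> bool" where
  "brownian_motion M F W \<longleftrightarrow>
     (\<forall>t\<ge>0. W t \<in> borel_measurable (F t)) \<and>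
     (AE \<omega> in M. W 0 \<omega> = 0) \<and>
     (AE \<omega> in M. continuous_on {0..} (\<lambda>t. W t \<omega>)) \<and>
     (\<forall>s t. 0 \<le> s \<and> s < t \<longrightarrow>
        prob_space.indep_set M (sets (F s))
          (sets (vimage_algebra (space M) (\<lambda>\<omega>. W t \<omega> - W s \<omega>) borel)) \<and>
        prob_space.indep_vars M (\<lambda>_. borel) (\<lambda>i \<omega>. (W t \<omega> - W s \<omega>) $ i) UNIV \<and>
        (\<forall>i. distributed M lborel (\<lambda>\<omega>. (W t \<omega> - W s \<omega>) $ i) (normal_density 0 (sqrt (t - s)))))"


section \<open>The path space of the initial datum\<close>

text \<open>\<open>cfunspace\<close> is the metric space of bounded continuous maps with the uniform distance; its
  points are extensional functions, whence the \<^const>\<open>restrict\<close> below.\<close>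

definition path_borel :: "real \<Rightarrow> (real \<Rightarrow> 'a::metric_space) measure" where
  "path_borel \<tau> =
     (let C = cfunspace (top_of_set {-\<tau>..0}) euclidean_metric
      in sigma (mspace C) {U. openin (mtopology_of C) U})"

definition path_norm :: "real \<Rightarrow> (real \<Rightarrow> 'a::real_normed_vector) \<Rightarrow> real" where
  "path_norm \<tau> \<phi> = (SUP \<theta>\<in>{-\<tau>..0}. norm (\<phi> \<theta>))"

definition initial_datum ::
  "'w measure \<Rightarrow> 'w measure \<Rightarrow> real \<Rightarrow> ('w \<Rightarrow> real \<Rightarrow> 'a::real_normed_vector) \<Rightarrow> bool" where
  "initial_datum M F0 \<tau> \<xi> \<longleftrightarrow>
     (\<lambda>\<omega>. restrict (\<xi> \<omega>) {-\<tau>..0}) \<in> measurable F0 (path_borel \<tau>) \<and>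
     (\<forall>p\<ge>2. (\<integral>\<^sup>+\<omega>. ennreal (path_norm \<tau> (\<xi> \<omega>) powr p) \<partial>M) < \<infinity>)"

lemma initial_datum_continuous:
  assumes "initial_datum M F0 \<tau> \<xi>" "\<omega> \<in> space F0"
  shows "continuous_on {-\<tau>..0} (\<xi> \<omega>)"
proof -
  let ?C = "cfunspace (top_of_set {-\<tau>..0}) (euclidean_metric :: 'b metric)"
  have "{U. openin (mtopology_of ?C) U} \<subseteq> Pow (mspace ?C)"
    using openin_subset by fastforce
  then have "space (path_borel \<tau> :: (real \<Rightarrow> 'b) measure) = mspace ?C"
    by (simp add: path_borel_def Let_def space_measure_of del: mspace_cfunspace)
  with assms have "restrict (\<xi> \<omega>) {-\<tau>..0} \<in> mspace ?C"
    unfolding initial_datum_def by (metis measurable_space)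
  then have "continuous_map (top_of_set {-\<tau>..0}) euclidean (restrict (\<xi> \<omega>) {-\<tau>..0})"
    by simp
  then have "continuous_on {-\<tau>..0} (restrict (\<xi> \<omega>) {-\<tau>..0})"
    by simp
  then show ?thesis
    by (metis (no_types, lifting) continuous_on_cong restrict_apply')
qed


section \<open>Assumptions on the coefficients and on the time steps\<close>

text \<open>The library norm on matrices is the Frobenius (Hilbert-Schmidt) norm.\<close>

lemma norm_matrix_eq_trace:
  fixes A :: "real ^ 'd ^ 'm"
  shows "norm A = sqrt (trace (transpose A ** A))"
proof -
  have "trace (transpose A ** A) = (\<Sum>j\<in>UNIV. \<Sum>i\<in>UNIV. (A $ i $ j)\<^sup>2)"
    by (simp add: trace_def matrix_matrix_mult_def transpose_def power2_eq_square)
  also have "\<dots> = (\<Sum>i\<in>UNIV. \<Sum>j\<in>UNIV. (A $ i $ j)\<^sup>2)"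
    by (rule sum.swap)
  also have "\<dots> = (\<Sum>i\<in>UNIV. (norm (A $ i))\<^sup>2)"
    by (simp add: norm_vec_def L2_set_def sum_nonneg)
  finally show ?thesis
    by (simp add: norm_vec_def L2_set_def)
qed

definition assumption_A ::
  "(real ^ 'm \<Rightarrow> real ^ 'm \<Rightarrow> real ^ 'm) \<Rightarrow> (real ^ 'm \<Rightarrow> real ^ 'm \<Rightarrow> real ^ 'd ^ 'm) \<Rightarrow> bool" where
  "assumption_A f g \<longleftrightarrow>
     (\<forall>R>0. \<exists>C>0. \<forall>x y x' y'.
        norm x \<le> R \<and> norm y \<le> R \<and> norm x' \<le> R \<and> norm y' \<le> R \<longrightarrow>
        norm (f x y - f x' y') + norm (g x y - g x' y') \<le> C * (norm (x - x') + norm (y - y'))) \<and>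
     (\<exists>\<alpha>\<ge>0. \<exists>\<beta>\<ge>0. \<forall>x y.
        x \<bullet> f x y \<le> \<alpha> * ((norm x)\<^sup>2 + (norm y)\<^sup>2) + \<beta> \<and>
        (norm (g x y))\<^sup>2 \<le> \<alpha> * ((norm x)\<^sup>2 + (norm y)\<^sup>2) + \<beta>)"

definition assumption_B ::
  "real \<Rightarrow> (real ^ 'm \<Rightarrow> real ^ 'm \<Rightarrow> real ^ 'm) \<Rightarrow> (real \<Rightarrow> real ^ 'm \<Rightarrow> real) \<Rightarrow> bool" where
  "assumption_B T f h \<longleftrightarrow>
     (\<forall>\<delta>\<in>{0<..<1}. continuous_on UNIV (h \<delta>) \<and> (\<forall>x. 0 < h \<delta> x \<and> h \<delta> x \<le> \<delta> * T)) \<and>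
     (\<exists>\<alpha>>0. \<exists>\<beta>>0. \<forall>\<delta>\<in>{0<..<1}. \<forall>x y.
        x \<bullet> f x y + 1/2 * h \<delta> x * (norm (f x y))\<^sup>2 \<le> \<alpha> * ((norm x)\<^sup>2 + (norm y)\<^sup>2) + \<beta>)"


section \<open>The adaptive scheme, pathwise\<close>

text \<open>Everything here is a functional of one initial path \<open>\<xi>\<close> and one driving path \<open>w\<close>. The
  recursion is not stopped once \<open>t\<^sub>n \<ge> T\<close>; this does not affect the approximation on \<open>[0, T]\<close>.

  The delayed value in step \<open>n\<close> may lie in any earlier step, so the recursion carries, along with
  \<open>t\<^sub>n\<close>, the step process built so far: its values up to time \<open>t\<^sub>n\<close> (from the initial path and the
  first \<open>n\<close> steps), extended constantly after \<open>t\<^sub>n\<close>.\<close>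

context
  fixes f :: "real ^ 'm \<Rightarrow> real ^ 'm \<Rightarrow> real ^ 'm"
    and g :: "real ^ 'm \<Rightarrow> real ^ 'm \<Rightarrow> real ^ 'd ^ 'm"
    and h :: "real ^ 'm \<Rightarrow> real"
    and \<tau> :: real
    and \<xi> :: "real \<Rightarrow> real ^ 'm"
    and w :: "real \<Rightarrow> real ^ 'd"
begin

primrec em_state :: "nat \<Rightarrow> real \<times> (real \<Rightarrow> real ^ 'm)" where
  "em_state 0 = (0, \<lambda>s. if s < 0 then \<xi> s else \<xi> 0)"
| "em_state (Suc n) =
     (let (t, Z) = em_state n;
          x = Z t;
          y = Z (t - \<tau>);
          t' = t + h x;
          x' = x + h x *\<^sub>R f x y + g x y *v (w t' - w t)
      in (t', \<lambda>s. if s < t' then Z s else x'))"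

definition em_time :: "nat \<Rightarrow> real" where
  "em_time n = fst (em_state n)"

definition em_val :: "nat \<Rightarrow> real ^ 'm" where
  "em_val n = snd (em_state n) (em_time n)"

definition em_idx :: "real \<Rightarrow> nat" where
  "em_idx s = (LEAST n. s < em_time (Suc n))"

definition em_bar :: "real \<Rightarrow> real ^ 'm" where
  "em_bar s = (if s < 0 then \<xi> s else em_val (em_idx s))"

definition em_delay :: "real \<Rightarrow> real ^ 'm" where
  "em_delay u = em_bar (em_time (em_idx (u + \<tau>)) - \<tau>)"

end

text \<open>The stochastic integral \<open>\<integral>\<^sub>0\<^sup>t G\<^sub>s dW\<^sub>s\<close> along a path, for an integrand that is constant on
  each interval \<open>[\<sigma>\<^sub>n, \<sigma>\<^sub>n\<^sub>+\<^sub>1)\<close> of a grid of stopping times: the Ito integral of such a step process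
  is by definition the sum of its values times the increments of the integrator, stopped at \<open>t\<close>.
  All but finitely many terms vanish as soon as the grid passes \<open>t\<close>.\<close>

definition step_integral ::
  "(nat \<Rightarrow> real) \<Rightarrow> (real \<Rightarrow> real ^ 'd ^ 'm) \<Rightarrow> (real \<Rightarrow> real ^ 'd) \<Rightarrow> real \<Rightarrow> real ^ 'm" where
  "step_integral \<sigma> G w t = (\<Sum>n. G (\<sigma> n) *v (w (min t (\<sigma> (Suc n))) - w (min t (\<sigma> n))))"

definition em_cont ::
  "(real ^ 'm \<Rightarrow> real ^ 'm \<Rightarrow> real ^ 'm) \<Rightarrow> (real ^ 'm \<Rightarrow> real ^ 'm \<Rightarrow> real ^ 'd ^ 'm) \<Rightarrow>
   (real ^ 'm \<Rightarrow> real) \<Rightarrow> real \<Rightarrow> (real \<Rightarrow> real ^ 'm) \<Rightarrow> (real \<Rightarrow> real ^ 'd) \<Rightarrow> real \<Rightarrow> real ^ 'm" where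
  "em_cont f g h \<tau> \<xi> w t =
     (if t \<le> 0 then \<xi> t
      else
        let Xbar = em_bar f g h \<tau> \<xi> w; Xtilde = em_delay f g h \<tau> \<xi> w in
        \<xi> 0 + (LINT s:{0..t}|lborel. f (Xbar s) (Xtilde (s - \<tau>)))
            + step_integral (em_time f g h \<tau> \<xi> w) (\<lambda>s. g (Xbar s) (Xtilde (s - \<tau>))) w t)"

definition attainable ::
  "'w measure \<Rightarrow> (real ^ 'm \<Rightarrow> real ^ 'm \<Rightarrow> real ^ 'm) \<Rightarrow>
   (real ^ 'm \<Rightarrow> real ^ 'm \<Rightarrow> real ^ 'd ^ 'm) \<Rightarrow> (real ^ 'm \<Rightarrow> real) \<Rightarrow> real \<Rightarrow>
   ('w \<Rightarrow> real \<Rightarrow> real ^ 'm) \<Rightarrow> (real \<Rightarrow> 'w \<Rightarrow> real ^ 'd) \<Rightarrow> real \<Rightarrow> bool" where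
  "attainable M f g h \<tau> \<xi> W T \<longleftrightarrow>
     (AE \<omega> in M. \<exists>N. em_time f g h \<tau> (\<xi> \<omega>) (\<lambda>t. W t \<omega>) N \<ge> T)"


subsection \<open>The defining equations of the scheme\<close>

context
  fixes f :: "real ^ 'm \<Rightarrow> real ^ 'm \<Rightarrow> real ^ 'm"
    and g :: "real ^ 'm \<Rightarrow> real ^ 'm \<Rightarrow> real ^ 'd ^ 'm"
    and h :: "real ^ 'm \<Rightarrow> real"
    and \<tau> :: real
    and \<xi> :: "real \<Rightarrow> real ^ 'm"
    and w :: "real \<Rightarrow> real ^ 'd"
  assumes h_pos: "\<And>x. 0 < h x" and tau_pos: "0 < \<tau>"
begin

private abbreviation "st \<equiv> em_state f g h \<tau> \<xi> w"
private abbreviation "tm \<equiv> em_time f g h \<tau> \<xi> w"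
private abbreviation "vl \<equiv> em_val f g h \<tau> \<xi> w"
private abbreviation "br \<equiv> em_bar f g h \<tau> \<xi> w"
private abbreviation "dl \<equiv> em_delay f g h \<tau> \<xi> w"

lemma em_time_0: "tm 0 = 0"
  by (simp add: em_time_def)

lemma em_val_0: "vl 0 = \<xi> 0"
  by (simp add: em_val_def em_time_def)

lemma em_time_Suc: "tm (Suc n) = tm n + h (vl n)"
  by (simp add: em_time_def em_val_def Let_def split_beta)

lemma em_time_strict_mono: "strict_mono tm"
  by (rule strict_monoI_Suc) (simp add: em_time_Suc h_pos)

lemma em_time_nonneg: "0 \<le> tm n"
  using strict_mono_less_eq[OF em_time_strict_mono, of 0 n] by (simp add: em_time_0)

lemma em_idx_eq:
  assumes "tm n \<le> s" "s < tm (Suc n)"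
  shows "em_idx f g h \<tau> \<xi> w s = n"
  unfolding em_idx_def
proof (rule Least_equality)
  fix k assume "s < tm (Suc k)"
  with assms have "tm n < tm (Suc k)" by simp
  then show "n \<le> k" using strict_mono_less[OF em_time_strict_mono] by fastforce
qed (use assms in simp)

lemma em_bar_neg: "s < 0 \<Longrightarrow> br s = \<xi> s"
  by (simp add: em_bar_def)

lemma em_bar_step:
  assumes "tm n \<le> s" "s < tm (Suc n)"
  shows "br s = vl n"
  using em_idx_eq[OF assms] assms em_time_nonneg[of n] by (simp add: em_bar_def)

lemma em_bar_time: "br (tm n) = vl n"
  by (rule em_bar_step) (simp_all add: em_time_Suc h_pos)

lemma em_delay_step:
  assumes "tm n - \<tau> \<le> s" "s < tm (Suc n) - \<tau>"
  shows "dl s = br (tm n - \<tau>)"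
  using em_idx_eq[of n "s + \<tau>"] assms by (simp add: em_delay_def)

private lemma em_state_path:
  assumes "s < tm (Suc n)"
  shows "snd (st n) s = br s"
  using assms
proof (induction n)
  case 0
  then show ?case
    using em_bar_step[of 0 s] by (auto simp: em_bar_neg em_time_0 em_val_0)
next
  case (Suc n)
  have upd: "snd (st (Suc n)) s =
      (if s < tm (Suc n) then snd (st n) s else snd (st (Suc n)) (tm (Suc n)))" for s
    by (simp add: em_time_def Let_def split_beta)
  show ?case
  proof (cases "s < tm (Suc n)")
    case True
    then show ?thesis using Suc.IH upd[of s] by simp
  next
    case False
    then show ?thesis
      using upd[of s] em_bar_step[of "Suc n" s] Suc.prems by (simp add: em_val_def)
  qed
qed

lemma em_val_Suc:
  "vl (Suc n) = vl n + h (vl n) *\<^sub>R f (br (tm n)) (br (tm n - \<tau>))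
     + g (br (tm n)) (br (tm n - \<tau>)) *v (w (tm (Suc n)) - w (tm n))"
proof -
  have "tm n < tm (Suc n)" by (simp add: em_time_Suc h_pos)
  then have "snd (st n) (tm n) = br (tm n)" "snd (st n) (tm n - \<tau>) = br (tm n - \<tau>)"
    using em_state_path[of _ n] tau_pos by simp_all
  then show ?thesis
    using em_bar_time[of n]
    by (simp add: em_val_def[of _ _ _ _ _ _ "Suc n"] em_time_def Let_def split_beta)
qed

private abbreviation "dr \<equiv> \<lambda>s. f (br s) (dl (s - \<tau>))"
private abbreviation "cf \<equiv> \<lambda>n. f (br (tm n)) (br (tm n - \<tau>))"

private lemma drift_block:
  assumes "tm n \<le> t" "t \<le> tm (Suc n)"
  shows "set_integrable lborel {tm n..<t} dr"
    and "(LINT s:{tm n..<t}|lborel. dr s) = (t - tm n) *\<^sub>R cf n"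
proof -
  have *: "dr s = cf n" if "s \<in> {tm n..<t}" for s
  proof -
    from that assms have s: "tm n \<le> s" "s < tm (Suc n)" by auto
    then have "dl (s - \<tau>) = br (tm n - \<tau>)" by (intro em_delay_step) auto
    with em_bar_step[OF s] show ?thesis by (simp add: em_bar_time)
  qed
  have "set_integrable lborel {tm n..<t} (\<lambda>_. cf n)"
    unfolding set_integrable_def
    by (rule integrable_real_indicator[THEN integrable_scaleR_left]) (use assms in auto)
  moreover have "set_integrable lborel {tm n..<t} dr \<longleftrightarrow> set_integrable lborel {tm n..<t} (\<lambda>_. cf n)"
    by (rule set_integrable_cong) (use * in auto)
  ultimately show "set_integrable lborel {tm n..<t} dr" by simp
  have "(LINT s:{tm n..<t}|lborel. dr s) = (LINT s:{tm n..<t}|lborel. cf n)"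
    by (rule set_lebesgue_integral_cong) (use * in auto)
  also have "\<dots> = (t - tm n) *\<^sub>R cf n"
    using assms by (simp add: set_lebesgue_integral_def)
  finally show "(LINT s:{tm n..<t}|lborel. dr s) = (t - tm n) *\<^sub>R cf n" .
qed

private lemma drift_extend:
  assumes "tm n \<le> t" "t \<le> tm (Suc n)" "set_integrable lborel {0..<tm n} dr"
  shows "set_integrable lborel {0..<t} dr"
    and "(LINT s:{0..<t}|lborel. dr s) = (LINT s:{0..<tm n}|lborel. dr s) + (t - tm n) *\<^sub>R cf n"
proof -
  have U: "{0..<t} = {0..<tm n} \<union> {tm n..<t}"
    using assms(1) em_time_nonneg[of n] by auto
  show "set_integrable lborel {0..<t} dr"
    unfolding U by (rule set_integrable_Un) (use assms drift_block in auto)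
  have "(LINT s:{0..<tm n} \<union> {tm n..<t}|lborel. dr s) =
      (LINT s:{0..<tm n}|lborel. dr s) + (LINT s:{tm n..<t}|lborel. dr s)"
    by (rule set_integral_Un) (use assms drift_block in auto)
  with U drift_block(2)[OF assms(1,2)]
  show "(LINT s:{0..<t}|lborel. dr s) = (LINT s:{0..<tm n}|lborel. dr s) + (t - tm n) *\<^sub>R cf n"
    by simp
qed

private lemma drift_grid: "set_integrable lborel {0..<tm n} dr"
proof (induction n)
  case 0
  then show ?case by (simp add: em_time_0 set_integrable_def)
next
  case (Suc n)
  show ?case
    by (rule drift_extend(1)[OF _ _ Suc.IH]) (simp_all add: em_time_Suc h_pos less_imp_le)
qed

lemma em_cont_step:
  assumes "tm n \<le> t" "t \<le> tm (Suc n)"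
  shows "em_cont f g h \<tau> \<xi> w t =
    vl n + (t - tm n) *\<^sub>R f (br (tm n)) (br (tm n - \<tau>))
      + g (br (tm n)) (br (tm n - \<tau>)) *v (w t - w (tm n))"
proof -
  let ?c = "\<lambda>k. g (br (tm k)) (br (tm k - \<tau>))"
  have mono: "tm i \<le> tm j" if "i \<le> j" for i j
    using strict_mono_less_eq[OF em_time_strict_mono] that by simp
  have dl: "dl (tm k - \<tau>) = br (tm k - \<tau>)" for k
    by (rule em_delay_step) (simp_all add: em_time_Suc h_pos)
  have "step_integral tm (\<lambda>s. g (br s) (dl (s - \<tau>))) w t
      = (\<Sum>k. ?c k *v (w (min t (tm (Suc k))) - w (min t (tm k))))"
    by (simp add: step_integral_def dl)
  also have "\<dots> = (\<Sum>k<Suc n. ?c k *v (w (min t (tm (Suc k))) - w (min t (tm k))))"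
  proof (rule suminf_finite)
    fix k assume "k \<notin> {..<Suc n}"
    then have "t \<le> tm k" "t \<le> tm (Suc k)"
      using assms(2) mono[of "Suc n" k] mono[of "Suc n" "Suc k"] by auto
    then show "?c k *v (w (min t (tm (Suc k))) - w (min t (tm k))) = 0" by simp
  qed simp
  also have "\<dots> = (\<Sum>k<n. ?c k *v (w (tm (Suc k)) - w (tm k))) + ?c n *v (w t - w (tm n))"
  proof -
    have "min t (tm k) = tm k" if "k \<le> n" for k
      using mono[OF that] assms(1) by simp
    moreover have "min t (tm (Suc n)) = t" using assms(2) by simp
    ultimately show ?thesis by simp
  qed
  finally have stoch: "step_integral tm (\<lambda>s. g (br s) (dl (s - \<tau>))) w t = \<dots>" .

  have val: "vl k = \<xi> 0 + (LINT s:{0..<tm k}|lborel. dr s)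
      + (\<Sum>j<k. ?c j *v (w (tm (Suc j)) - w (tm j)))" for k
  proof (induction k)
    case 0
    then show ?case by (simp add: em_val_0 em_time_0 set_lebesgue_integral_def)
  next
    case (Suc k)
    have "(LINT s:{0..<tm (Suc k)}|lborel. dr s) =
        (LINT s:{0..<tm k}|lborel. dr s) + h (vl k) *\<^sub>R cf k"
      using drift_extend(2)[OF _ order_refl drift_grid, of k] mono[of k "Suc k"]
      by (simp add: em_time_Suc)
    with Suc.IH em_val_Suc[of k] show ?case by simp
  qed

  have "(LINT s:{0..t}|lborel. dr s) = (LINT s:{0..<t}|lborel. dr s)"
    unfolding set_lebesgue_integral_def
    by (rule integral_discrete_difference[of "{t}"]) (auto simp: indicator_def)
  also have "\<dots> = (LINT s:{0..<tm n}|lborel. dr s) + (t - tm n) *\<^sub>R cf n"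
    by (rule drift_extend(2)[OF assms drift_grid])
  finally have drift: "(LINT s:{0..t}|lborel. dr s) = \<dots>" .

  show ?thesis
  proof (cases "t \<le> 0")
    case True
    then have "tm n = 0" "t = 0"
      using assms em_time_nonneg[of n] by auto
    moreover from this have "n = 0"
      using strict_mono_eq[OF em_time_strict_mono, of n 0] by (simp add: em_time_0)
    ultimately show ?thesis by (simp add: em_cont_def em_val_0)
  next
    case False
    then show ?thesis
      using stoch drift val[of n] by (simp add: em_cont_def Let_def)
  qed
qed

corollary em_cont_time: "em_cont f g h \<tau> \<xi> w (tm n) = vl n"
  using em_cont_step[of n "tm n"] by (simp add: em_time_Suc h_pos less_imp_le)

end

end

theory Submission
  imports Defs
begin

text \<open>Along the random grid, \<open>X\<^sub>n\<^sub>+\<^sub>1 = \<phi>\<^sub>n + g\<^sub>n \<Delta>W\<^sub>n\<close> with \<open>\<phi>\<^sub>n = X\<^sub>n + h\<^sub>n f\<^sub>n\<close>, and Assumption B says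
  exactly that \<open>|\<phi>\<^sub>n|\<^sup>2 \<le> |X\<^sub>n|\<^sup>2 + 2 h\<^sub>n (\<alpha> (|X\<^sub>n|\<^sup>2 + |Y\<^sub>n|\<^sup>2) + \<beta>)\<close>, \<open>Y\<^sub>n\<close> being the delayed value. Since the
  grid times are stopping times and \<open>t\<^sub>n\<^sub>+\<^sub>1\<close> is known at time \<open>t\<^sub>n\<close>, every even power
  \<open>exp (- C t\<^sub>n) |X\<^sub>n|\<^bsup>2q\<^esup>\<close> is a supermartingale up to the delay terms \<open>C h\<^sub>n (1 + |Y\<^sub>n|\<^bsup>2q\<^esup>)\<close>. The weak
  maximal inequality bounds the tail of \<open>max |X\<^sub>n|\<close> by a power; as all powers are available, losing
  two of them in passing from tails to moments is harmless, so neither Doob's \<open>L\<^sup>p\<close> inequality nor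
  the Burkholder-Davis-Gundy inequality is needed. The delay terms at times up to \<open>(j + 1) \<tau>\<close> involve
  only values at times up to \<open>j \<tau>\<close>, which gives an induction over windows of length \<open>\<tau>\<close>.
  Finiteness of \<open>sup |X\<^sub>n|\<close> keeps the steps bounded below, hence attainability, and inside a step
  \<open>|X\<^sub>t|\<close> is at most a constant times \<open>(1 + max |X\<^sub>n|) (1 + 2 sup |W|)\<close>.\<close>

section \<open>Elementary inequalities and Gaussian increments\<close>

text \<open>Since h may be arbitrarily small, the number of grid points before \<open>T\<close> is
  bounded neither in \<omega> nor in \<delta>, so no estimate may lose a constant per step. Every
  error must carry a factor h, and the steps begun before \<open>K\<close> add up to at most
  \<open>K + T\<close> (\<open>sum_steps_le\<close>). Moments of a single \<open>X n\<close>, with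
  bounds that grow with \<open>n\<close>, are proved only to keep the expectations in the
  supermartingale argument finite. Uniformity in \<delta> comes from constants explicit in
  \<open>T\<close>, \<tau>, \<open>L\<close>, the moments of the initial datum and the Gaussian
  constant \<open>c\<close> of \<open>increment_bound\<close>; the step function enters only through
  \<open>h x \<le> T\<close> and the growth bounds of \<open>em_scheme\<close>. As each window costs
  two powers, the induction over windows treats all even powers at once. In place of conditional
  expectations, the one-step estimate carries a weight known at the start of the step; it holds the
  discount and the indicator that the level has not been reached. Exceptional null sets are removed
  beforehand by modifying \<open>W\<close>, so that path properties hold at every \<omega>;
  completeness of the measure brings measurability back to the original \<open>W\<close>.\<close>

lemma power_mult_power_le:
  fixes r s :: real
  assumes "0 \<le> r" "0 \<le> s"
  shows "r ^ i * s ^ j \<le> r ^ (i + j) + s ^ (i + j)"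
proof (cases "r \<le> s")
  case True
  then have "r ^ i * s ^ j \<le> s ^ i * s ^ j"
    using assms by (intro mult_right_mono power_mono) auto
  with assms show ?thesis by (simp add: power_add add_increasing)
next
  case False
  then have "r ^ i * s ^ j \<le> r ^ i * r ^ j"
    using assms by (intro mult_left_mono power_mono) auto
  with assms show ?thesis by (simp add: power_add add_increasing2)
qed

text \<open>A second-order Taylor expansion in \<open>b\<close> that keeps the linear term exactly:
  it has mean zero once \<open>b\<close> is a centred increment. Even powers are polynomials in the
  square of the norm, so the induction just multiplies by that square of
  \<open>a + b\<close>.\<close>

lemma norm_add_power_le:
  "\<exists>C\<ge>0. \<forall>a b :: 'a :: real_inner. norm (a + b) ^ (2 * k + 2) \<le>
     norm a ^ (2 * k + 2) + real (2 * k + 2) * norm a ^ (2 * k) * (a \<bullet> b)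
     + C * (norm a ^ (2 * k) * norm b ^ 2 + norm b ^ (2 * k + 2))"
proof (induction k)
  case 0
  have "norm (a + b) ^ 2 = norm a ^ 2 + 2 * (a \<bullet> b) + norm b ^ 2" for a b :: 'a
    by (simp add: power2_norm_eq_inner inner_add_left inner_add_right inner_commute)
  then show ?case by (intro exI[of _ 1]) (auto simp: numeral_2_eq_2[symmetric])
next
  case (Suc k)
  then obtain C where C: "C \<ge> 0" and IH: "\<And>a b :: 'a. norm (a + b) ^ (2 * k + 2) \<le>
     norm a ^ (2 * k + 2) + real (2 * k + 2) * norm a ^ (2 * k) * (a \<bullet> b)
     + C * (norm a ^ (2 * k) * norm b ^ 2 + norm b ^ (2 * k + 2))" by blast
  \<comment> \<open>The three summands pay for three groups of error terms: the term
    \<open>r ^ (2 * k + 2) * s ^ 2\<close>, then \<open>e2\<close>, then \<open>e3\<close>.\<close>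
  define D where "D = 1 + (2 * real k + 2) * 3 + 8 * C"
  show ?case
  proof (intro exI[of _ D] conjI allI)
    show "0 \<le> D" using C by (simp add: D_def)
    fix a b :: 'a
    define r s p where "r = norm a" and "s = norm b" and "p = a \<bullet> b"
    have r: "0 \<le> r" and s: "0 \<le> s" by (auto simp: r_def s_def)
    have p: "\<bar>p\<bar> \<le> r * s" unfolding r_def s_def p_def by (rule Cauchy_Schwarz_ineq2)
    have n: "norm (a + b) ^ 2 = r ^ 2 + 2 * p + s ^ 2"
      unfolding r_def s_def p_def
      by (simp add: power2_norm_eq_inner inner_add_left inner_add_right inner_commute)
    have p4: "x ^ (2 * k + 4) = x ^ (2 * k + 2) * x ^ 2" for x :: real
    proof -
      have "2 * k + 4 = 2 * k + 2 + 2" by simp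
      then show ?thesis by (simp only: power_add)
    qed
    have rs2: "2 * (r * s) \<le> r ^ 2 + s ^ 2"
      using sum_squares_bound[of r s] by simp
    \<comment> \<open>Every error monomial has degree 2k+4 and at least two factors
      \<open>s\<close>; by \<open>ij\<close> each such monomial is at most \<open>E\<close>.\<close>
    define E where "E = r ^ (2 * k + 2) * s ^ 2 + s ^ (2 * k + 4)"
    have ij: "r ^ i * s ^ (j + 2) \<le> E" if "i + j = 2 * k + 2" for i j
    proof -
      have "(r ^ i * s ^ j) * s ^ 2 \<le> (r ^ (i + j) + s ^ (i + j)) * s ^ 2"
        by (intro mult_right_mono power_mult_power_le r s) simp
      moreover have "s ^ (2 * k + 2) * s ^ 2 = s ^ (2 * k + 4)"
        by (rule p4[symmetric])
      moreover have "r ^ i * s ^ j * s ^ 2 = r ^ i * s ^ (j + 2)"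
        by (simp only: power_add mult.assoc)
      ultimately show ?thesis
        by (simp only: that E_def distrib_right)
    qed
    have e1: "r ^ (2 * k + 2) * s ^ 2 \<le> E" using ij[of "2 * k + 2" 0] by (simp add: numeral_2_eq_2)
    have e2: "r ^ (2 * k) * (2 * (p * p) + p * s ^ 2) \<le> 3 * E"
    proof -
      have "p * p \<le> (r * s) * (r * s)"
        using mult_mono[OF p p] r s by simp
      moreover have "p * s ^ 2 \<le> (r * s) * s ^ 2"
        using p by (intro mult_right_mono) auto
      ultimately have "r ^ (2 * k) * (2 * (p * p) + p * s ^ 2)
          \<le> r ^ (2 * k) * (2 * ((r * s) * (r * s)) + (r * s) * s ^ 2)"
        using r by (intro mult_left_mono) auto
      also have "\<dots> = 2 * (r ^ (2 * k + 2) * s ^ 2) + r ^ (2 * k + 1) * s ^ 3"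
        by (simp add: power_add algebra_simps power2_eq_square power3_eq_cube)
      also have "\<dots> \<le> 3 * E"
        using ij[of "2 * k + 2" 0] ij[of "2 * k + 1" 1] by (simp add: numeral_3_eq_3 power2_eq_square)
      finally show ?thesis .
    qed
    have e3: "(r ^ (2 * k) * s ^ 2 + s ^ (2 * k + 2)) * (r ^ 2 + 2 * p + s ^ 2) \<le> 8 * E"
    proof -
      have "(r ^ (2 * k) * s ^ 2 + s ^ (2 * k + 2)) * (r ^ 2 + 2 * p + s ^ 2)
          \<le> (r ^ (2 * k) * s ^ 2 + s ^ (2 * k + 2)) * (2 * (r ^ 2 + s ^ 2))"
        using p rs2 r s by (intro mult_left_mono) auto
      also have "\<dots> = 2 * (r ^ (2 * k + 2) * s ^ 2) + 2 * (r ^ (2 * k) * s ^ 4)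
          + 2 * (r ^ 2 * s ^ (2 * k + 2)) + 2 * s ^ (2 * k + 4)"
        by (simp add: power_add algebra_simps power2_eq_square power4_eq_xxxx)
      also have "\<dots> \<le> 8 * E"
        using ij[of "2 * k + 2" 0] ij[of "2 * k" 2] ij[of 2 "2 * k"] ij[of 0 "2 * k + 2"]
        by (simp add: numeral_eq_Suc)
      finally show ?thesis .
    qed
    have "norm (a + b) ^ (2 * k + 4) = norm (a + b) ^ (2 * k + 2) * (r ^ 2 + 2 * p + s ^ 2)"
      unfolding n[symmetric] by (rule p4)
    also have "\<dots> \<le> (r ^ (2 * k + 2) + (2 * k + 2) * r ^ (2 * k) * p
        + C * (r ^ (2 * k) * s ^ 2 + s ^ (2 * k + 2))) * (r ^ 2 + 2 * p + s ^ 2)"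
      using IH[of a b] n unfolding r_def s_def p_def
      by (intro mult_right_mono) (auto simp: n[symmetric, unfolded r_def s_def p_def])
    also have "\<dots> = r ^ (2 * k + 4) + (2 * k + 4) * r ^ (2 * k + 2) * p + r ^ (2 * k + 2) * s ^ 2
        + (2 * k + 2) * (r ^ (2 * k) * (2 * (p * p) + p * s ^ 2))
        + C * ((r ^ (2 * k) * s ^ 2 + s ^ (2 * k + 2)) * (r ^ 2 + 2 * p + s ^ 2))"
      by (simp add: power_add algebra_simps power2_eq_square power4_eq_xxxx)
    also have "\<dots> \<le> r ^ (2 * k + 4) + (2 * k + 4) * r ^ (2 * k + 2) * p + E
        + (2 * k + 2) * (3 * E) + C * (8 * E)"
      by (intro add_mono mult_left_mono e1 e2 e3 C order_refl) simp
    also have "\<dots> = r ^ (2 * k + 4) + (2 * k + 4) * r ^ (2 * k + 2) * p + D * E"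
      by (simp add: D_def algebra_simps)
    finally have *: "norm (a + b) ^ (2 * k + 4) \<le>
        r ^ (2 * k + 4) + real (2 * k + 4) * r ^ (2 * k + 2) * p + D * E"
      .
    then show "norm (a + b) ^ (2 * Suc k + 2) \<le>
       norm a ^ (2 * Suc k + 2) + real (2 * Suc k + 2) * norm a ^ (2 * Suc k) * (a \<bullet> b)
       + D * (norm a ^ (2 * Suc k) * norm b ^ 2 + norm b ^ (2 * Suc k + 2))"
      unfolding E_def r_def s_def p_def by (simp add: numeral_eq_Suc algebra_simps)
  qed
qed

lemma norm_matrix_vector_mult_le:
  fixes A :: "real ^ 'n ^ 'm"
  shows "norm (A *v x) \<le> norm A * norm x"
proof -
  have "norm (A *v x) = L2_set (\<lambda>i. norm ((A *v x) $ i)) UNIV" by (simp add: norm_vec_def)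
  also have "\<dots> \<le> L2_set (\<lambda>i. norm (A $ i) * norm x) UNIV"
    by (intro L2_set_mono) (auto simp: matrix_vector_mul_component Cauchy_Schwarz_ineq2)
  also have "\<dots> = norm A * norm x"
    by (simp add: L2_set_left_distrib norm_vec_def)
  finally show ?thesis .
qed

text \<open>Splits the linear term into scalar products of a coefficient known beforehand with one
  coordinate of the increment, which is the form in which independence and centring are
  available.\<close>

lemma inner_matrix_vector_mult_axis:
  fixes A :: "real ^ 'n ^ 'm"
  shows "a \<bullet> (A *v z) = (\<Sum>l\<in>UNIV. (a \<bullet> (A *v axis l 1)) * z $ l)"
  by (simp add: dot_lmul_matrix[symmetric] inner_axis inner_vec_def[of "_ v* _"])

text \<open>The squared norm is at most the dimension times the largest squared coordinate. This
  reduces moments of a vector to those of its one-dimensional marginals.\<close>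

lemma norm_power_le_sum:
  fixes z :: "real ^ 'n"
  shows "norm z ^ (2 * q) \<le> real CARD('n) ^ q * (\<Sum>l\<in>UNIV. (z $ l) ^ (2 * q))"
proof -
  obtain m where m: "\<And>l. (z $ l)\<^sup>2 \<le> (z $ m)\<^sup>2"
  proof -
    have "Max (range (\<lambda>l. (z $ l)\<^sup>2)) \<in> range (\<lambda>l. (z $ l)\<^sup>2)" by (intro Max_in) auto
    then obtain m where "Max (range (\<lambda>l. (z $ l)\<^sup>2)) = (z $ m)\<^sup>2" by (elim imageE)
    moreover have "(z $ l)\<^sup>2 \<le> Max (range (\<lambda>l. (z $ l)\<^sup>2))" for l by (intro Max_ge) auto
    ultimately show ?thesis using that by metis
  qed
  have "(norm z)\<^sup>2 = (\<Sum>l\<in>UNIV. (z $ l)\<^sup>2)"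
    by (simp add: norm_vec_def L2_set_def sum_nonneg)
  also have "\<dots> \<le> real CARD('n) * (z $ m)\<^sup>2"
    using sum_bounded_above[of UNIV "\<lambda>l. (z $ l)\<^sup>2", OF m] by simp
  finally have "((norm z)\<^sup>2) ^ q \<le> (real CARD('n) * (z $ m)\<^sup>2) ^ q"
    by (intro power_mono) auto
  also have "\<dots> = real CARD('n) ^ q * (z $ m) ^ (2 * q)"
    by (simp add: power_mult_distrib power_mult)
  also have "\<dots> \<le> real CARD('n) ^ q * (\<Sum>l\<in>UNIV. (z $ l) ^ (2 * q))"
    by (intro mult_left_mono member_le_sum) (auto simp: power_mult)
  finally show ?thesis by (simp add: power_mult)
qed

section \<open>Moments of Gaussian increments and the one-step estimate at deterministic
  times\<close>

context prob_space
begin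

text \<open>\<open>fact (2 * q) / (2 ^ q * fact q)\<close> is the Gaussian moment (2q-1)!!. Of the
  q+1 factors \<open>CARD('n)\<close>, q come from \<open>norm_power_le_sum\<close> and one from
  adding up the coordinates.\<close>

lemma normal_vector_moments:
  fixes Z :: "'a \<Rightarrow> real ^ 'n"
  assumes u: "0 < u" and Zm[measurable]: "Z \<in> borel_measurable M"
    and Z: "\<And>l. distributed M lborel (\<lambda>\<omega>. Z \<omega> $ l) (normal_density 0 (sqrt u))"
  shows "integrable M (\<lambda>\<omega>. Z \<omega> $ l)" "(LINT \<omega>|M. Z \<omega> $ l) = 0"
    "integrable M (\<lambda>\<omega>. norm (Z \<omega>) ^ (2 * q))"
    "(LINT \<omega>|M. norm (Z \<omega>) ^ (2 * q)) \<le> real CARD('n) ^ Suc q * fact (2 * q) / (2 ^ q * fact q) * u ^ q"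
proof -
  have su: "0 < sqrt u" using u by simp
  show "integrable M (\<lambda>\<omega>. Z \<omega> $ l)"
    using distributed_integrable[OF Z, of "\<lambda>x. x"] integrable_normal_moment[OF su, of 0 1] by simp
  show "(LINT \<omega>|M. Z \<omega> $ l) = 0"
    using distributed_integral[OF Z, of "\<lambda>x. x"] integral_normal_moment_odd[OF su, of 0 0] by simp
  have i: "integrable M (\<lambda>\<omega>. (Z \<omega> $ l) ^ (2 * q))" for l
    using distributed_integrable[OF Z, of "\<lambda>x. x ^ (2 * q)"]
      integrable_normal_moment[OF su, of 0 "2 * q"] by simp
  have e: "(LINT \<omega>|M. (Z \<omega> $ l) ^ (2 * q)) = fact (2 * q) / (2 ^ q * fact q) * u ^ q" for l
    using distributed_integral[OF Z, of "\<lambda>x. x ^ (2 * q)"]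
      integral_normal_moment_even[OF su, of 0 q] u by (simp add: power_divide field_simps)
  have is_sum: "integrable M (\<lambda>\<omega>. real CARD('n) ^ q * (\<Sum>l\<in>UNIV. (Z \<omega> $ l) ^ (2 * q)))"
    by (intro integrable_mult_right Bochner_Integration.integrable_sum i)
  show int: "integrable M (\<lambda>\<omega>. norm (Z \<omega>) ^ (2 * q))"
    by (rule Bochner_Integration.integrable_bound[OF is_sum])
       (auto simp: order_trans[OF norm_power_le_sum] abs_ge_self)
  have "(LINT \<omega>|M. norm (Z \<omega>) ^ (2 * q)) \<le>
      (LINT \<omega>|M. real CARD('n) ^ q * (\<Sum>l\<in>UNIV. (Z \<omega> $ l) ^ (2 * q)))"
    by (intro integral_mono int is_sum norm_power_le_sum)
  also have "\<dots> = real CARD('n) ^ Suc q * fact (2 * q) / (2 ^ q * fact q) * u ^ q"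
    by (simp add: Bochner_Integration.integral_sum i e)
  finally show "(LINT \<omega>|M. norm (Z \<omega>) ^ (2 * q)) \<le> \<dots>" .
qed

text \<open>The Brownian hypothesis speaks of sigma-algebras, the product formula for expectations
  of random variables. The sigma-algebras generated by \<open>c\<close> and by \<open>\<phi>\<close>
  of \<open>Z\<close> lie inside the two independent ones.\<close>

lemma indep_var_of_subalgebra:
  assumes sub: "subalgebra M G"
    and ind: "indep_set (sets G) (sets (vimage_algebra (space M) Z borel))"
    and Zm: "Z \<in> borel_measurable M"
    and c: "c \<in> borel_measurable G" and \<phi>: "\<phi> \<in> borel_measurable borel"
  shows "indep_var borel c borel (\<lambda>\<omega>. \<phi> (Z \<omega>))"
proof -
  have sp: "space G = space M" and le: "sets G \<subseteq> sets M" using sub by (auto simp: subalgebra_def)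
  have cM: "c \<in> borel_measurable M" using measurable_from_subalg[OF sub c] .
  have \<phi>V: "(\<lambda>\<omega>. \<phi> (Z \<omega>)) \<in> borel_measurable (vimage_algebra (space M) Z borel)"
    by (rule measurable_compose[OF _ \<phi>]) (rule measurable_vimage_algebra1, auto)
  have 1: "sigma_sets (space M) {c -` A \<inter> space M |A. A \<in> sets borel} \<subseteq> sets G"
    using measurable_sets[OF c] sp
    by (intro sets.sigma_sets_subset[of _ G, unfolded sp]) auto
  have 2: "sigma_sets (space M) {(\<lambda>\<omega>. \<phi> (Z \<omega>)) -` A \<inter> space M |A. A \<in> sets borel}
      \<subseteq> sets (vimage_algebra (space M) Z borel)"
    using measurable_sets[OF \<phi>V]
    by (intro sets.sigma_sets_subset[of _ "vimage_algebra (space M) Z borel", simplified]) auto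
  show ?thesis
    unfolding indep_var_eq
  proof (intro conjI cM measurable_compose[OF Zm \<phi>])
    show "indep_set (sigma_sets (space M) {c -` A \<inter> space M |A. A \<in> sets borel})
        (sigma_sets (space M) {(\<lambda>\<omega>. \<phi> (Z \<omega>)) -` A \<inter> space M |A. A \<in> sets borel})"
      using ind 1 2 unfolding indep_sets2_eq by (meson subset_iff)
  qed
qed

text \<open>Expectation of \<open>norm_add_power_le\<close> with \<open>b\<close> the product of
  \<open>A\<close> and \<open>Z\<close>. The linear term vanishes and the remainder has at least two
  factors \<open>Z\<close>, which yields a factor \<open>u\<close>. The constant is chosen before
  all processes, so it depends only on \<open>k\<close>, \<open>U\<close> and the
  dimensions.\<close>

lemma gaussian_step:
  "\<exists>C\<ge>0. \<forall>G (Z :: 'a \<Rightarrow> real ^ 'n) (a :: 'a \<Rightarrow> real ^ 'm) A R wt u.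
     subalgebra M G \<longrightarrow> indep_set (sets G) (sets (vimage_algebra (space M) Z borel)) \<longrightarrow>
     Z \<in> borel_measurable M \<longrightarrow>
     (\<forall>l. distributed M lborel (\<lambda>\<omega>. Z \<omega> $ l) (normal_density 0 (sqrt u))) \<longrightarrow>
     0 < u \<longrightarrow> u \<le> U \<longrightarrow> a \<in> borel_measurable G \<longrightarrow> A \<in> borel_measurable G \<longrightarrow>
     R \<in> borel_measurable G \<longrightarrow> wt \<in> borel_measurable G \<longrightarrow>
     (\<forall>\<omega>. 0 \<le> wt \<omega> \<and> (norm (a \<omega>))\<^sup>2 \<le> R \<omega> \<and> (norm (A \<omega>))\<^sup>2 \<le> R \<omega>) \<longrightarrow>
     (\<integral>\<^sup>+\<omega>. ennreal (wt \<omega> * R \<omega> ^ (k + 1)) \<partial>M) < \<infinity> \<longrightarrow>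
     (\<integral>\<^sup>+\<omega>. ennreal (wt \<omega> * norm (a \<omega> + A \<omega> *v Z \<omega>) ^ (2 * k + 2)) \<partial>M)
       \<le> (\<integral>\<^sup>+\<omega>. ennreal (wt \<omega> * (norm (a \<omega>) ^ (2 * k + 2) + C * u * R \<omega> ^ (k + 1))) \<partial>M)"
proof -
  obtain C0 where C0: "C0 \<ge> 0" and exp: "\<And>a b :: real ^ 'm. norm (a + b) ^ (2 * k + 2) \<le>
     norm a ^ (2 * k + 2) + real (2 * k + 2) * norm a ^ (2 * k) * (a \<bullet> b)
     + C0 * (norm a ^ (2 * k) * norm b ^ 2 + norm b ^ (2 * k + 2))"
    using norm_add_power_le[of k] by blast
  define K where "K q = real CARD('n) ^ Suc q * fact (2 * q) / (2 ^ q * fact q)" for q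
  have K: "0 \<le> K q" for q by (simp add: K_def)
  \<comment> \<open>Because \<open>u \<le> U\<close>, the power \<open>u ^ (k + 1)\<close> of the
    top-order term is at most \<open>U ^ k * u\<close>; the whole error becomes linear in
    \<open>u\<close>.\<close>
  define C where "C = C0 * (K 1 + K (k + 1) * U ^ k)"
  show ?thesis
  \<comment> \<open>For negative \<open>U\<close> the constant \<open>C\<close> could be negative
    while the claim is vacuous; \<open>max 0\<close> covers this case.\<close>
  proof (intro exI[of _ "max 0 C"] conjI allI impI)
    fix G and Z :: "'a \<Rightarrow> real ^ 'n" and a :: "'a \<Rightarrow> real ^ 'm" and A :: "'a \<Rightarrow> real ^ 'n ^ 'm" and R wt and u :: real
    assume sub: "subalgebra M G"
      and ind: "indep_set (sets G) (sets (vimage_algebra (space M) Z borel))"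
      and Zm[measurable]: "Z \<in> borel_measurable M"
      and Z: "\<forall>l. distributed M lborel (\<lambda>\<omega>. Z \<omega> $ l) (normal_density 0 (sqrt u))"
      and u: "0 < u" "u \<le> U"
      and a: "a \<in> borel_measurable G" and A: "A \<in> borel_measurable G"
      and R: "R \<in> borel_measurable G" and wt: "wt \<in> borel_measurable G"
      and bnd: "\<forall>\<omega>. 0 \<le> wt \<omega> \<and> (norm (a \<omega>))\<^sup>2 \<le> R \<omega> \<and> (norm (A \<omega>))\<^sup>2 \<le> R \<omega>"
      and fin: "(\<integral>\<^sup>+\<omega>. ennreal (wt \<omega> * R \<omega> ^ (k + 1)) \<partial>M) < \<infinity>"
    have aM[measurable]: "a \<in> borel_measurable M" and AM[measurable]: "A \<in> borel_measurable M"
      and RM[measurable]: "R \<in> borel_measurable M" and wtM[measurable]: "wt \<in> borel_measurable M"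
      using measurable_from_subalg[OF sub] a A R wt by auto
    have w0: "0 \<le> wt \<omega>" and aR: "(norm (a \<omega>))\<^sup>2 \<le> R \<omega>" and AR: "(norm (A \<omega>))\<^sup>2 \<le> R \<omega>" for \<omega>
      using bnd by auto
    have R0: "0 \<le> R \<omega>" for \<omega> using aR[of \<omega>] by (meson order_trans zero_le_power2)
    have aRk: "norm (a \<omega>) ^ (2 * j) \<le> R \<omega> ^ j" for \<omega> j
      using power_mono[OF aR, of \<omega> j] by (simp add: power_mult)
    have aAR: "norm (a \<omega>) * norm (A \<omega>) \<le> R \<omega>" for \<omega>
      using sum_squares_bound[of "norm (a \<omega>)" "norm (A \<omega>)"] aR[of \<omega>] AR[of \<omega>] by simp
    define c where "c l \<omega> = wt \<omega> * (real (2 * k + 2) * norm (a \<omega>) ^ (2 * k) * (a \<omega> \<bullet> (A \<omega> *v axis l 1)))" for l \<omega>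
    have Aax: "(\<lambda>\<omega>. A \<omega> *v axis l 1) \<in> borel_measurable G" for l
      by (rule measurable_compose[OF A borel_measurable_continuous_onI])
         (auto simp: matrix_vector_mult_def intro!: continuous_intros)
    have cG: "c l \<in> borel_measurable G" for l
      unfolding c_def using a[measurable] wt[measurable] Aax[measurable] by measurable
    have cM[measurable]: "c l \<in> borel_measurable M" for l using measurable_from_subalg[OF sub cG] .
    have iR: "integrable M (\<lambda>\<omega>. wt \<omega> * R \<omega> ^ (k + 1))"
      using fin w0 R0 by (intro integrableI_bounded) auto
    have RG: "(\<lambda>\<omega>. wt \<omega> * R \<omega> ^ (k + 1)) \<in> borel_measurable G" using R wt by measurable
    have cb: "\<bar>c l \<omega>\<bar> \<le> real (2 * k + 2) * (wt \<omega> * R \<omega> ^ (k + 1))" for l \<omega>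
    proof -
      have "\<bar>a \<omega> \<bullet> (A \<omega> *v axis l 1)\<bar> \<le> norm (a \<omega>) * (norm (A \<omega>) * norm (axis l (1::real)))"
        by (intro order_trans[OF Cauchy_Schwarz_ineq2] mult_left_mono norm_matrix_vector_mult_le) auto
      also have "\<dots> \<le> R \<omega>" using aAR by (simp add: norm_axis_1)
      finally have "norm (a \<omega>) ^ (2 * k) * \<bar>a \<omega> \<bullet> (A \<omega> *v axis l 1)\<bar> \<le> R \<omega> ^ k * R \<omega>"
        using aRk[of \<omega> k] R0[of \<omega>] by (intro mult_mono) auto
      then have "wt \<omega> * (real (2 * k + 2) * (norm (a \<omega>) ^ (2 * k) * \<bar>a \<omega> \<bullet> (A \<omega> *v axis l 1)\<bar>)) \<le>
          wt \<omega> * (real (2 * k + 2) * (R \<omega> ^ k * R \<omega>))"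
        by (intro mult_left_mono) (auto simp: w0)
      then show ?thesis using w0[of \<omega>] by (simp add: c_def abs_mult mult_ac)
    qed
    have ic: "integrable M (c l)" for l
      by (rule Bochner_Integration.integrable_bound[OF integrable_mult_right[OF iR, of "real (2 * k + 2)"]])
         (auto intro!: AE_I2 order_trans[OF cb] abs_ge_self)
    note mom = normal_vector_moments[OF u(1) Zm Z[rule_format]]
    have vl: "(\<lambda>z. z $ l) \<in> borel_measurable (borel :: (real ^ 'n) measure)" for l
      by (intro borel_measurable_continuous_onI continuous_intros)
    have vn: "(\<lambda>z. norm z ^ j) \<in> borel_measurable (borel :: (real ^ 'n) measure)" for j by simp
    \<comment> \<open>Here the first-order term disappears: \<open>c l\<close> is known to
      \<open>G\<close>, while the l-th coordinate of \<open>Z\<close> is independent of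
      \<open>G\<close> and has mean zero.\<close>
    have cZ: "integrable M (\<lambda>\<omega>. c l \<omega> * Z \<omega> $ l)" "(LINT \<omega>|M. c l \<omega> * Z \<omega> $ l) = 0" for l
      using indep_var_integrable[OF indep_var_of_subalgebra[OF sub ind Zm cG vl] ic mom(1)]
        indep_var_lebesgue_integral[OF indep_var_of_subalgebra[OF sub ind Zm cG vl] ic mom(1)] mom(2)
      by auto
    have RZ: "integrable M (\<lambda>\<omega>. wt \<omega> * R \<omega> ^ (k + 1) * norm (Z \<omega>) ^ (2 * j))"
      "(LINT \<omega>|M. wt \<omega> * R \<omega> ^ (k + 1) * norm (Z \<omega>) ^ (2 * j)) =
         (LINT \<omega>|M. wt \<omega> * R \<omega> ^ (k + 1)) * (LINT \<omega>|M. norm (Z \<omega>) ^ (2 * j))" for j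
      using indep_var_integrable[OF indep_var_of_subalgebra[OF sub ind Zm RG vn] iR mom(3)]
        indep_var_lebesgue_integral[OF indep_var_of_subalgebra[OF sub ind Zm RG vn] iR mom(3)]
      by auto
    have ia: "integrable M (\<lambda>\<omega>. wt \<omega> * norm (a \<omega>) ^ (2 * k + 2))"
      using aRk[of _ "k + 1"] w0
      by (intro Bochner_Integration.integrable_bound[OF iR])
         (auto simp: abs_mult R0 intro!: mult_left_mono)
    let ?r = "\<lambda>\<omega>. wt \<omega> * norm (a \<omega>) ^ (2 * k + 2) + (\<Sum>l\<in>UNIV. c l \<omega> * Z \<omega> $ l)
        + C0 * (wt \<omega> * R \<omega> ^ (k + 1) * norm (Z \<omega>) ^ (2 * 1)
              + wt \<omega> * R \<omega> ^ (k + 1) * norm (Z \<omega>) ^ (2 * (k + 1)))"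
    have pw: "wt \<omega> * norm (a \<omega> + A \<omega> *v Z \<omega>) ^ (2 * k + 2) \<le> ?r \<omega>" for \<omega>
    proof -
      have AZ: "norm (A \<omega> *v Z \<omega>) ^ (2 * j) \<le> R \<omega> ^ j * norm (Z \<omega>) ^ (2 * j)" for j
      proof -
        have "norm (A \<omega> *v Z \<omega>) ^ (2 * j) \<le> (norm (A \<omega>) * norm (Z \<omega>)) ^ (2 * j)"
          by (intro power_mono norm_matrix_vector_mult_le) auto
        also have "\<dots> = ((norm (A \<omega>))\<^sup>2) ^ j * norm (Z \<omega>) ^ (2 * j)"
          by (simp add: power_mult_distrib power_mult)
        also have "\<dots> \<le> R \<omega> ^ j * norm (Z \<omega>) ^ (2 * j)"
          by (intro mult_right_mono power_mono AR) auto
        finally show ?thesis .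
      qed
      have "norm (a \<omega>) ^ (2 * k) * norm (A \<omega> *v Z \<omega>) ^ 2 \<le> R \<omega> ^ k * (R \<omega> * norm (Z \<omega>) ^ 2)"
        using AZ[of 1] R0[of \<omega>] by (intro mult_mono aRk) auto
      moreover have "norm (A \<omega> *v Z \<omega>) ^ (2 * k + 2) \<le> R \<omega> ^ (k + 1) * norm (Z \<omega>) ^ (2 * (k + 1))"
        using AZ[of "k + 1"] by simp
      ultimately have "C0 * (norm (a \<omega>) ^ (2 * k) * norm (A \<omega> *v Z \<omega>) ^ 2 + norm (A \<omega> *v Z \<omega>) ^ (2 * k + 2))
          \<le> C0 * (R \<omega> ^ (k + 1) * norm (Z \<omega>) ^ (2 * 1) + R \<omega> ^ (k + 1) * norm (Z \<omega>) ^ (2 * (k + 1)))"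
        by (intro mult_left_mono C0 add_mono) (simp_all add: mult_ac)
      with exp[of "a \<omega>" "A \<omega> *v Z \<omega>"] have
        "norm (a \<omega> + A \<omega> *v Z \<omega>) ^ (2 * k + 2) \<le> norm (a \<omega>) ^ (2 * k + 2)
          + real (2 * k + 2) * norm (a \<omega>) ^ (2 * k) * (\<Sum>l\<in>UNIV. (a \<omega> \<bullet> (A \<omega> *v axis l 1)) * Z \<omega> $ l)
          + C0 * (R \<omega> ^ (k + 1) * norm (Z \<omega>) ^ (2 * 1) + R \<omega> ^ (k + 1) * norm (Z \<omega>) ^ (2 * (k + 1)))"
        unfolding inner_matrix_vector_mult_axis[of "a \<omega>" "A \<omega>" "Z \<omega>"] by linarith
      from mult_left_mono[OF this w0[of \<omega>]] show ?thesis
        by (simp only: c_def distrib_left sum_distrib_left ac_simps)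
    qed
    have ir: "integrable M ?r"
      by (intro Bochner_Integration.integrable_add Bochner_Integration.integrable_sum
          integrable_mult_right ia cZ RZ)
    have "(\<integral>\<^sup>+\<omega>. ennreal (wt \<omega> * norm (a \<omega> + A \<omega> *v Z \<omega>) ^ (2 * k + 2)) \<partial>M) \<le> (\<integral>\<^sup>+\<omega>. ennreal (?r \<omega>) \<partial>M)"
      using pw by (intro nn_integral_mono ennreal_leI)
    also have "\<dots> = ennreal (LINT \<omega>|M. ?r \<omega>)"
      using pw w0 by (intro nn_integral_eq_integral[OF ir] AE_I2) (meson order_trans mult_nonneg_nonneg zero_le_power norm_ge_zero)
    also have "(LINT \<omega>|M. ?r \<omega>) = (LINT \<omega>|M. wt \<omega> * norm (a \<omega>) ^ (2 * k + 2))
        + C0 * ((LINT \<omega>|M. wt \<omega> * R \<omega> ^ (k + 1)) * (LINT \<omega>|M. norm (Z \<omega>) ^ (2 * 1))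
              + (LINT \<omega>|M. wt \<omega> * R \<omega> ^ (k + 1)) * (LINT \<omega>|M. norm (Z \<omega>) ^ (2 * (k + 1))))"
      by (subst Bochner_Integration.integral_add Bochner_Integration.integral_sum
          integral_mult_right_zero; (intro Bochner_Integration.integrable_add
          Bochner_Integration.integrable_sum integrable_mult_right ia cZ RZ)?)+
         (simp only: RZ cZ sum.neutral_const add_0_right)
    also have "\<dots> \<le> (LINT \<omega>|M. wt \<omega> * norm (a \<omega>) ^ (2 * k + 2))
        + max 0 C * u * (LINT \<omega>|M. wt \<omega> * R \<omega> ^ (k + 1))"
    proof -
      let ?I = "LINT \<omega>|M. wt \<omega> * R \<omega> ^ (k + 1)"
      have I: "0 \<le> ?I" using w0 R0 by (intro integral_nonneg_AE AE_I2) auto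
      have "(LINT \<omega>|M. norm (Z \<omega>) ^ (2 * 1)) \<le> K 1 * u"
        using mom(4)[of 1] by (simp add: K_def)
      moreover have "(LINT \<omega>|M. norm (Z \<omega>) ^ (2 * (k + 1))) \<le> K (k + 1) * U ^ k * u"
      proof -
        have "(LINT \<omega>|M. norm (Z \<omega>) ^ (2 * (k + 1))) \<le> K (k + 1) * (u ^ k * u)"
          using mom(4)[of "k + 1"] by (simp add: K_def mult_ac)
        also have "\<dots> \<le> K (k + 1) * (U ^ k * u)"
          using u by (intro mult_left_mono mult_right_mono power_mono K) auto
        finally show ?thesis by (simp add: mult_ac)
      qed
      ultimately have "C0 * (?I * (LINT \<omega>|M. norm (Z \<omega>) ^ (2 * 1)) + ?I * (LINT \<omega>|M. norm (Z \<omega>) ^ (2 * (k + 1))))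
         \<le> C0 * (?I * (K 1 * u) + ?I * (K (k + 1) * U ^ k * u))"
        by (intro mult_left_mono add_mono C0 I)
      also have "\<dots> = C * u * ?I" by (simp add: C_def algebra_simps)
      also have "\<dots> \<le> max 0 C * u * ?I" using u I by (intro mult_right_mono) auto
      finally show ?thesis by simp
    qed
    also have "\<dots> = (LINT \<omega>|M. wt \<omega> * norm (a \<omega>) ^ (2 * k + 2) + max 0 C * u * (wt \<omega> * R \<omega> ^ (k + 1)))"
      using ia iR by simp
    also have "ennreal \<dots> = (\<integral>\<^sup>+\<omega>. ennreal (wt \<omega> * norm (a \<omega>) ^ (2 * k + 2) + max 0 C * u * (wt \<omega> * R \<omega> ^ (k + 1))) \<partial>M)"
      using ia iR u w0 R0 by (intro nn_integral_eq_integral[symmetric]) auto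
    finally show "(\<integral>\<^sup>+\<omega>. ennreal (wt \<omega> * norm (a \<omega> + A \<omega> *v Z \<omega>) ^ (2 * k + 2)) \<partial>M)
       \<le> (\<integral>\<^sup>+\<omega>. ennreal (wt \<omega> * (norm (a \<omega>) ^ (2 * k + 2) + max 0 C * u * R \<omega> ^ (k + 1))) \<partial>M)"
      by (simp add: distrib_left mult_ac ennreal_leI)
  qed simp
qed

end

section \<open>Brownian increments over random time intervals\<close>

lemma floor_ceiling_grid_bounds:
  fixes x N :: real
  assumes "0 < N"
  shows "x - 1 / N \<le> \<lfloor>N * x\<rfloor> / N" "\<lfloor>N * x\<rfloor> / N \<le> x" "x \<le> \<lceil>N * x\<rceil> / N" "\<lceil>N * x\<rceil> / N \<le> x + 1 / N"
proof -
  have "N * x - 1 \<le> \<lfloor>N * x\<rfloor>" "\<lfloor>N * x\<rfloor> \<le> N * x" "N * x \<le> \<lceil>N * x\<rceil>" "\<lceil>N * x\<rceil> \<le> N * x + 1"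
    by linarith+
  from this[THEN divide_right_mono, of N] assms
  show "x - 1 / N \<le> \<lfloor>N * x\<rfloor> / N" "\<lfloor>N * x\<rfloor> / N \<le> x" "x \<le> \<lceil>N * x\<rceil> / N" "\<lceil>N * x\<rceil> / N \<le> x + 1 / N"
    by (simp_all add: diff_divide_distrib add_divide_distrib)
qed

lemma floor_grid_tendsto: "(\<lambda>n. \<lfloor>real (Suc n) * x\<rfloor> / real (Suc n)) \<longlonglongrightarrow> (x :: real)"
proof (rule tendsto_sandwich)
  show "\<forall>\<^sub>F n in sequentially. x - 1 / real (Suc n) \<le> \<lfloor>real (Suc n) * x\<rfloor> / real (Suc n)"
    by (intro always_eventually allI floor_ceiling_grid_bounds) simp
  show "\<forall>\<^sub>F n in sequentially. \<lfloor>real (Suc n) * x\<rfloor> / real (Suc n) \<le> x"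
    by (intro always_eventually allI floor_ceiling_grid_bounds) simp
  show "(\<lambda>n. x - 1 / real (Suc n)) \<longlonglongrightarrow> x"
    using tendsto_diff[OF tendsto_const LIMSEQ_inverse_real_of_nat, of "x"]
    by (simp add: inverse_eq_divide)
qed simp

lemma ceiling_grid_tendsto: "(\<lambda>n. \<lceil>real (Suc n) * x\<rceil> / real (Suc n)) \<longlonglongrightarrow> (x :: real)"
proof (rule tendsto_sandwich)
  show "\<forall>\<^sub>F n in sequentially. \<lceil>real (Suc n) * x\<rceil> / real (Suc n) \<le> x + 1 / real (Suc n)"
    by (intro always_eventually allI floor_ceiling_grid_bounds) simp
  show "\<forall>\<^sub>F n in sequentially. x \<le> \<lceil>real (Suc n) * x\<rceil> / real (Suc n)"
    by (intro always_eventually allI floor_ceiling_grid_bounds) simp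
  show "(\<lambda>n. x + 1 / real (Suc n)) \<longlonglongrightarrow> x"
    using tendsto_add[OF tendsto_const LIMSEQ_inverse_real_of_nat, of x]
    by (simp add: inverse_eq_divide)
qed simp

text \<open>Rounding \<open>\<sigma>\<close> down to a mesh gives a random time with countably many
  values, for which evaluation is measurable piece by piece; continuity of the paths passes to the
  limit.\<close>

lemma borel_measurable_random_eval:
  fixes V :: "real \<Rightarrow> 'w \<Rightarrow> 'b :: {second_countable_topology, metric_space}"
  assumes V: "\<And>r. V r \<in> borel_measurable N"
    and cont: "\<And>\<omega>. \<omega> \<in> space N \<Longrightarrow> continuous_on UNIV (\<lambda>r. V r \<omega>)"
    and \<sigma>[measurable]: "\<sigma> \<in> borel_measurable N"
  shows "(\<lambda>\<omega>. V (\<sigma> \<omega>) \<omega>) \<in> borel_measurable N"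
proof (rule borel_measurable_LIMSEQ_metric)
  fix n :: nat
  show "(\<lambda>\<omega>. V (\<lfloor>real (Suc n) * \<sigma> \<omega>\<rfloor> / real (Suc n)) \<omega>) \<in> borel_measurable N"
    by (rule measurable_compose_countable[where f="\<lambda>i \<omega>. V (real_of_int i / real (Suc n)) \<omega>"])
       (use V in auto)
next
  fix \<omega> assume \<omega>: "\<omega> \<in> space N"
  note floor_grid_tendsto[of "\<sigma> \<omega>"]
  then show "(\<lambda>n. V (\<lfloor>real (Suc n) * \<sigma> \<omega>\<rfloor> / real (Suc n)) \<omega>) \<longlonglongrightarrow> V (\<sigma> \<omega>) \<omega>"
    using continuous_on_tendsto_compose[OF cont[OF \<omega>]] by simp
qed

text \<open>Start and continuity are demanded at every point of the space instead of almost surely,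
  so that evaluation at random times is measurable without any exceptional set.
  \<open>brownian_modification\<close> provides such a process.\<close>

locale brownian = prob_space M for M :: "'w measure" +
  fixes F :: "real \<Rightarrow> 'w measure" and W :: "real \<Rightarrow> 'w \<Rightarrow> real ^ 'd"
  assumes subalgebra_F: "0 \<le> t \<Longrightarrow> subalgebra M (F t)"
    and F_mono: "0 \<le> s \<Longrightarrow> s \<le> t \<Longrightarrow> sets (F s) \<subseteq> sets (F t)"
    and W_adapted: "0 \<le> t \<Longrightarrow> W t \<in> borel_measurable (F t)"
    and W_0: "\<omega> \<in> space M \<Longrightarrow> W 0 \<omega> = 0"
    and W_continuous: "\<omega> \<in> space M \<Longrightarrow> continuous_on {0..} (\<lambda>t. W t \<omega>)"
    and W_indep: "0 \<le> s \<Longrightarrow> s < t \<Longrightarrow>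
      indep_set (sets (F s)) (sets (vimage_algebra (space M) (\<lambda>\<omega>. W t \<omega> - W s \<omega>) borel))"
    and W_normal: "0 \<le> s \<Longrightarrow> s < t \<Longrightarrow>
      distributed M lborel (\<lambda>\<omega>. (W t \<omega> - W s \<omega>) $ i) (normal_density 0 (sqrt (t - s)))"
begin

text \<open>Filtrations are indexed by all reals, whereas nothing is known of \<open>F\<close> at
  negative times; the index is therefore clipped at 0.\<close>

abbreviation "FF \<equiv> \<lambda>t. F (max 0 t)"

lemma space_F_nonneg: "0 \<le> t \<Longrightarrow> space (F t) = space M"
  using subalgebra_F by (auto simp: subalgebra_def)

sublocale filtration "space M" FF
  by standard (use space_F_nonneg F_mono in auto)

text \<open>Stopping times here are real-valued, hence finite: an event of the past of
  \<open>\<sigma>\<close> is the countable union of its parts on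
  \<open>\<sigma> \<le> n\<close>.\<close>

lemma subalgebra_pre_sigma:
  assumes "stopping_time FF \<sigma>"
  shows "subalgebra M (pre_sigma \<sigma>)"
proof -
  have "A \<in> sets M" if "A \<in> sets (pre_sigma \<sigma>)" for A
  proof -
    have 1: "{\<omega> \<in> A. \<sigma> \<omega> \<le> real n} \<in> sets M" for n :: nat
      using sets_pre_sigmaD[OF assms that, of "real n"] subalgebra_F[of "real n"]
      by (auto simp: subalgebra_def)
    have "A = (\<Union>n. {\<omega> \<in> A. \<sigma> \<omega> \<le> real n})" using real_arch_simple by auto
    also have "\<dots> \<in> sets M" using 1 by auto
    finally show ?thesis .
  qed
  then show ?thesis by (auto simp: subalgebra_def space_pre_sigma)
qed

lemma W_measurable: "0 \<le> t \<Longrightarrow> W t \<in> borel_measurable M"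
  using measurable_from_subalg[OF subalgebra_F W_adapted] by simp

text \<open>Carries knowledge at the random time \<open>\<sigma>\<close> over to a fixed time
  \<open>s\<close>: on \<open>\<sigma> \<le> s\<close> it is part of \<open>F s\<close>, and
  elsewhere the value is overwritten by a constant. With this, random starting times can be replaced
  by deterministic ones.\<close>

lemma measurable_restrict_pre_sigma:
  fixes H :: "'w \<Rightarrow> 'b :: topological_space"
  assumes \<sigma>: "stopping_time FF \<sigma>" and H: "H \<in> borel_measurable (pre_sigma \<sigma>)" and s: "0 \<le> s"
  shows "(\<lambda>\<omega>. if \<sigma> \<omega> \<le> s then H \<omega> else c) \<in> borel_measurable (F s)"
proof (rule measurableI)
  fix B :: "'b set" assume B: "B \<in> sets borel"
  have "{\<omega> \<in> H -` B \<inter> space (pre_sigma \<sigma>). \<sigma> \<omega> \<le> s} \<in> sets (F s)"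
    using sets_pre_sigmaD[OF \<sigma> measurable_sets[OF H B], of s] s by simp
  moreover have "{\<omega> \<in> space (F s). \<sigma> \<omega> \<le> s} \<in> sets (F s)"
    using stopping_timeD[OF \<sigma>, of s] s by (simp add: pred_def)
  ultimately have "{\<omega> \<in> H -` B \<inter> space (pre_sigma \<sigma>). \<sigma> \<omega> \<le> s} \<union>
     (if c \<in> B then space (F s) - {\<omega> \<in> space (F s). \<sigma> \<omega> \<le> s} else {}) \<in> sets (F s)"
    by auto
  also have "{\<omega> \<in> H -` B \<inter> space (pre_sigma \<sigma>). \<sigma> \<omega> \<le> s} \<union>
     (if c \<in> B then space (F s) - {\<omega> \<in> space (F s). \<sigma> \<omega> \<le> s} else {})
     = (\<lambda>\<omega>. if \<sigma> \<omega> \<le> s then H \<omega> else c) -` B \<inter> space (F s)"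
    by (auto simp: space_pre_sigma space_F_nonneg s split: if_splits)
  finally show "(\<lambda>\<omega>. if \<sigma> \<omega> \<le> s then H \<omega> else c) -` B \<inter> space (F s) \<in> sets (F s)" .
qed simp

lemma W_stopping_time_measurable:
  assumes \<rho>: "stopping_time FF \<rho>" and nonneg: "\<And>\<omega>. 0 \<le> \<rho> \<omega>"
  shows "(\<lambda>\<omega>. W (\<rho> \<omega>) \<omega>) \<in> borel_measurable (pre_sigma \<rho>)"
proof (rule measurableI)
  fix B :: "(real ^ 'd) set" assume B: "B \<in> sets borel"
  show "(\<lambda>\<omega>. W (\<rho> \<omega>) \<omega>) -` B \<inter> space (pre_sigma \<rho>) \<in> sets (pre_sigma \<rho>)"
  proof (rule sets_pre_sigmaI[OF \<rho>])
    fix s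
    show "{\<omega> \<in> (\<lambda>\<omega>. W (\<rho> \<omega>) \<omega>) -` B \<inter> space (pre_sigma \<rho>). \<rho> \<omega> \<le> s} \<in> sets (FF s)"
    proof (cases "0 \<le> s")
      case False
      then have "{\<omega> \<in> (\<lambda>\<omega>. W (\<rho> \<omega>) \<omega>) -` B \<inter> space (pre_sigma \<rho>). \<rho> \<omega> \<le> s} = {}"
        using nonneg order_trans by blast
      then show ?thesis by (simp only: sets.empty_sets)
    next
      case True
      have \<rho>s: "(\<lambda>\<omega>. if \<rho> \<omega> \<le> s then \<rho> \<omega> else s) \<in> borel_measurable (F s)"
        by (rule measurable_restrict_pre_sigma[OF \<rho> measurable_stopping_time_pre_sigma[OF \<rho>] True])
      \<comment> \<open>The path is frozen outside [0, s], so that all its values are known at time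
        \<open>s\<close>; on \<open>\<rho> \<le> s\<close> freezing changes nothing.\<close>
      have Ws: "W (max 0 (min r s)) \<in> borel_measurable (F s)" for r
        using W_adapted[of "max 0 (min r s)"] F_mono[of "max 0 (min r s)" s] True
        by (intro measurable_from_subalg[of "F s" "F (max 0 (min r s))"])
           (auto simp: subalgebra_def space_F_nonneg)
      have Wc: "continuous_on UNIV (\<lambda>r. W (max 0 (min r s)) \<omega>)" if "\<omega> \<in> space (F s)" for \<omega>
      proof -
        have "\<omega> \<in> space M" using that True by (simp add: space_F_nonneg)
        then show ?thesis
          by (rule continuous_on_compose2[OF W_continuous]) (auto intro!: continuous_intros)
      qed
      have "(\<lambda>\<omega>. W (max 0 (min (if \<rho> \<omega> \<le> s then \<rho> \<omega> else s) s)) \<omega>) \<in> borel_measurable (F s)"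
        by (rule borel_measurable_random_eval[where V="\<lambda>r. W (max 0 (min r s))", OF Ws Wc \<rho>s])
      note 1 = measurable_sets[OF this B]
      have 2: "{\<omega> \<in> space (F s). \<rho> \<omega> \<le> s} \<in> sets (F s)"
        using stopping_timeD[OF \<rho>, of s] True by (simp add: pred_def)
      have "(\<lambda>\<omega>. W (max 0 (min (if \<rho> \<omega> \<le> s then \<rho> \<omega> else s) s)) \<omega>) -` B \<inter> space (F s)
          \<inter> {\<omega> \<in> space (F s). \<rho> \<omega> \<le> s} \<in> sets (F s)"
        by (rule sets.Int[OF 1 2])
      also have "(\<lambda>\<omega>. W (max 0 (min (if \<rho> \<omega> \<le> s then \<rho> \<omega> else s) s)) \<omega>) -` B \<inter> space (F s)
          \<inter> {\<omega> \<in> space (F s). \<rho> \<omega> \<le> s} = {\<omega> \<in> (\<lambda>\<omega>. W (\<rho> \<omega>) \<omega>) -` B \<inter> space (pre_sigma \<rho>). \<rho> \<omega> \<le> s}"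
        using nonneg by (auto simp: space_pre_sigma space_F_nonneg True max_absorb2 min_absorb1)
      finally show ?thesis using True by simp
    qed
  qed
qed simp

text \<open>\<open>gaussian_step\<close> for a random interval from \<open>\<sigma>\<close> to
  \<open>\<rho>\<close>, where \<open>\<rho>\<close> is already known at time
  \<open>\<sigma>\<close>. A predicate gives the constant a name, so that one \<open>C\<close> can
  be shared by all schemes over the same \<open>W\<close>. The type argument records the dimension
  of the state, which otherwise occurs only in bound variables.\<close>

definition increment_bound :: "'m::finite itself \<Rightarrow> real \<Rightarrow> nat \<Rightarrow> real \<Rightarrow> bool" where
  "increment_bound _ U k C \<longleftrightarrow> 0 \<le> C \<and> (\<forall>\<sigma> \<rho> (a :: 'w \<Rightarrow> real ^ 'm) A R wt B.
     stopping_time FF \<sigma> \<longrightarrow> \<rho> \<in> borel_measurable (pre_sigma \<sigma>) \<longrightarrow>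
     a \<in> borel_measurable (pre_sigma \<sigma>) \<longrightarrow> A \<in> borel_measurable (pre_sigma \<sigma>) \<longrightarrow>
     R \<in> borel_measurable (pre_sigma \<sigma>) \<longrightarrow> wt \<in> borel_measurable (pre_sigma \<sigma>) \<longrightarrow>
     (\<forall>\<omega>. 0 \<le> \<sigma> \<omega> \<and> \<sigma> \<omega> \<le> \<rho> \<omega> \<and> \<rho> \<omega> \<le> \<sigma> \<omega> + U \<and> \<rho> \<omega> \<le> B \<and>
       0 \<le> wt \<omega> \<and> (norm (a \<omega>))\<^sup>2 \<le> R \<omega> \<and> (norm (A \<omega>))\<^sup>2 \<le> R \<omega>) \<longrightarrow>
     (\<integral>\<^sup>+\<omega>. ennreal (wt \<omega> * R \<omega> ^ (k + 1)) \<partial>M) < \<infinity> \<longrightarrow>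
     (\<integral>\<^sup>+\<omega>. ennreal (wt \<omega> * norm (a \<omega> + A \<omega> *v (W (\<rho> \<omega>) \<omega> - W (\<sigma> \<omega>) \<omega>)) ^ (2 * k + 2)) \<partial>M)
       \<le> (\<integral>\<^sup>+\<omega>. ennreal (wt \<omega> * (norm (a \<omega>) ^ (2 * k + 2) + C * (\<rho> \<omega> - \<sigma> \<omega>) * R \<omega> ^ (k + 1))) \<partial>M))"

text \<open>Strong Markov in the only form needed: the grid times are approximated from the right by
  deterministic ones, where the increment is independent of the past, and Fatou's lemma passes to
  the limit.\<close>

lemma increment_bound_exists: "\<exists>C. increment_bound TYPE('m::finite) U k C"
proof -
  \<comment> \<open>\<open>U + 1\<close> because rounding both ends up to a mesh 1/N lengthens the
    interval by at most 1/N, and N is at least 1.\<close>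
  from gaussian_step[where 'n='d and 'm='m, of "U + 1" k]
  obtain C where C: "0 \<le> C" and *: "\<forall>G (Z :: 'w \<Rightarrow> real ^ 'd) (a :: 'w \<Rightarrow> real ^ 'm) A R wt u.
     subalgebra M G \<longrightarrow> indep_set (sets G) (sets (vimage_algebra (space M) Z borel)) \<longrightarrow>
     Z \<in> borel_measurable M \<longrightarrow>
     (\<forall>l. distributed M lborel (\<lambda>\<omega>. Z \<omega> $ l) (normal_density 0 (sqrt u))) \<longrightarrow>
     0 < u \<longrightarrow> u \<le> U + 1 \<longrightarrow> a \<in> borel_measurable G \<longrightarrow> A \<in> borel_measurable G \<longrightarrow>
     R \<in> borel_measurable G \<longrightarrow> wt \<in> borel_measurable G \<longrightarrow>
     (\<forall>\<omega>. 0 \<le> wt \<omega> \<and> (norm (a \<omega>))\<^sup>2 \<le> R \<omega> \<and> (norm (A \<omega>))\<^sup>2 \<le> R \<omega>) \<longrightarrow>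
     (\<integral>\<^sup>+\<omega>. ennreal (wt \<omega> * R \<omega> ^ (k + 1)) \<partial>M) < \<infinity> \<longrightarrow>
     (\<integral>\<^sup>+\<omega>. ennreal (wt \<omega> * norm (a \<omega> + A \<omega> *v Z \<omega>) ^ (2 * k + 2)) \<partial>M)
       \<le> (\<integral>\<^sup>+\<omega>. ennreal (wt \<omega> * (norm (a \<omega>) ^ (2 * k + 2) + C * u * R \<omega> ^ (k + 1))) \<partial>M)" by (elim exE conjE)
  note step = *[rule_format]
  show ?thesis
    unfolding increment_bound_def
  proof (intro exI[of _ C] conjI C allI impI)
    fix \<sigma> \<rho> :: "'w \<Rightarrow> real" and a :: "'w \<Rightarrow> real ^ 'm" and A :: "'w \<Rightarrow> real ^ 'd ^ 'm"
      and R wt :: "'w \<Rightarrow> real" and B :: real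
    assume \<sigma>: "stopping_time FF \<sigma>"
      and m[measurable]: "\<rho> \<in> borel_measurable (pre_sigma \<sigma>)" "a \<in> borel_measurable (pre_sigma \<sigma>)"
        "A \<in> borel_measurable (pre_sigma \<sigma>)" "R \<in> borel_measurable (pre_sigma \<sigma>)"
        "wt \<in> borel_measurable (pre_sigma \<sigma>)"
      and bnd: "\<forall>\<omega>. 0 \<le> \<sigma> \<omega> \<and> \<sigma> \<omega> \<le> \<rho> \<omega> \<and> \<rho> \<omega> \<le> \<sigma> \<omega> + U \<and> \<rho> \<omega> \<le> B \<and>
       0 \<le> wt \<omega> \<and> (norm (a \<omega>))\<^sup>2 \<le> R \<omega> \<and> (norm (A \<omega>))\<^sup>2 \<le> R \<omega>"
      and fin: "(\<integral>\<^sup>+\<omega>. ennreal (wt \<omega> * R \<omega> ^ (k + 1)) \<partial>M) < \<infinity>"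
    note [measurable] = measurable_stopping_time_pre_sigma[OF \<sigma>]
    note fromM = measurable_from_subalg[OF subalgebra_pre_sigma[OF \<sigma>]]
    note mM[measurable] = m[THEN fromM] measurable_stopping_time_pre_sigma[OF \<sigma>, THEN fromM]
    have b: "0 \<le> \<sigma> \<omega>" "\<sigma> \<omega> \<le> \<rho> \<omega>" "\<rho> \<omega> \<le> \<sigma> \<omega> + U" "\<rho> \<omega> \<le> B" "0 \<le> wt \<omega>"
      "(norm (a \<omega>))\<^sup>2 \<le> R \<omega>" "(norm (A \<omega>))\<^sup>2 \<le> R \<omega>" for \<omega> using bnd by auto
    have R0: "0 \<le> R \<omega>" for \<omega> using b(6)[of \<omega>] by (meson order_trans zero_le_power2)
    define f where "f z \<omega> = ennreal (wt \<omega> * norm (a \<omega> + A \<omega> *v z) ^ (2 * k + 2))" for z \<omega>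
    define r where "r u \<omega> = ennreal (wt \<omega> * (norm (a \<omega>) ^ (2 * k + 2) + C * u * R \<omega> ^ (k + 1)))" for u \<omega>
    have Wm: "(\<lambda>\<omega>. W (\<phi> \<omega>) \<omega>) \<in> borel_measurable M"
      if "\<phi> \<in> borel_measurable M" "\<And>\<omega>. 0 \<le> \<phi> \<omega>" for \<phi> :: "'w \<Rightarrow> real"
    proof -
      have "(\<lambda>\<omega>. W (max 0 (\<phi> \<omega>)) \<omega>) \<in> borel_measurable M"
      proof (rule borel_measurable_random_eval[of "\<lambda>r. W (max 0 r)", OF _ _ that(1)])
        show "W (max 0 r) \<in> borel_measurable M" for r by (rule W_measurable) simp
        show "continuous_on UNIV (\<lambda>r. W (max 0 r) \<omega>)" if "\<omega> \<in> space M" for \<omega>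
          by (rule continuous_on_compose2[OF W_continuous[OF that]]) (auto intro!: continuous_intros)
      qed
      moreover have "max 0 (\<phi> \<omega>) = \<phi> \<omega>" for \<omega> using that(2)[of \<omega>] by simp
      ultimately show ?thesis by simp
    qed
    have mv: "(\<lambda>\<omega>. A' \<omega> *v z \<omega>) \<in> borel_measurable N"
      if "A' \<in> borel_measurable N" "z \<in> borel_measurable N" for A' :: "'w \<Rightarrow> real ^ 'd ^ 'm" and z N
      by (rule borel_measurable_continuous_Pair[OF that])
         (auto simp: matrix_vector_mult_def intro!: continuous_intros)
    have fm: "(\<lambda>\<omega>. f (z \<omega>) \<omega>) \<in> borel_measurable M" if [measurable]: "z \<in> borel_measurable M" for z
      unfolding f_def using mv[OF mM(3) that, measurable] by measurable
    have rm[measurable]: "(\<lambda>\<omega>. r (u \<omega>) \<omega>) \<in> borel_measurable M" if [measurable]: "u \<in> borel_measurable M" for u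
      unfolding r_def by measurable
    have grid: "(\<integral>\<^sup>+\<omega>. f (W (\<lceil>N * \<rho> \<omega>\<rceil> / N) \<omega> - W (\<lceil>N * \<sigma> \<omega>\<rceil> / N) \<omega>) \<omega> \<partial>M)
        \<le> (\<integral>\<^sup>+\<omega>. r (\<rho> \<omega> - \<sigma> \<omega> + 1 / N) \<omega> \<partial>M)" (is "?L \<le> ?R") if N: "1 \<le> N" for N :: real
    proof -
      \<comment> \<open>The deterministic bound \<open>\<rho> \<le> B\<close> leaves finitely many
        pairs of rounded ends.\<close>
      define I where "I = {0..\<lceil>N * B\<rceil>} \<times> {0..\<lceil>N * B\<rceil>}"
      \<comment> \<open>The cells of constant rounded ends. They belong to the past of
        \<open>\<sigma>\<close>, since \<open>\<rho>\<close> is known there, and can therefore be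
        absorbed into the weight.\<close>
      define E where "E = (\<lambda>(i, j). {\<omega> \<in> space M. \<lceil>N * \<sigma> \<omega>\<rceil> = i \<and> \<lceil>N * \<rho> \<omega>\<rceil> = j})"
      have EG[measurable]: "E e \<in> sets (pre_sigma \<sigma>)" for e
      proof -
        obtain i j where e: "e = (i, j)" by (cases e)
        have "{\<omega> \<in> space (pre_sigma \<sigma>). \<lceil>N * \<sigma> \<omega>\<rceil> = i \<and> \<lceil>N * \<rho> \<omega>\<rceil> = j} \<in> sets (pre_sigma \<sigma>)"
          by measurable
        then show ?thesis by (simp add: E_def e space_pre_sigma)
      qed
      have EM[measurable]: "E e \<in> sets M" for e
        using EG[of e] subalgebra_pre_sigma[OF \<sigma>] by (auto simp: subalgebra_def)
      have finI: "finite I" by (simp add: I_def)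
      have one: "(\<Sum>e\<in>I. indicator (E e) \<omega>) = (1 :: ennreal)" if "\<omega> \<in> space M" for \<omega>
      proof -
        let ?e = "(\<lceil>N * \<sigma> \<omega>\<rceil>, \<lceil>N * \<rho> \<omega>\<rceil>)"
        have "0 \<le> N * \<sigma> \<omega>" "N * \<sigma> \<omega> \<le> N * B" "0 \<le> N * \<rho> \<omega>" "N * \<rho> \<omega> \<le> N * B"
          using N b[of \<omega>] by (auto intro!: mult_left_mono)
        then have "?e \<in> I"
          by (auto simp: I_def intro!: ceiling_mono)
        have "(\<Sum>e\<in>I. indicator (E e) \<omega>) = (\<Sum>e\<in>I. if e = ?e then 1 else (0::ennreal))"
          using that by (intro sum.cong) (auto simp: E_def indicator_def)
        also have "\<dots> = 1" using finI \<open>?e \<in> I\<close> by simp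
        finally show ?thesis .
      qed
      have split: "(\<integral>\<^sup>+\<omega>. h \<omega> \<partial>M) = (\<Sum>e\<in>I. \<integral>\<^sup>+\<omega>. indicator (E e) \<omega> * h \<omega> \<partial>M)"
        if [measurable]: "h \<in> borel_measurable M" for h :: "'w \<Rightarrow> ennreal"
      proof -
        have "(\<integral>\<^sup>+\<omega>. h \<omega> \<partial>M) = (\<integral>\<^sup>+\<omega>. (\<Sum>e\<in>I. indicator (E e) \<omega> * h \<omega>) \<partial>M)"
          by (intro nn_integral_cong) (simp add: sum_distrib_right[symmetric] one)
        then show ?thesis by (simp add: nn_integral_sum)
      qed
      have part: "(\<integral>\<^sup>+\<omega>. indicator (E e) \<omega> * f (W (\<lceil>N * \<rho> \<omega>\<rceil> / N) \<omega> - W (\<lceil>N * \<sigma> \<omega>\<rceil> / N) \<omega>) \<omega> \<partial>M)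
          \<le> (\<integral>\<^sup>+\<omega>. indicator (E e) \<omega> * r (\<rho> \<omega> - \<sigma> \<omega> + 1 / N) \<omega> \<partial>M)" (is "?l \<le> ?r") if e: "e \<in> I" for e
      proof (cases "E e = {}")
        case True then show ?thesis by simp
      next
        case False
        then obtain \<omega>0 where \<omega>0: "\<omega>0 \<in> E e" by auto
        obtain i j where ij: "e = (i, j)" by (cases e)
        define s t where "s = real_of_int i / N" and "t = real_of_int j / N"
        have i0: "0 \<le> i" "0 \<le> j" using e by (auto simp: I_def ij)
        have s0: "0 \<le> s" using i0 N by (simp add: s_def)
        have gap: "t - s \<le> \<rho> \<omega> - \<sigma> \<omega> + 1 / N" and le: "\<sigma> \<omega> \<le> s" and ij_le: "i \<le> j"
          if "\<omega> \<in> E e" for \<omega>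
        proof -
          have i: "i = \<lceil>N * \<sigma> \<omega>\<rceil>" and j: "j = \<lceil>N * \<rho> \<omega>\<rceil>" using that by (auto simp: ij E_def)
          have "real_of_int j - real_of_int i \<le> N * \<rho> \<omega> - N * \<sigma> \<omega> + 1" unfolding i j by linarith
          then have "(real_of_int j - real_of_int i) / N \<le> (N * \<rho> \<omega> - N * \<sigma> \<omega> + 1) / N"
            using N by (intro divide_right_mono) auto
          then show "t - s \<le> \<rho> \<omega> - \<sigma> \<omega> + 1 / N"
            using N by (simp add: s_def t_def diff_divide_distrib add_divide_distrib)
          have "N * \<sigma> \<omega> \<le> real_of_int i" unfolding i by simp
          then show "\<sigma> \<omega> \<le> s" using N by (simp add: s_def field_simps)
          show "i \<le> j" unfolding i j using N b[of \<omega>] by (intro ceiling_mono mult_left_mono) auto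
        qed
        have ij_le: "i \<le> j" using ij_le[OF \<omega>0] .
        have "t - s \<le> \<rho> \<omega>0 - \<sigma> \<omega>0 + 1 / N" by (rule gap[OF \<omega>0])
        moreover have "1 / N \<le> 1" using N by simp
        ultimately have ub: "t - s \<le> U + 1" using b(3)[of \<omega>0] by linarith
        have lr: "indicator (E e) \<omega> * f (W (\<lceil>N * \<rho> \<omega>\<rceil> / N) \<omega> - W (\<lceil>N * \<sigma> \<omega>\<rceil> / N) \<omega>) \<omega>
            = indicator (E e) \<omega> * f (W t \<omega> - W s \<omega>) \<omega>" for \<omega>
          by (auto simp: ij E_def s_def t_def indicator_def)
        have rr: "indicator (E e) \<omega> * r (t - s) \<omega> \<le> indicator (E e) \<omega> * r (\<rho> \<omega> - \<sigma> \<omega> + 1 / N) \<omega>" for \<omega>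
          using gap[of \<omega>] b(5)[of \<omega>] R0[of \<omega>] C
          by (auto simp: r_def indicator_def intro!: ennreal_leI mult_left_mono mult_right_mono)
        have "(\<integral>\<^sup>+\<omega>. indicator (E e) \<omega> * f (W t \<omega> - W s \<omega>) \<omega> \<partial>M) \<le> (\<integral>\<^sup>+\<omega>. indicator (E e) \<omega> * r (t - s) \<omega> \<partial>M)"
        proof (cases "i = j")
          \<comment> \<open>Both ends round to the same mesh point: the increment is 0 and
            \<open>gaussian_step\<close>, which wants a positive length, is not called upon.\<close>
          case True
          then have "indicator (E e) \<omega> * f (W t \<omega> - W s \<omega>) \<omega> = indicator (E e) \<omega> * r (t - s) \<omega>" for \<omega>
            by (simp add: f_def r_def s_def t_def)
          then show ?thesis by simp
        next
          case False
          with ij_le N have st: "s < t" by (simp add: s_def t_def divide_strict_right_mono)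
          \<comment> \<open>Setting the data to 0 off \<open>\<sigma> \<le> s\<close> makes them
            known at the deterministic time \<open>s\<close>. Nothing is lost on the cell, because
            rounding up puts \<open>\<sigma>\<close> below \<open>s\<close> there.\<close>
          define wt' a' A' R' where "wt' \<omega> = (if \<sigma> \<omega> \<le> s then indicator (E e) \<omega> * wt \<omega> else 0)"
            and "a' \<omega> = (if \<sigma> \<omega> \<le> s then a \<omega> else 0)"
            and "A' \<omega> = (if \<sigma> \<omega> \<le> s then A \<omega> else 0)"
            and "R' \<omega> = (if \<sigma> \<omega> \<le> s then R \<omega> else 0)" for \<omega>
          have mF: "wt' \<in> borel_measurable (F s)" "a' \<in> borel_measurable (F s)"
            "A' \<in> borel_measurable (F s)" "R' \<in> borel_measurable (F s)"
            unfolding wt'_def a'_def A'_def R'_def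
            by (intro measurable_restrict_pre_sigma[OF \<sigma> _ s0]; measurable)+
          have "(\<integral>\<^sup>+\<omega>. ennreal (wt' \<omega> * norm (a' \<omega> + A' \<omega> *v (W t \<omega> - W s \<omega>)) ^ (2 * k + 2)) \<partial>M)
             \<le> (\<integral>\<^sup>+\<omega>. ennreal (wt' \<omega> * (norm (a' \<omega>) ^ (2 * k + 2) + C * (t - s) * R' \<omega> ^ (k + 1))) \<partial>M)"
          proof (rule step[OF subalgebra_F[OF s0] W_indep[OF s0 st] _ _ _ ub mF(2,3,4,1)])
            show "(\<lambda>\<omega>. W t \<omega> - W s \<omega>) \<in> borel_measurable M"
              using s0 st by (intro borel_measurable_diff W_measurable) auto
            show "distributed M lborel (\<lambda>\<omega>. (W t \<omega> - W s \<omega>) $ l) (normal_density 0 (sqrt (t - s)))" for l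
              by (rule W_normal[OF s0 st])
            show "0 \<le> wt' \<omega> \<and> (norm (a' \<omega>))\<^sup>2 \<le> R' \<omega> \<and> (norm (A' \<omega>))\<^sup>2 \<le> R' \<omega>" for \<omega>
              using b[of \<omega>] by (auto simp: wt'_def a'_def A'_def R'_def)
            have "(\<integral>\<^sup>+\<omega>. ennreal (wt' \<omega> * R' \<omega> ^ (k + 1)) \<partial>M) \<le> (\<integral>\<^sup>+\<omega>. ennreal (wt \<omega> * R \<omega> ^ (k + 1)) \<partial>M)"
              using b R0 by (intro nn_integral_mono ennreal_leI)
                (auto simp: wt'_def R'_def indicator_def)
            also note fin
            finally show "(\<integral>\<^sup>+\<omega>. ennreal (wt' \<omega> * R' \<omega> ^ (k + 1)) \<partial>M) < \<infinity>" .
          qed (use st in auto)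
          moreover have "ennreal (wt' \<omega> * norm (a' \<omega> + A' \<omega> *v (W t \<omega> - W s \<omega>)) ^ (2 * k + 2))
              = indicator (E e) \<omega> * f (W t \<omega> - W s \<omega>) \<omega>"
            "ennreal (wt' \<omega> * (norm (a' \<omega>) ^ (2 * k + 2) + C * (t - s) * R' \<omega> ^ (k + 1)))
              = indicator (E e) \<omega> * r (t - s) \<omega>" for \<omega>
            using le[of \<omega>] by (auto simp: wt'_def a'_def A'_def R'_def f_def r_def indicator_def)
          ultimately show ?thesis by simp
        qed
        also have "\<dots> \<le> ?r" by (intro nn_integral_mono rr)
        finally show ?thesis unfolding lr .
      qed
      have "?L = (\<Sum>e\<in>I. \<integral>\<^sup>+\<omega>. indicator (E e) \<omega> * f (W (\<lceil>N * \<rho> \<omega>\<rceil> / N) \<omega> - W (\<lceil>N * \<sigma> \<omega>\<rceil> / N) \<omega>) \<omega> \<partial>M)"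
      proof (rule split, intro fm borel_measurable_diff Wm)
        fix \<omega>
        have "0 \<le> N * \<rho> \<omega>" "0 \<le> N * \<sigma> \<omega>" using N b[of \<omega>] by auto
        then have "0 \<le> \<lceil>N * \<rho> \<omega>\<rceil>" "0 \<le> \<lceil>N * \<sigma> \<omega>\<rceil>" by linarith+
        then show "0 \<le> \<lceil>N * \<rho> \<omega>\<rceil> / N" "0 \<le> \<lceil>N * \<sigma> \<omega>\<rceil> / N" using N by auto
      qed measurable
      also have "\<dots> \<le> (\<Sum>e\<in>I. \<integral>\<^sup>+\<omega>. indicator (E e) \<omega> * r (\<rho> \<omega> - \<sigma> \<omega> + 1 / N) \<omega> \<partial>M)"
        by (intro sum_mono part)
      also have "\<dots> = ?R" by (rule split[symmetric]) measurable
      finally show ?thesis .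
    qed
    define g where "g n \<omega> = f (W (\<lceil>real (Suc n) * \<rho> \<omega>\<rceil> / real (Suc n)) \<omega> - W (\<lceil>real (Suc n) * \<sigma> \<omega>\<rceil> / real (Suc n)) \<omega>) \<omega>" for n \<omega>
    let ?J = "\<integral>\<^sup>+\<omega>. ennreal (wt \<omega> * R \<omega> ^ (k + 1)) \<partial>M"
    have "(\<integral>\<^sup>+\<omega>. f (W (\<rho> \<omega>) \<omega> - W (\<sigma> \<omega>) \<omega>) \<omega> \<partial>M) = (\<integral>\<^sup>+\<omega>. liminf (\<lambda>n. g n \<omega>) \<partial>M)"
    proof (intro nn_integral_cong)
      fix \<omega> assume \<omega>: "\<omega> \<in> space M"
      have Wl: "(\<lambda>n. W (\<lceil>real (Suc n) * x\<rceil> / real (Suc n)) \<omega>) \<longlonglongrightarrow> W x \<omega>" if x: "0 \<le> x" for x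
      proof (rule continuous_on_tendsto_compose[OF W_continuous[OF \<omega>] ceiling_grid_tendsto])
        show "\<forall>\<^sub>F n in sequentially. \<lceil>real (Suc n) * x\<rceil> / real (Suc n) \<in> {0..}"
          using floor_ceiling_grid_bounds(3)[of "real (Suc n)" x for n] x
          by (intro always_eventually allI) (simp only: atLeast_iff, meson of_nat_0_less_iff order_trans zero_less_Suc)
      qed (use x in simp)
      have "(\<lambda>n. g n \<omega>) \<longlonglongrightarrow> f (W (\<rho> \<omega>) \<omega> - W (\<sigma> \<omega>) \<omega>) \<omega>"
        unfolding g_def f_def
        by (intro tendsto_ennrealI tendsto_intros Wl b(1) order_trans[OF b(1) b(2)] bounded_linear.tendsto[OF matrix_vector_mul_bounded_linear])
      then show "f (W (\<rho> \<omega>) \<omega> - W (\<sigma> \<omega>) \<omega>) \<omega> = liminf (\<lambda>n. g n \<omega>)"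
        by (simp add: lim_imp_Liminf)
    qed
    also have "\<dots> \<le> liminf (\<lambda>n. \<integral>\<^sup>+\<omega>. g n \<omega> \<partial>M)"
    proof (rule nn_integral_liminf)
      fix n
      show "g n \<in> borel_measurable M"
        unfolding g_def
      proof (intro fm borel_measurable_diff Wm)
        fix \<omega>
        have "0 \<le> real (Suc n) * \<rho> \<omega>" "0 \<le> real (Suc n) * \<sigma> \<omega>" using b(1,2)[of \<omega>] by auto
        then have "0 \<le> \<lceil>real (Suc n) * \<rho> \<omega>\<rceil>" "0 \<le> \<lceil>real (Suc n) * \<sigma> \<omega>\<rceil>" by linarith+
        then show "0 \<le> \<lceil>real (Suc n) * \<rho> \<omega>\<rceil> / real (Suc n)" "0 \<le> \<lceil>real (Suc n) * \<sigma> \<omega>\<rceil> / real (Suc n)" by auto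
      qed measurable
    qed
    also have "\<dots> \<le> liminf (\<lambda>n. (\<integral>\<^sup>+\<omega>. r (\<rho> \<omega> - \<sigma> \<omega>) \<omega> \<partial>M) + ennreal (C / real (Suc n)) * ?J)"
    proof (intro Liminf_mono always_eventually allI)
      fix n
      have "(\<integral>\<^sup>+\<omega>. g n \<omega> \<partial>M) \<le> (\<integral>\<^sup>+\<omega>. r (\<rho> \<omega> - \<sigma> \<omega> + 1 / real (Suc n)) \<omega> \<partial>M)"
        unfolding g_def by (rule grid) simp
      also have "\<dots> = (\<integral>\<^sup>+\<omega>. r (\<rho> \<omega> - \<sigma> \<omega>) \<omega> + ennreal (C / real (Suc n)) * ennreal (wt \<omega> * R \<omega> ^ (k + 1)) \<partial>M)"
      proof (intro nn_integral_cong)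
        fix \<omega>
        have "0 \<le> wt \<omega> * (norm (a \<omega>) ^ (2 * k + 2) + C * (\<rho> \<omega> - \<sigma> \<omega>) * R \<omega> ^ (k + 1))"
          using b[of \<omega>] R0[of \<omega>] C by simp
        moreover have "0 \<le> wt \<omega> * R \<omega> ^ (k + 1)" using b[of \<omega>] R0[of \<omega>] by simp
        ultimately show "r (\<rho> \<omega> - \<sigma> \<omega> + 1 / real (Suc n)) \<omega> =
            r (\<rho> \<omega> - \<sigma> \<omega>) \<omega> + ennreal (C / real (Suc n)) * ennreal (wt \<omega> * R \<omega> ^ (k + 1))"
          unfolding r_def using C
          by (simp add: ennreal_mult[symmetric] ennreal_plus[symmetric] del: ennreal_plus)
             (simp add: algebra_simps)
      qed
      also have "\<dots> = (\<integral>\<^sup>+\<omega>. r (\<rho> \<omega> - \<sigma> \<omega>) \<omega> \<partial>M) + ennreal (C / real (Suc n)) * ?J"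
        by (simp add: nn_integral_add nn_integral_cmult)
      finally show "(\<integral>\<^sup>+\<omega>. g n \<omega> \<partial>M) \<le> \<dots>" .
    qed
    \<comment> \<open>The surplus length 1/N costs \<open>C\<close> / N times the integral
      \<open>?J\<close>, which is finite by assumption.\<close>
    also have "\<dots> = (\<integral>\<^sup>+\<omega>. r (\<rho> \<omega> - \<sigma> \<omega>) \<omega> \<partial>M)"
    proof -
      have "(\<lambda>n. C * inverse (real (Suc n))) \<longlonglongrightarrow> 0"
        using tendsto_mult[OF tendsto_const LIMSEQ_inverse_real_of_nat, of C] by simp
      then have "(\<lambda>n. ?J * ennreal (C / real (Suc n))) \<longlonglongrightarrow> ?J * ennreal 0"
        using fin by (intro ennreal_tendsto_cmult tendsto_ennrealI) (auto simp: divide_inverse)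
      then have "(\<lambda>n. (\<integral>\<^sup>+\<omega>. r (\<rho> \<omega> - \<sigma> \<omega>) \<omega> \<partial>M) + ennreal (C / real (Suc n)) * ?J)
          \<longlonglongrightarrow> (\<integral>\<^sup>+\<omega>. r (\<rho> \<omega> - \<sigma> \<omega>) \<omega> \<partial>M) + 0"
        by (intro tendsto_add tendsto_const) (simp add: mult.commute)
      then show ?thesis by (simp add: lim_imp_Liminf)
    qed
    finally show "(\<integral>\<^sup>+\<omega>. ennreal (wt \<omega> * norm (a \<omega> + A \<omega> *v (W (\<rho> \<omega>) \<omega> - W (\<sigma> \<omega>) \<omega>)) ^ (2 * k + 2)) \<partial>M)
       \<le> (\<integral>\<^sup>+\<omega>. ennreal (wt \<omega> * (norm (a \<omega>) ^ (2 * k + 2) + C * (\<rho> \<omega> - \<sigma> \<omega>) * R \<omega> ^ (k + 1))) \<partial>M)"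
      unfolding f_def r_def .
  qed
qed

end

section \<open>Moments and tails\<close>

lemma add_power_le:
  fixes a b :: real
  assumes "0 \<le> a" "0 \<le> b"
  shows "(a + b) ^ p \<le> 2 ^ p * (a ^ p + b ^ p)"
proof -
  have "(a + b) ^ p \<le> (2 * max a b) ^ p" using assms by (intro power_mono) auto
  also have "\<dots> = 2 ^ p * max a b ^ p" by (simp add: power_mult_distrib)
  also have "\<dots> \<le> 2 ^ p * (a ^ p + b ^ p)"
    using assms by (intro mult_left_mono) (auto simp: max_def)
  finally show ?thesis .
qed

text \<open>A mean value bound. It keeps \<open>b\<close> as a linear factor, and \<open>b\<close>
  will be the drift contribution that carries the step size.\<close>

lemma power_Suc_add_le:
  fixes a b :: real
  assumes "0 \<le> a" "0 \<le> b"
  shows "(a + b) ^ (k + 1) \<le> a ^ (k + 1) + real (k + 1) * b * (a + b) ^ k"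
proof (induction k)
  case (Suc k)
  have "(a + b) ^ (Suc k + 1) = (a + b) * (a + b) ^ (k + 1)" by simp
  also have "\<dots> \<le> (a + b) * (a ^ (k + 1) + real (k + 1) * b * (a + b) ^ k)"
    using Suc assms by (intro mult_left_mono) auto
  also have "\<dots> = a ^ (Suc k + 1) + b * a ^ (k + 1) + real (k + 1) * b * (a + b) ^ (k + 1)"
    by (simp add: algebra_simps)
  also have "b * a ^ (k + 1) \<le> b * (a + b) ^ (k + 1)"
    using assms by (intro mult_left_mono power_mono) auto
  finally show ?case by (simp add: algebra_simps)
qed simp

context prob_space
begin

text \<open>Dyadic levels: where \<open>S\<close> lies between \<open>2 ^ j\<close> and
  \<open>2 ^ (j + 1)\<close>, its r-th power is at most \<open>2 ^ ((j + 1) * r)\<close>, while the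
  tail is at most \<open>D\<close> divided by the (r+2)-nd power of \<open>2 ^ j\<close>. The two
  spare powers leave a geometric series of ratio 1/4, whose sum 4/3 is rounded up to 2; values below
  1 account for the summand 1.\<close>

lemma moment_from_tail:
  fixes S :: "'a \<Rightarrow> real"
  assumes S[measurable]: "S \<in> borel_measurable M" and nn: "\<And>\<omega>. 0 \<le> S \<omega>" and D: "0 \<le> D"
    and tail: "\<And>l. 1 \<le> l \<Longrightarrow> ennreal (l ^ (r + 2)) * emeasure M {\<omega> \<in> space M. l \<le> S \<omega>} \<le> ennreal D"
  shows "(\<integral>\<^sup>+\<omega>. ennreal (S \<omega> ^ r) \<partial>M) \<le> ennreal (1 + 2 ^ (r + 1) * D)"
proof -
  let ?E = "\<lambda>j. {\<omega> \<in> space M. 2 ^ j \<le> S \<omega>}"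
  have term_le: "a j \<le> (\<Sum>j. a j)" for a :: "nat \<Rightarrow> ennreal" and j
    using sum_le_suminf[of a "{j}"] by simp
  have pw: "ennreal (S \<omega> ^ r) \<le> 1 + (\<Sum>j. ennreal (2 ^ ((j + 1) * r)) * indicator (?E j) \<omega>)"
    if \<omega>: "\<omega> \<in> space M" for \<omega>
  proof (cases "S \<omega> < 1")
    case True
    then have "S \<omega> ^ r \<le> 1" using nn[of \<omega>] by (intro power_le_one) auto
    then have "ennreal (S \<omega> ^ r) \<le> 1 + 0" by (simp add: ennreal_le_1)
    then show ?thesis by (rule order_trans) (intro add_left_mono, simp)
  next
    case False
    obtain j where j: "2 ^ j \<le> S \<omega>" "S \<omega> < 2 ^ (j + 1)"
    proof -
      have "\<exists>n. S \<omega> < 2 ^ n" by (rule real_arch_pow) simp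
      then obtain n where n: "S \<omega> < 2 ^ n" "\<And>i. i < n \<Longrightarrow> \<not> S \<omega> < 2 ^ i"
        using exists_least_iff[of "\<lambda>n. S \<omega> < 2 ^ n"] by auto
      with False have "n \<noteq> 0" by (metis power_0)
      then show ?thesis using n(1) n(2)[of "n - 1"] by (intro that[of "n - 1"]) auto
    qed
    have "S \<omega> ^ r \<le> (2 ^ (j + 1)) ^ r"
      using j nn[of \<omega>] by (intro power_mono) auto
    then have "ennreal (S \<omega> ^ r) \<le> ennreal (2 ^ ((j + 1) * r)) * indicator (?E j) \<omega>"
      using j \<omega> by (simp add: power_mult[symmetric] power_add ennreal_leI)
    also have "\<dots> \<le> (\<Sum>j. ennreal (2 ^ ((j + 1) * r)) * indicator (?E j) \<omega>)"
      by (rule term_le)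
    finally show ?thesis by (simp add: add_increasing)
  qed
  have tail_term: "ennreal (2 ^ ((j + 1) * r)) * emeasure M (?E j) \<le> ennreal (2 ^ r * D * (1 / 4) ^ j)" for j
  proof -
    have e: "(2::real) ^ ((j + 1) * r) = 2 ^ r * (1 / 4) ^ j * (2 ^ j) ^ (r + 2)"
    proof -
      have "(2::real) ^ ((j + 1) * r) * 4 ^ j = 2 ^ ((j + 1) * r) * (2 ^ 2) ^ j" by simp
      also have "\<dots> = 2 ^ ((j + 1) * r + 2 * j)" by (simp only: power_add power_mult)
      also have "(j + 1) * r + 2 * j = r + j * (r + 2)" by (simp add: algebra_simps)
      also have "(2::real) ^ (r + j * (r + 2)) = 2 ^ r * (2 ^ j) ^ (r + 2)"
        by (simp only: power_add power_mult)
      finally show ?thesis by (simp add: field_simps power_divide)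
    qed
    have "ennreal (2 ^ ((j + 1) * r)) * emeasure M (?E j) =
        ennreal (2 ^ r * (1 / 4) ^ j) * (ennreal ((2 ^ j) ^ (r + 2)) * emeasure M (?E j))"
      unfolding e by (subst ennreal_mult) (auto simp: mult.assoc)
    also have "\<dots> \<le> ennreal (2 ^ r * (1 / 4) ^ j) * ennreal D"
      by (intro mult_left_mono tail) auto
    also have "\<dots> = ennreal (2 ^ r * D * (1 / 4) ^ j)"
      using D by (simp add: ennreal_mult[symmetric] mult_ac)
    finally show ?thesis .
  qed
  have "(\<integral>\<^sup>+\<omega>. ennreal (S \<omega> ^ r) \<partial>M)
      \<le> (\<integral>\<^sup>+\<omega>. 1 + (\<Sum>j. ennreal (2 ^ ((j + 1) * r)) * indicator (?E j) \<omega>) \<partial>M)"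
    by (intro nn_integral_mono pw)
  also have "\<dots> = 1 + (\<Sum>j. ennreal (2 ^ ((j + 1) * r)) * emeasure M (?E j))"
    by (simp add: nn_integral_add nn_integral_suminf nn_integral_cmult emeasure_space_1)
  also have "\<dots> \<le> 1 + (\<Sum>j. ennreal (2 ^ r * D * (1 / 4) ^ j))"
    by (intro add_left_mono suminf_le tail_term) auto
  also have "(\<Sum>j. ennreal (2 ^ r * D * (1 / 4) ^ j)) = ennreal (\<Sum>j. 2 ^ r * D * (1 / 4) ^ j)"
    using D by (intro suminf_ennreal2 summable_mult summable_geometric) auto
  also have "(\<Sum>j. 2 ^ r * D * (1 / 4) ^ j) = 2 ^ r * D * (4 / 3)"
    by (simp add: suminf_mult suminf_geometric summable_geometric)
  also have "1 + ennreal (2 ^ r * D * (4 / 3)) \<le> ennreal (1 + 2 ^ (r + 1) * D)"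
    using D by (subst ennreal_plus) (auto intro!: ennreal_leI mult_left_mono)
  finally show ?thesis .
qed

text \<open>Asking for all powers at once gives a class closed under sums and products, so that
  finiteness arguments need no bookkeeping of exponents.\<close>

definition all_moments :: "('a \<Rightarrow> real) \<Rightarrow> bool" where
  "all_moments Z \<longleftrightarrow> Z \<in> borel_measurable M \<and> (\<forall>p. (\<integral>\<^sup>+\<omega>. ennreal (\<bar>Z \<omega>\<bar> ^ p) \<partial>M) < \<infinity>)"

lemma all_momentsD: "all_moments Z \<Longrightarrow> (\<integral>\<^sup>+\<omega>. ennreal (\<bar>Z \<omega>\<bar> ^ p) \<partial>M) < \<infinity>"
  by (simp add: all_moments_def)

lemma all_moments_measurable: "all_moments Z \<Longrightarrow> Z \<in> borel_measurable M"
  by (simp add: all_moments_def)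

lemma all_moments_bound:
  assumes "all_moments Y" "Z \<in> borel_measurable M" "\<And>\<omega>. \<omega> \<in> space M \<Longrightarrow> \<bar>Z \<omega>\<bar> \<le> \<bar>Y \<omega>\<bar>"
  shows "all_moments Z"
  unfolding all_moments_def
proof (intro conjI allI assms(2))
  fix p
  have "(\<integral>\<^sup>+\<omega>. ennreal (\<bar>Z \<omega>\<bar> ^ p) \<partial>M) \<le> (\<integral>\<^sup>+\<omega>. ennreal (\<bar>Y \<omega>\<bar> ^ p) \<partial>M)"
    using assms(3) by (intro nn_integral_mono ennreal_leI power_mono) auto
  also note all_momentsD[OF assms(1)]
  finally show "(\<integral>\<^sup>+\<omega>. ennreal (\<bar>Z \<omega>\<bar> ^ p) \<partial>M) < \<infinity>" .
qed

lemma all_moments_const: "all_moments (\<lambda>_. c)"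
  by (simp add: all_moments_def emeasure_space_1)

lemma all_moments_add:
  assumes Y: "all_moments Y" and Z: "all_moments Z"
  shows "all_moments (\<lambda>\<omega>. Y \<omega> + Z \<omega>)"
  unfolding all_moments_def
proof (intro conjI allI)
  note [measurable] = Y[THEN all_moments_measurable] Z[THEN all_moments_measurable]
  show "(\<lambda>\<omega>. Y \<omega> + Z \<omega>) \<in> borel_measurable M" by measurable
  fix p
  have "\<bar>Y \<omega> + Z \<omega>\<bar> ^ p \<le> 2 ^ p * (\<bar>Y \<omega>\<bar> ^ p + \<bar>Z \<omega>\<bar> ^ p)" for \<omega>
    by (rule order_trans[OF power_mono[OF abs_triangle_ineq] add_power_le]) auto
  then have "(\<integral>\<^sup>+\<omega>. ennreal (\<bar>Y \<omega> + Z \<omega>\<bar> ^ p) \<partial>M)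
      \<le> (\<integral>\<^sup>+\<omega>. ennreal (2 ^ p * (\<bar>Y \<omega>\<bar> ^ p + \<bar>Z \<omega>\<bar> ^ p)) \<partial>M)"
    by (intro nn_integral_mono ennreal_leI)
  also have "\<dots> = ennreal (2 ^ p) * ((\<integral>\<^sup>+\<omega>. ennreal (\<bar>Y \<omega>\<bar> ^ p) \<partial>M) + (\<integral>\<^sup>+\<omega>. ennreal (\<bar>Z \<omega>\<bar> ^ p) \<partial>M))"
    by (subst nn_integral_add[symmetric], simp, simp, subst nn_integral_cmult[symmetric])
       (auto simp: ennreal_mult[symmetric] ennreal_plus[symmetric] simp del: ennreal_plus)
  also have "\<dots> < \<infinity>"
    using all_momentsD[OF Y, of p] all_momentsD[OF Z, of p] by (simp add: ennreal_mult_less_top)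
  finally show "(\<integral>\<^sup>+\<omega>. ennreal (\<bar>Y \<omega> + Z \<omega>\<bar> ^ p) \<partial>M) < \<infinity>" .
qed

lemma all_moments_mult:
  assumes Y: "all_moments Y" and Z: "all_moments Z"
  shows "all_moments (\<lambda>\<omega>. Y \<omega> * Z \<omega>)"
  unfolding all_moments_def
proof (intro conjI allI)
  note [measurable] = Y[THEN all_moments_measurable] Z[THEN all_moments_measurable]
  show "(\<lambda>\<omega>. Y \<omega> * Z \<omega>) \<in> borel_measurable M" by measurable
  fix p
  have "\<bar>Y \<omega> * Z \<omega>\<bar> ^ p \<le> \<bar>Y \<omega>\<bar> ^ (p + p) + \<bar>Z \<omega>\<bar> ^ (p + p)" for \<omega>
    unfolding abs_mult power_mult_distrib by (intro power_mult_power_le) auto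
  then have "(\<integral>\<^sup>+\<omega>. ennreal (\<bar>Y \<omega> * Z \<omega>\<bar> ^ p) \<partial>M)
      \<le> (\<integral>\<^sup>+\<omega>. ennreal (\<bar>Y \<omega>\<bar> ^ (p + p) + \<bar>Z \<omega>\<bar> ^ (p + p)) \<partial>M)"
    by (intro nn_integral_mono ennreal_leI)
  also have "\<dots> = (\<integral>\<^sup>+\<omega>. ennreal (\<bar>Y \<omega>\<bar> ^ (p + p)) \<partial>M) + (\<integral>\<^sup>+\<omega>. ennreal (\<bar>Z \<omega>\<bar> ^ (p + p)) \<partial>M)"
    by (simp add: nn_integral_add)
  also have "\<dots> < \<infinity>"
    using all_momentsD[OF Y, of "p + p"] all_momentsD[OF Z, of "p + p"] by simp
  finally show "(\<integral>\<^sup>+\<omega>. ennreal (\<bar>Y \<omega> * Z \<omega>\<bar> ^ p) \<partial>M) < \<infinity>" .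
qed

lemma all_moments_sum:
  "finite I \<Longrightarrow> (\<And>i. i \<in> I \<Longrightarrow> all_moments (Z i)) \<Longrightarrow> all_moments (\<lambda>\<omega>. \<Sum>i\<in>I. Z i \<omega>)"
  by (induction I rule: finite_induct) (auto intro: all_moments_add all_moments_const)

text \<open>Any power is at most the even power \<open>2 * p + 2\<close> plus 1, and the powers
  \<open>2 * k + 2\<close> are those that the expansion of the norm controls.\<close>

lemma all_moments_evenI:
  assumes Z[measurable]: "Z \<in> borel_measurable M"
    and fin: "\<And>k. (\<integral>\<^sup>+\<omega>. ennreal (\<bar>Z \<omega>\<bar> ^ (2 * k + 2)) \<partial>M) < \<infinity>"
  shows "all_moments Z"
  unfolding all_moments_def
proof (intro conjI allI Z)
  fix p
  have "\<bar>Z \<omega>\<bar> ^ p \<le> \<bar>Z \<omega>\<bar> ^ (2 * p + 2) + 1" for \<omega>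
    using power_mult_power_le[of "\<bar>Z \<omega>\<bar>" 1 p "p + 2"] by (simp add: mult_2)
  then have "(\<integral>\<^sup>+\<omega>. ennreal (\<bar>Z \<omega>\<bar> ^ p) \<partial>M) \<le> (\<integral>\<^sup>+\<omega>. ennreal (\<bar>Z \<omega>\<bar> ^ (2 * p + 2) + 1) \<partial>M)"
    by (intro nn_integral_mono ennreal_leI)
  also have "\<dots> = (\<integral>\<^sup>+\<omega>. ennreal (\<bar>Z \<omega>\<bar> ^ (2 * p + 2)) \<partial>M) + 1"
    by (simp add: nn_integral_add emeasure_space_1)
  also have "\<dots> < \<infinity>" using fin[of p] by simp
  finally show "(\<integral>\<^sup>+\<omega>. ennreal (\<bar>Z \<omega>\<bar> ^ p) \<partial>M) < \<infinity>" .
qed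

end

section \<open>Random times known at an earlier stopping time\<close>

context brownian
begin

text \<open>As \<open>\<sigma> \<le> \<rho>\<close>, the event \<open>\<rho> \<le> s\<close> equals
  its own trace on \<open>\<sigma> \<le> s\<close>, and that trace is in the filtration at time
  \<open>s\<close>. This is why the next grid time is a stopping time.\<close>

lemma stopping_time_later:
  assumes \<sigma>: "stopping_time FF \<sigma>" and \<rho>[measurable]: "\<rho> \<in> borel_measurable (pre_sigma \<sigma>)"
    and le: "\<And>\<omega>. \<sigma> \<omega> \<le> \<rho> \<omega>"
  shows "stopping_time FF \<rho>"
proof
  fix s
  have "{\<omega> \<in> space (pre_sigma \<sigma>). \<rho> \<omega> \<le> s} \<in> sets (pre_sigma \<sigma>)" by measurable
  from sets_pre_sigmaD[OF \<sigma> this, of s]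
  have "{\<omega> \<in> {\<omega> \<in> space (pre_sigma \<sigma>). \<rho> \<omega> \<le> s}. \<sigma> \<omega> \<le> s} \<in> sets (FF s)" .
  also have "{\<omega> \<in> {\<omega> \<in> space (pre_sigma \<sigma>). \<rho> \<omega> \<le> s}. \<sigma> \<omega> \<le> s} = {\<omega> \<in> space (FF s). \<rho> \<omega> \<le> s}"
    using le order_trans by (fastforce simp: space_pre_sigma space_F_nonneg)
  finally show "Measurable.pred (FF s) (\<lambda>\<omega>. \<rho> \<omega> \<le> s)" by (simp add: pred_def)
qed

lemma measurable_pre_sigma_mono:
  assumes "stopping_time FF \<sigma>" "stopping_time FF \<rho>" "\<And>\<omega>. \<sigma> \<omega> \<le> \<rho> \<omega>"
    and "H \<in> borel_measurable (pre_sigma \<sigma>)"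
  shows "H \<in> borel_measurable (pre_sigma \<rho>)"
  using mono_pre_sigma[OF assms(1,2)] assms(3,4)
  by (intro measurable_from_subalg[of "pre_sigma \<rho>" "pre_sigma \<sigma>"])
     (auto simp: subalgebra_def space_pre_sigma)

lemma F0_pre_sigma:
  assumes \<sigma>: "stopping_time FF \<sigma>" and nn: "\<And>\<omega>. 0 \<le> \<sigma> \<omega>" and H: "H \<in> borel_measurable (F 0)"
  shows "H \<in> borel_measurable (pre_sigma \<sigma>)"
proof (rule measurable_from_subalg[OF _ H])
  have "A \<in> sets (pre_sigma \<sigma>)" if A: "A \<in> sets (F 0)" for A
  proof (rule sets_pre_sigmaI[OF \<sigma>])
    fix s
    have "A \<inter> {\<omega> \<in> space (FF s). \<sigma> \<omega> \<le> s} \<in> sets (FF s)"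
      using A F_mono[of 0 "max 0 s"] stopping_timeD[OF \<sigma>, of s]
      by (intro sets.Int) (auto simp: pred_def)
    also have "A \<inter> {\<omega> \<in> space (FF s). \<sigma> \<omega> \<le> s} = {\<omega> \<in> A. \<sigma> \<omega> \<le> s}"
      using sets.sets_into_space[OF A] by (auto simp: space_F_nonneg)
    finally show "{\<omega> \<in> A. \<sigma> \<omega> \<le> s} \<in> sets (FF s)" .
  qed
  then show "subalgebra (pre_sigma \<sigma>) (F 0)"
    by (auto simp: subalgebra_def space_pre_sigma space_F_nonneg)
qed

end

section \<open>The scheme as an adapted process\<close>

text \<open>One step function, with \<delta> gone: \<open>h x \<le> T\<close> is the only uniform
  information kept about its size. \<open>drift_bound\<close> is required for partial steps too,
  since the continuous-time interpolation stops inside a step. A single \<open>L\<close> serves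
  drift and diffusion, and \<open>\<Xi>\<close> is a measurable majorant of the initial
  path.\<close>

locale em_scheme = brownian M F W
  for M :: "'w measure" and F and W :: "real \<Rightarrow> 'w \<Rightarrow> real ^ 'd" +
  fixes f :: "real ^ 'm \<Rightarrow> real ^ 'm \<Rightarrow> real ^ 'm"
    and g :: "real ^ 'm \<Rightarrow> real ^ 'm \<Rightarrow> real ^ 'd ^ 'm"
    and h :: "real ^ 'm \<Rightarrow> real"
    and \<xi> :: "'w \<Rightarrow> real \<Rightarrow> real ^ 'm"
    and \<Xi> :: "'w \<Rightarrow> real"
    and \<tau> T L :: real
  assumes tau_pos: "0 < \<tau>" and T_pos: "0 < T" and L_nonneg: "0 \<le> L"
    and f_measurable: "case_prod f \<in> borel_measurable borel"
    and g_measurable: "case_prod g \<in> borel_measurable borel"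
    and h_continuous: "continuous_on UNIV h"
    and h_pos: "0 < h x" and h_le: "h x \<le> T"
    and drift_bound: "0 \<le> s \<Longrightarrow> s \<le> h x \<Longrightarrow>
      (norm (x + s *\<^sub>R f x y))\<^sup>2 \<le> (norm x)\<^sup>2 + 2 * s * (L * (1 + (norm x)\<^sup>2 + (norm y)\<^sup>2))"
    and diffusion_bound: "(norm (g x y))\<^sup>2 \<le> L * (1 + (norm x)\<^sup>2 + (norm y)\<^sup>2)"
    and \<xi>_continuous: "\<omega> \<in> space M \<Longrightarrow> continuous_on {-\<tau>..0} (\<xi> \<omega>)"
    and \<xi>_measurable: "\<theta> \<in> {-\<tau>..0} \<Longrightarrow> (\<lambda>\<omega>. \<xi> \<omega> \<theta>) \<in> borel_measurable (F 0)"
    and \<Xi>_bound: "\<omega> \<in> space M \<Longrightarrow> \<theta> \<in> {-\<tau>..0} \<Longrightarrow> norm (\<xi> \<omega> \<theta>) \<le> \<Xi> \<omega>"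
    and \<Xi>_moments: "all_moments \<Xi>"
begin

definition "t n \<omega> = em_time f g h \<tau> (\<xi> \<omega>) (\<lambda>s. W s \<omega>) n"
definition "X n \<omega> = em_val f g h \<tau> (\<xi> \<omega>) (\<lambda>s. W s \<omega>) n"
definition "Y n \<omega> = em_bar f g h \<tau> (\<xi> \<omega>) (\<lambda>s. W s \<omega>) (t n \<omega> - \<tau>)"

lemma t_0: "t 0 \<omega> = 0" and X_0: "X 0 \<omega> = \<xi> \<omega> 0"
  by (simp_all add: t_def X_def em_time_0[OF h_pos tau_pos] em_val_0[OF h_pos tau_pos])

lemma t_Suc: "t (Suc n) \<omega> = t n \<omega> + h (X n \<omega>)"
  by (simp add: t_def X_def em_time_Suc[OF h_pos tau_pos])

lemma X_Suc: "X (Suc n) \<omega> = (X n \<omega> + h (X n \<omega>) *\<^sub>R f (X n \<omega>) (Y n \<omega>))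
    + g (X n \<omega>) (Y n \<omega>) *v (W (t (Suc n) \<omega>) \<omega> - W (t n \<omega>) \<omega>)"
  using em_val_Suc[OF h_pos tau_pos, where f=f and g=g and \<xi>="\<xi> \<omega>" and w="\<lambda>s. W s \<omega>" and n=n]
    em_bar_time[OF h_pos tau_pos, where f=f and g=g and \<xi>="\<xi> \<omega>" and w="\<lambda>s. W s \<omega>" and n=n]
  by (simp add: t_def X_def Y_def)

lemma t_mono: "m \<le> n \<Longrightarrow> t m \<omega> \<le> t n \<omega>"
  by (rule lift_Suc_mono_le[of "\<lambda>n. t n \<omega>"]) (use h_pos less_imp_le in \<open>auto simp: t_Suc\<close>)

lemma t_nonneg: "0 \<le> t n \<omega>"
  using t_mono[of 0 n \<omega>] by (simp add: t_0)

lemma t_Suc_le: "t (Suc n) \<omega> \<le> t n \<omega> + T"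
  using h_le by (simp add: t_Suc)

lemma t_le: "t n \<omega> \<le> real n * T"
proof (induction n)
  case (Suc n) then show ?case using t_Suc_le[of n \<omega>] by (simp add: algebra_simps)
qed (simp add: t_0)

lemma t_less: "t n \<omega> < t (Suc n) \<omega>"
  using h_pos by (simp add: t_Suc)

lemma ex_step:
  assumes "0 \<le> s" "s < t n \<omega>"
  obtains m where "m < n" "t m \<omega> \<le> s" "s < t (Suc m) \<omega>"
proof -
  define m where "m = (LEAST m. s < t (Suc m) \<omega>)"
  obtain k where k: "n = Suc k" using assms by (cases n) (auto simp: t_0)
  have ex: "s < t (Suc k) \<omega>" using assms k by simp
  then have m1: "s < t (Suc m) \<omega>" unfolding m_def by (rule LeastI)
  have "m \<le> k" unfolding m_def using ex by (rule Least_le)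
  moreover have "t m \<omega> \<le> s"
  proof (cases m)
    case 0 then show ?thesis using assms by (simp add: t_0)
  next
    case (Suc j)
    then have "\<not> s < t (Suc j) \<omega>" using not_less_Least[of j "\<lambda>m. s < t (Suc m) \<omega>"] by (simp add: m_def)
    then show ?thesis using Suc by simp
  qed
  ultimately show ?thesis using m1 k by (intro that[of m]) auto
qed

lemma Y_early: "t n \<omega> < \<tau> \<Longrightarrow> Y n \<omega> = \<xi> \<omega> (t n \<omega> - \<tau>)"
  by (simp add: Y_def em_bar_neg[OF h_pos tau_pos])

lemma Y_late: "t m \<omega> \<le> t n \<omega> - \<tau> \<Longrightarrow> t n \<omega> - \<tau> < t (Suc m) \<omega> \<Longrightarrow> Y n \<omega> = X m \<omega>"
  unfolding Y_def X_def by (rule em_bar_step[OF h_pos tau_pos]) (simp_all add: t_def)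

text \<open>Writes the delayed value through measurable pieces. The sum has exactly one nonzero
  index, and that index is below \<open>n\<close> because the delay is positive. Clipping the
  argument of \<open>\<xi>\<close> keeps it in the interval where continuity is known.\<close>

lemma Y_eq: "Y n \<omega> = (if t n \<omega> < \<tau> then \<xi> \<omega> (max (-\<tau>) (min 0 (t n \<omega> - \<tau>)))
    else \<Sum>m<n. if t m \<omega> \<le> t n \<omega> - \<tau> \<and> t n \<omega> - \<tau> < t (Suc m) \<omega> then X m \<omega> else 0)"
proof (cases "t n \<omega> < \<tau>")
  case True
  then show ?thesis using t_nonneg[of n \<omega>] by (simp add: Y_early)
next
  case False
  then obtain m where m: "m < n" "t m \<omega> \<le> t n \<omega> - \<tau>" "t n \<omega> - \<tau> < t (Suc m) \<omega>"
    using ex_step[of "t n \<omega> - \<tau>" n \<omega>] tau_pos by auto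
  have uniq: "j = m" if "t j \<omega> \<le> t n \<omega> - \<tau>" "t n \<omega> - \<tau> < t (Suc j) \<omega>" for j
  proof (rule ccontr)
    assume "j \<noteq> m"
    then have "Suc j \<le> m \<or> Suc m \<le> j" by auto
    then show False using t_mono[of "Suc j" m \<omega>] t_mono[of "Suc m" j \<omega>] that m by auto
  qed
  have "(\<Sum>j<n. if t j \<omega> \<le> t n \<omega> - \<tau> \<and> t n \<omega> - \<tau> < t (Suc j) \<omega> then X j \<omega> else 0)
      = (\<Sum>j<n. if j = m then X m \<omega> else 0)"
  proof (intro sum.cong refl)
    fix j
    show "(if t j \<omega> \<le> t n \<omega> - \<tau> \<and> t n \<omega> - \<tau> < t (Suc j) \<omega> then X j \<omega> else 0) = (if j = m then X m \<omega> else 0)"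
      using uniq[of j] m(2,3) by (cases "j = m") auto
  qed
  then show ?thesis using False m Y_late[OF m(2,3)] by simp
qed

text \<open>The source of the induction over windows: up to time \<open>K + \<tau>\<close> the
  delayed argument looks only at the initial path or at grid values up to time
  \<open>K\<close>.\<close>

lemma norm_Y_le:
  assumes "\<omega> \<in> space M" "t n \<omega> \<le> K + \<tau>"
  shows "norm (Y n \<omega>) \<le> \<Xi> \<omega> \<or> (\<exists>m<n. t m \<omega> \<le> K \<and> Y n \<omega> = X m \<omega>)"
proof (cases "t n \<omega> < \<tau>")
  case True
  then show ?thesis using \<Xi>_bound[OF assms(1), of "t n \<omega> - \<tau>"] t_nonneg[of n \<omega>] by (simp add: Y_early)
next
  case False
  then obtain m where m: "m < n" "t m \<omega> \<le> t n \<omega> - \<tau>" "t n \<omega> - \<tau> < t (Suc m) \<omega>"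
    using ex_step[of "t n \<omega> - \<tau>" n \<omega>] tau_pos by auto
  have "t m \<omega> \<le> K" using m(2) assms(2) by simp
  then show ?thesis using m Y_late[OF m(2,3)] by auto
qed

lemma h_measurable: "h \<in> borel_measurable borel"
  by (rule borel_measurable_continuous_onI[OF h_continuous])

lemma coefficient_measurable:
  assumes "x \<in> borel_measurable N" "y \<in> borel_measurable N"
  shows "(\<lambda>\<omega>. f (x \<omega>) (y \<omega>)) \<in> borel_measurable N" "(\<lambda>\<omega>. g (x \<omega>) (y \<omega>)) \<in> borel_measurable N"
proof -
  have "(\<lambda>\<omega>. (x \<omega>, y \<omega>)) \<in> borel_measurable N" using assms by (rule borel_measurable_Pair)
  from measurable_compose[OF this f_measurable] measurable_compose[OF this g_measurable]
  show "(\<lambda>\<omega>. f (x \<omega>) (y \<omega>)) \<in> borel_measurable N" "(\<lambda>\<omega>. g (x \<omega>) (y \<omega>)) \<in> borel_measurable N"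
    by simp_all
qed

lemma matrix_vector_mult_measurable:
  fixes A :: "'v \<Rightarrow> real ^ 'd ^ 'm"
  assumes "A \<in> borel_measurable N" "z \<in> borel_measurable N"
  shows "(\<lambda>\<omega>. A \<omega> *v z \<omega>) \<in> borel_measurable N"
  by (rule borel_measurable_continuous_Pair[OF assms])
     (auto simp: matrix_vector_mult_def intro!: continuous_intros)

text \<open>Measurability of the past is a hypothesis because the lemma is used inside the induction
  that proves it.\<close>

lemma Y_measurable_of:
  assumes st: "stopping_time FF (t n)"
    and prev: "\<And>m. m \<le> n \<Longrightarrow> t m \<in> borel_measurable (pre_sigma (t n)) \<and> X m \<in> borel_measurable (pre_sigma (t n))"
  shows "Y n \<in> borel_measurable (pre_sigma (t n))"
proof -
  have tm[measurable]: "t m \<in> borel_measurable (pre_sigma (t n))"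
    and Xm[measurable]: "X m \<in> borel_measurable (pre_sigma (t n))" if "m \<le> n" for m
    using prev[OF that] by auto
  note [measurable] = tm[OF order_refl]
  have "(\<lambda>\<omega>. \<xi> \<omega> (max (-\<tau>) (min 0 (t n \<omega> - \<tau>)))) \<in> borel_measurable (pre_sigma (t n))"
  proof (rule borel_measurable_random_eval[where V="\<lambda>r \<omega>. \<xi> \<omega> (max (-\<tau>) (min 0 r))"])
    show "(\<lambda>\<omega>. \<xi> \<omega> (max (-\<tau>) (min 0 r))) \<in> borel_measurable (pre_sigma (t n))" for r
      using tau_pos by (intro F0_pre_sigma[OF st t_nonneg] \<xi>_measurable) auto
    fix \<omega> assume "\<omega> \<in> space (pre_sigma (t n))"
    then have "\<omega> \<in> space M" by (simp add: space_pre_sigma)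
    then show "continuous_on UNIV (\<lambda>r. \<xi> \<omega> (max (-\<tau>) (min 0 r)))"
      using tau_pos by (intro continuous_on_compose2[OF \<xi>_continuous]) (auto intro!: continuous_intros)
  qed measurable
  moreover have "(\<lambda>\<omega>. \<Sum>m<n. if t m \<omega> \<le> t n \<omega> - \<tau> \<and> t n \<omega> - \<tau> < t (Suc m) \<omega> then X m \<omega> else 0)
      \<in> borel_measurable (pre_sigma (t n))"
  proof (intro borel_measurable_sum)
    fix m assume "m \<in> {..<n}"
    then have "m \<le> n" "Suc m \<le> n" by auto
    note [measurable] = tm[OF this(1)] tm[OF this(2)] Xm[OF this(1)]
    show "(\<lambda>\<omega>. if t m \<omega> \<le> t n \<omega> - \<tau> \<and> t n \<omega> - \<tau> < t (Suc m) \<omega> then X m \<omega> else 0)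
      \<in> borel_measurable (pre_sigma (t n))" by measurable
  qed
  moreover have "{\<omega> \<in> space (pre_sigma (t n)). t n \<omega> < \<tau>} \<in> sets (pre_sigma (t n))"
    by measurable
  ultimately have "(\<lambda>\<omega>. if t n \<omega> < \<tau> then \<xi> \<omega> (max (-\<tau>) (min 0 (t n \<omega> - \<tau>)))
    else \<Sum>m<n. if t m \<omega> \<le> t n \<omega> - \<tau> \<and> t n \<omega> - \<tau> < t (Suc m) \<omega> then X m \<omega> else 0)
    \<in> borel_measurable (pre_sigma (t n))" by (intro measurable_If)
  then show ?thesis by (subst Y_eq[abs_def])
qed

text \<open>The two claims need each other: the next grid time is a stopping time because the
  present value is known, and the next value is known because \<open>W\<close> is measurable at
  stopping times.\<close>

lemma adapted: "stopping_time FF (t n) \<and>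
  (\<forall>m\<le>n. t m \<in> borel_measurable (pre_sigma (t n)) \<and> X m \<in> borel_measurable (pre_sigma (t n)))"
proof (induction n)
  case 0
  have st: "stopping_time FF (t 0)" unfolding t_0[abs_def] by (rule stopping_time_const)
  have "X 0 \<in> borel_measurable (pre_sigma (t 0))"
    unfolding X_0[abs_def] using tau_pos by (intro F0_pre_sigma[OF st t_nonneg] \<xi>_measurable) auto
  with st show ?case using measurable_stopping_time_pre_sigma[OF st] by auto
next
  case (Suc n)
  then have st: "stopping_time FF (t n)"
    and prev: "\<And>m. m \<le> n \<Longrightarrow> t m \<in> borel_measurable (pre_sigma (t n)) \<and> X m \<in> borel_measurable (pre_sigma (t n))"
    by auto
  note [measurable] = h_measurable prev[OF order_refl, THEN conjunct1] prev[OF order_refl, THEN conjunct2]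
  have tS: "t (Suc n) \<in> borel_measurable (pre_sigma (t n))"
    unfolding t_Suc[abs_def] by measurable
  have st': "stopping_time FF (t (Suc n))"
    by (rule stopping_time_later[OF st tS]) (use t_less less_imp_le in auto)
  have up: "H \<in> borel_measurable (pre_sigma (t n)) \<Longrightarrow> H \<in> borel_measurable (pre_sigma (t (Suc n)))"
    for H :: "'w \<Rightarrow> 'b :: topological_space"
    by (rule measurable_pre_sigma_mono[OF st st']) (use t_less less_imp_le in auto)
  have Xn: "X n \<in> borel_measurable (pre_sigma (t (Suc n)))" and Yn: "Y n \<in> borel_measurable (pre_sigma (t (Suc n)))"
    using prev[OF order_refl] Y_measurable_of[OF st prev] by (auto intro: up)
  note [measurable] = Xn coefficient_measurable[OF Xn Yn]
    W_stopping_time_measurable[OF st' t_nonneg] up[OF W_stopping_time_measurable[OF st t_nonneg]]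
  have "X (Suc n) \<in> borel_measurable (pre_sigma (t (Suc n)))"
    unfolding X_Suc[abs_def]
    by (intro borel_measurable_add matrix_vector_mult_measurable) measurable
  moreover have "t m \<in> borel_measurable (pre_sigma (t (Suc n)))" "X m \<in> borel_measurable (pre_sigma (t (Suc n)))"
    if "m \<le> n" for m
    using prev[OF that] by (auto intro: up)
  ultimately show ?case
    using st' measurable_stopping_time_pre_sigma[OF st'] by (metis le_Suc_eq)
qed

lemmas stopping_time_t = adapted[THEN conjunct1]

lemma t_adapted: "m \<le> n \<Longrightarrow> t m \<in> borel_measurable (pre_sigma (t n))"
  and X_adapted: "m \<le> n \<Longrightarrow> X m \<in> borel_measurable (pre_sigma (t n))"
  using adapted[of n] by auto

lemma Y_adapted: "Y n \<in> borel_measurable (pre_sigma (t n))"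
  by (rule Y_measurable_of) (use adapted in auto)

text \<open>The end of a step is known at its beginning; \<open>increment_bound\<close> can be
  applied between consecutive grid times for this reason only.\<close>

lemma t_Suc_adapted: "t (Suc n) \<in> borel_measurable (pre_sigma (t n))"
  unfolding t_Suc[abs_def]
  using h_measurable t_adapted[OF order_refl] X_adapted[OF order_refl] by measurable

lemmas from_pre_sigma = measurable_from_subalg[OF subalgebra_pre_sigma[OF stopping_time_t]]

lemma t_measurable[measurable]: "t n \<in> borel_measurable M"
  and X_measurable[measurable]: "X n \<in> borel_measurable M"
  and Y_measurable[measurable]: "Y n \<in> borel_measurable M"
  using from_pre_sigma[OF t_adapted[OF order_refl]] from_pre_sigma[OF X_adapted[OF order_refl]]
    from_pre_sigma[OF Y_adapted] by auto

end

section \<open>Lyapunov estimate along the random grid\<close>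

lemma power_sum3_le:
  fixes a b :: real
  assumes "0 \<le> a" "0 \<le> b"
  shows "(1 + a + b) ^ p \<le> 3 ^ p * (1 + a ^ p + b ^ p)"
proof -
  define m where "m = max 1 (max a b)"
  have "(1 + a + b) ^ p \<le> (3 * m) ^ p" using assms by (intro power_mono) (auto simp: m_def)
  also have "\<dots> = 3 ^ p * m ^ p" by (simp add: power_mult_distrib)
  also have "\<dots> \<le> 3 ^ p * (1 + a ^ p + b ^ p)"
    using assms by (intro mult_left_mono) (auto simp: m_def max_def)
  finally show ?thesis .
qed

lemma power2_power_Suc: "((x :: real)\<^sup>2) ^ (k + 1) = x ^ (2 * k + 2)"
proof -
  have "2 * k + 2 = 2 * (k + 1)" by simp
  then show ?thesis by (simp only: power_mult)
qed

context em_scheme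
begin

abbreviation "drifted n \<omega> \<equiv> X n \<omega> + h (X n \<omega>) *\<^sub>R f (X n \<omega>) (Y n \<omega>)"
abbreviation "mass n \<omega> \<equiv> 1 + (norm (X n \<omega>))\<^sup>2 + (norm (Y n \<omega>))\<^sup>2"

text \<open>One factor that turns \<open>mass\<close> into a common bound, the \<open>R\<close> of
  \<open>increment_bound\<close>: \<open>1 + 2 * T * L\<close> suffices for the squared drifted
  value and \<open>L\<close> for the squared diffusion coefficient.\<close>

definition "growth = 1 + 2 * T * L + L"

lemma growth_ge: "1 \<le> growth" "1 + 2 * T * L \<le> growth" "L \<le> growth"
  using T_pos L_nonneg by (simp_all add: growth_def)

lemma norm_drifted_sq: "(norm (drifted n \<omega>))\<^sup>2 \<le> (norm (X n \<omega>))\<^sup>2 + 2 * h (X n \<omega>) * (L * mass n \<omega>)"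
  by (rule drift_bound) (use h_pos less_imp_le in auto)

lemma norm_drifted_sq_le: "(norm (drifted n \<omega>))\<^sup>2 \<le> (1 + 2 * T * L) * mass n \<omega>"
proof -
  have "2 * h (X n \<omega>) * (L * mass n \<omega>) \<le> 2 * T * (L * mass n \<omega>)"
    using h_le L_nonneg by (intro mult_right_mono) auto
  moreover have "(norm (X n \<omega>))\<^sup>2 \<le> mass n \<omega>" by simp
  moreover have "(1 + 2 * T * L) * mass n \<omega> = mass n \<omega> + 2 * T * (L * mass n \<omega>)"
    by (simp only: distrib_right mult_1_left mult.assoc)
  ultimately show ?thesis using norm_drifted_sq[of n \<omega>] by linarith
qed

lemma drifted_le_growth: "(norm (drifted n \<omega>))\<^sup>2 \<le> growth * mass n \<omega>"
  using mult_right_mono[OF growth_ge(2), of "mass n \<omega>"] norm_drifted_sq_le[of n \<omega>] by simp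

lemma diffusion_le_growth: "(norm (g (X n \<omega>) (Y n \<omega>)))\<^sup>2 \<le> growth * mass n \<omega>"
  using mult_right_mono[OF growth_ge(3), of "mass n \<omega>"] diffusion_bound[of "X n \<omega>" "Y n \<omega>"] by simp

text \<open>Adding up all earlier values is crude and depends on \<open>n\<close>, but only
  finiteness is at stake here.\<close>

lemma Y_moments_of:
  assumes "\<And>m. m < n \<Longrightarrow> all_moments (\<lambda>\<omega>. norm (X m \<omega>))"
  shows "all_moments (\<lambda>\<omega>. norm (Y n \<omega>))"
proof (rule all_moments_bound[of "\<lambda>\<omega>. \<Xi> \<omega> + (\<Sum>m<n. norm (X m \<omega>))"])
  show "all_moments (\<lambda>\<omega>. \<Xi> \<omega> + (\<Sum>m<n. norm (X m \<omega>)))"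
    using assms by (intro all_moments_add all_moments_sum \<Xi>_moments) auto
  fix \<omega> assume \<omega>: "\<omega> \<in> space M"
  have "0 \<le> norm (\<xi> \<omega> 0)" by simp
  also have "\<dots> \<le> \<Xi> \<omega>" using \<Xi>_bound[OF \<omega>, of 0] tau_pos by simp
  finally have \<Xi>: "0 \<le> \<Xi> \<omega>" .
  consider "norm (Y n \<omega>) \<le> \<Xi> \<omega>" | m where "m < n" "Y n \<omega> = X m \<omega>"
    using norm_Y_le[OF \<omega>, of n "t n \<omega>"] tau_pos by auto
  then have "norm (Y n \<omega>) \<le> \<Xi> \<omega> + (\<Sum>m<n. norm (X m \<omega>))"
  proof cases
    case 1
    then show ?thesis by (rule order_trans) (simp add: sum_nonneg)
  next
    case 2
    then have "norm (Y n \<omega>) \<le> (\<Sum>m<n. norm (X m \<omega>))"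
      using member_le_sum[of m "{..<n}" "\<lambda>m. norm (X m \<omega>)"] by simp
    then show ?thesis using \<Xi> by simp
  qed
  then show "\<bar>norm (Y n \<omega>)\<bar> \<le> \<bar>\<Xi> \<omega> + (\<Sum>m<n. norm (X m \<omega>))\<bar>" by simp
qed simp

lemma mass_moments:
  assumes "\<And>m. m \<le> n \<Longrightarrow> all_moments (\<lambda>\<omega>. norm (X m \<omega>))"
  shows "all_moments (\<lambda>\<omega>. growth * mass n \<omega>)"
proof -
  have "all_moments (\<lambda>\<omega>. norm (Y n \<omega>))" using assms by (intro Y_moments_of) auto
  then show ?thesis
    unfolding power2_eq_square using assms
    by (intro all_moments_mult all_moments_add all_moments_const) auto
qed

text \<open>\<open>increment_bound\<close> between consecutive grid times. The moment hypothesis and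
  \<open>wt \<le> 1\<close> supply the finite integral that it demands; \<open>X_moments\<close>
  removes the former afterwards.\<close>

lemma step_of_moments:
  assumes c: "increment_bound TYPE('m) T k c"
    and mom: "\<And>m. m \<le> n \<Longrightarrow> all_moments (\<lambda>\<omega>. norm (X m \<omega>))"
    and wt: "wt \<in> borel_measurable (pre_sigma (t n))" "\<And>\<omega>. 0 \<le> wt \<omega>" "\<And>\<omega>. wt \<omega> \<le> 1"
  shows "(\<integral>\<^sup>+\<omega>. ennreal (wt \<omega> * norm (X (Suc n) \<omega>) ^ (2 * k + 2)) \<partial>M)
    \<le> (\<integral>\<^sup>+\<omega>. ennreal (wt \<omega> * (norm (drifted n \<omega>) ^ (2 * k + 2)
         + c * h (X n \<omega>) * (growth * mass n \<omega>) ^ (k + 1))) \<partial>M)"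
proof -
  note st = stopping_time_t
  note Xn[measurable] = X_adapted[of n n, OF order_refl]
  note Yn[measurable] = Y_adapted[of n]
  note [measurable] = coefficient_measurable[OF Xn Yn] h_measurable
  have hm: "drifted n \<in> borel_measurable (pre_sigma (t n))"
    "(\<lambda>\<omega>. growth * mass n \<omega>) \<in> borel_measurable (pre_sigma (t n))" by measurable
  have gm: "(\<lambda>\<omega>. g (X n \<omega>) (Y n \<omega>)) \<in> borel_measurable (pre_sigma (t n))" by measurable
  have le: "\<forall>\<omega>. 0 \<le> t n \<omega> \<and> t n \<omega> \<le> t (Suc n) \<omega> \<and> t (Suc n) \<omega> \<le> t n \<omega> + T \<and> t (Suc n) \<omega> \<le> real (Suc n) * T \<and>
      0 \<le> wt \<omega> \<and> (norm (drifted n \<omega>))\<^sup>2 \<le> growth * mass n \<omega> \<and> (norm (g (X n \<omega>) (Y n \<omega>)))\<^sup>2 \<le> growth * mass n \<omega>"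
    using t_nonneg t_less[THEN less_imp_le] t_Suc_le t_le wt drifted_le_growth diffusion_le_growth by blast
  have m0: "0 \<le> growth * mass n \<omega>" for \<omega> using growth_ge(1) by simp
  have "(\<integral>\<^sup>+\<omega>. ennreal (wt \<omega> * (growth * mass n \<omega>) ^ (k + 1)) \<partial>M) \<le>
      (\<integral>\<^sup>+\<omega>. ennreal (\<bar>growth * mass n \<omega>\<bar> ^ (k + 1)) \<partial>M)"
    using wt m0 by (intro nn_integral_mono ennreal_leI) (auto simp: abs_of_nonneg mult_left_le_one_le)
  also have "\<dots> < \<infinity>" by (rule all_momentsD[OF mass_moments[OF mom]])
  finally have fin: "(\<integral>\<^sup>+\<omega>. ennreal (wt \<omega> * (growth * mass n \<omega>) ^ (k + 1)) \<partial>M) < \<infinity>" .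
  show ?thesis
    using c[unfolded increment_bound_def, THEN conjunct2, rule_format, OF st t_Suc_adapted hm(1) gm hm(2) wt(1) le[rule_format] fin]
    by (simp add: X_Suc t_Suc)
qed

text \<open>Purely qualitative, with bounds that may explode in \<open>n\<close>. The induction is
  strong because the delayed value can be any earlier grid value.\<close>

lemma X_moments: "all_moments (\<lambda>\<omega>. norm (X n \<omega>))"
proof (induction n rule: less_induct)
  case (less n)
  show ?case
  proof (cases n)
    case 0
    show ?thesis
    proof (rule all_moments_bound[OF \<Xi>_moments])
      fix \<omega> assume "\<omega> \<in> space M"
      then show "\<bar>norm (X n \<omega>)\<bar> \<le> \<bar>\<Xi> \<omega>\<bar>"
        using \<Xi>_bound[of \<omega> 0] tau_pos by (simp add: X_0 0)
    qed simp
  next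
    case (Suc n')
    show ?thesis
    proof (rule all_moments_evenI)
      fix k
      obtain c where c: "increment_bound TYPE('m) T k c" using increment_bound_exists by blast
      have c0: "0 \<le> c" using c by (simp add: increment_bound_def)
      have mom: "all_moments (\<lambda>\<omega>. norm (X m \<omega>))" if "m \<le> n'" for m using less Suc that by auto
      have "(\<integral>\<^sup>+\<omega>. ennreal (\<bar>norm (X n \<omega>)\<bar> ^ (2 * k + 2)) \<partial>M)
          \<le> (\<integral>\<^sup>+\<omega>. ennreal (norm (drifted n' \<omega>) ^ (2 * k + 2) + c * h (X n' \<omega>) * (growth * mass n' \<omega>) ^ (k + 1)) \<partial>M)"
        using step_of_moments[OF c mom, of n' "\<lambda>_. 1"] by (simp add: Suc)
      also have "\<dots> \<le> (\<integral>\<^sup>+\<omega>. ennreal (1 + c * T) * ennreal (\<bar>growth * mass n' \<omega>\<bar> ^ (k + 1)) \<partial>M)"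
      proof (intro nn_integral_mono)
        fix \<omega>
        have m0: "0 \<le> growth * mass n' \<omega>" using growth_ge(1) by simp
        have "norm (drifted n' \<omega>) ^ (2 * k + 2) = ((norm (drifted n' \<omega>))\<^sup>2) ^ (k + 1)"
          by (rule power2_power_Suc[symmetric])
        also have "\<dots> \<le> (growth * mass n' \<omega>) ^ (k + 1)"
          by (intro power_mono drifted_le_growth) simp
        finally have 1: "norm (drifted n' \<omega>) ^ (2 * k + 2) \<le> (growth * mass n' \<omega>) ^ (k + 1)" .
        have 2: "c * h (X n' \<omega>) * (growth * mass n' \<omega>) ^ (k + 1) \<le> c * T * (growth * mass n' \<omega>) ^ (k + 1)"
          using h_le[of "X n' \<omega>"] c0 m0 by (intro mult_right_mono mult_left_mono) auto
        have "norm (drifted n' \<omega>) ^ (2 * k + 2) + c * h (X n' \<omega>) * (growth * mass n' \<omega>) ^ (k + 1)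
            \<le> (1 + c * T) * (growth * mass n' \<omega>) ^ (k + 1)"
          using add_mono[OF 1 2] by (simp only: distrib_right mult_1_left)
        then show "ennreal (norm (drifted n' \<omega>) ^ (2 * k + 2) + c * h (X n' \<omega>) * (growth * mass n' \<omega>) ^ (k + 1))
            \<le> ennreal (1 + c * T) * ennreal (\<bar>growth * mass n' \<omega>\<bar> ^ (k + 1))"
          using c0 T_pos m0 by (subst ennreal_mult[symmetric]) (auto intro: ennreal_leI)
      qed
      also have "\<dots> = ennreal (1 + c * T) * (\<integral>\<^sup>+\<omega>. ennreal (\<bar>growth * mass n' \<omega>\<bar> ^ (k + 1)) \<partial>M)"
        by (intro nn_integral_cmult) measurable
      also have "\<dots> < \<infinity>"
        using all_momentsD[OF mass_moments[OF mom], of n' "k + 1"] by (simp add: ennreal_mult_less_top)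
      finally show "(\<integral>\<^sup>+\<omega>. ennreal (\<bar>norm (X n \<omega>)\<bar> ^ (2 * k + 2)) \<partial>M) < \<infinity>" .
    qed simp
  qed
qed

text \<open>The rate of the exponential discount. In the bracket, the first summand is the drift
  error from \<open>power_Suc_add_le\<close> and the second the Gaussian error;
  \<open>3 ^ (k + 1)\<close> is the price of splitting the power of \<open>mass\<close>.\<close>

definition "lyap_const k c = 3 ^ (k + 1) * (2 * real (k + 1) * L * (1 + 2 * T * L) ^ k + c * growth ^ (k + 1))"

lemma lyap_const_nonneg: "0 \<le> c \<Longrightarrow> 0 \<le> lyap_const k c"
  using T_pos L_nonneg growth_ge(1) by (simp add: lyap_const_def)

lemma mass_power_le: "mass n \<omega> ^ (k + 1) \<le> 3 ^ (k + 1) * (1 + norm (X n \<omega>) ^ (2 * k + 2) + norm (Y n \<omega>) ^ (2 * k + 2))"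
  using power_sum3_le[of "(norm (X n \<omega>))\<^sup>2" "(norm (Y n \<omega>))\<^sup>2" "k + 1"] by (simp only: power2_power_Suc zero_le_power2)

text \<open>The Gaussian error is already linear in the step size, and
  \<open>power_Suc_add_le\<close> makes the drift error linear too. Only for this reason can the
  growth factor be absorbed by an exponential in the grid time.\<close>

lemma step_bound:
  assumes c: "increment_bound TYPE('m) T k c"
    and wt: "wt \<in> borel_measurable (pre_sigma (t n))" "\<And>\<omega>. 0 \<le> wt \<omega>" "\<And>\<omega>. wt \<omega> \<le> 1"
  shows "(\<integral>\<^sup>+\<omega>. ennreal (wt \<omega> * norm (X (Suc n) \<omega>) ^ (2 * k + 2)) \<partial>M)
    \<le> (\<integral>\<^sup>+\<omega>. ennreal (wt \<omega> * ((1 + lyap_const k c * h (X n \<omega>)) * norm (X n \<omega>) ^ (2 * k + 2)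
         + lyap_const k c * h (X n \<omega>) * (1 + norm (Y n \<omega>) ^ (2 * k + 2)))) \<partial>M)"
proof (rule order_trans[OF step_of_moments[OF c X_moments wt]], intro nn_integral_mono ennreal_leI mult_left_mono wt(2))
  fix \<omega>
  let ?h = "h (X n \<omega>)" and ?m = "mass n \<omega>" and ?C = "lyap_const k c"
  have c0: "0 \<le> c" using c by (simp add: increment_bound_def)
  have h0: "0 \<le> ?h" using h_pos less_imp_le by auto
  have m0: "0 \<le> ?m" by simp
  have "norm (drifted n \<omega>) ^ (2 * k + 2) = ((norm (drifted n \<omega>))\<^sup>2) ^ (k + 1)"
    by (rule power2_power_Suc[symmetric])
  also have "\<dots> \<le> ((norm (X n \<omega>))\<^sup>2 + 2 * ?h * (L * ?m)) ^ (k + 1)"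
    by (intro power_mono norm_drifted_sq) simp
  also have "\<dots> \<le> ((norm (X n \<omega>))\<^sup>2) ^ (k + 1)
      + real (k + 1) * (2 * ?h * (L * ?m)) * ((norm (X n \<omega>))\<^sup>2 + 2 * ?h * (L * ?m)) ^ k"
    using h0 L_nonneg m0 by (intro power_Suc_add_le) auto
  \<comment> \<open>One factor has to retain the step size; in the remaining k factors it is
    replaced by \<open>T\<close>.\<close>
  also have "\<dots> \<le> ((norm (X n \<omega>))\<^sup>2) ^ (k + 1) + real (k + 1) * (2 * ?h * (L * ?m)) * ((1 + 2 * T * L) * ?m) ^ k"
  proof (intro add_left_mono mult_left_mono power_mono)
    have "2 * ?h * (L * ?m) \<le> 2 * T * (L * ?m)"
      using h_le L_nonneg m0 by (intro mult_right_mono) auto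
    moreover have "(norm (X n \<omega>))\<^sup>2 \<le> ?m" by simp
    moreover have "(1 + 2 * T * L) * ?m = ?m + 2 * T * (L * ?m)"
      by (simp only: distrib_right mult_1_left mult.assoc)
    ultimately show "(norm (X n \<omega>))\<^sup>2 + 2 * ?h * (L * ?m) \<le> (1 + 2 * T * L) * ?m"
      by linarith
  qed (use h0 L_nonneg in auto)
  finally have "norm (drifted n \<omega>) ^ (2 * k + 2) + c * ?h * (growth * ?m) ^ (k + 1)
      \<le> norm (X n \<omega>) ^ (2 * k + 2) + real (k + 1) * (2 * ?h * (L * ?m)) * ((1 + 2 * T * L) * ?m) ^ k
        + c * ?h * (growth * ?m) ^ (k + 1)"
    by (simp only: power2_power_Suc add_right_mono)
  also have "\<dots> = norm (X n \<omega>) ^ (2 * k + 2) + ?h * (2 * real (k + 1) * L * (1 + 2 * T * L) ^ k + c * growth ^ (k + 1)) * ?m ^ (k + 1)"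
    unfolding power_mult_distrib power_add power_one_right by (simp only: distrib_left distrib_right mult_ac add_ac)
  also have "\<dots> \<le> norm (X n \<omega>) ^ (2 * k + 2) + ?h * (2 * real (k + 1) * L * (1 + 2 * T * L) ^ k + c * growth ^ (k + 1))
      * (3 ^ (k + 1) * (1 + norm (X n \<omega>) ^ (2 * k + 2) + norm (Y n \<omega>) ^ (2 * k + 2)))"
    using h0 c0 T_pos L_nonneg growth_ge(1) by (intro add_left_mono mult_left_mono mass_power_le) simp
  also have "\<dots> = norm (X n \<omega>) ^ (2 * k + 2) + ?C * ?h * (1 + norm (X n \<omega>) ^ (2 * k + 2) + norm (Y n \<omega>) ^ (2 * k + 2))"
    by (simp only: lyap_const_def mult_ac)
  also have "\<dots> = (1 + ?C * ?h) * norm (X n \<omega>) ^ (2 * k + 2) + ?C * ?h * (1 + norm (Y n \<omega>) ^ (2 * k + 2))"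
    by (simp only: distrib_left distrib_right mult_1_left mult_1_right add_ac mult_ac)
  finally show "norm (drifted n \<omega>) ^ (2 * k + 2) + c * ?h * (growth * ?m) ^ (k + 1)
      \<le> (1 + ?C * ?h) * norm (X n \<omega>) ^ (2 * k + 2) + ?C * ?h * (1 + norm (Y n \<omega>) ^ (2 * k + 2))" .
qed

text \<open>\<open>alive\<close> is known at the n-th grid time and so may serve as a weight;
  \<open>hit\<close> is the event of the maximal inequality. A path that leaves the window without
  reaching \<open>l\<close> is neither, and simply drops out of the estimate.\<close>

definition "alive K l n \<omega> \<longleftrightarrow> t n \<omega> \<le> K \<and> (\<forall>i\<le>n. norm (X i \<omega>) < l)"
definition "hit K l n \<omega> \<longleftrightarrow> (\<exists>i\<le>n. t i \<omega> \<le> K \<and> l \<le> norm (X i \<omega>))"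

lemma alive_adapted: "Measurable.pred (pre_sigma (t n)) (alive K l n)"
proof -
  have "Measurable.pred (pre_sigma (t n)) (\<lambda>\<omega>. norm (X i \<omega>) < l)" if "i \<le> n" for i
    using X_adapted[OF that] by measurable
  moreover have "Measurable.pred (pre_sigma (t n)) (\<lambda>\<omega>. t n \<omega> \<le> K)"
    using t_adapted[OF order_refl] by measurable
  ultimately have "Measurable.pred (pre_sigma (t n)) (\<lambda>\<omega>. t n \<omega> \<le> K \<and> (\<forall>i\<in>{..n}. norm (X i \<omega>) < l))"
    by (intro pred_intros_logic pred_intros_finite) auto
  moreover have "alive K l n = (\<lambda>\<omega>. t n \<omega> \<le> K \<and> (\<forall>i\<in>{..n}. norm (X i \<omega>) < l))"
    by (auto simp: alive_def fun_eq_iff)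
  ultimately show ?thesis by simp
qed

lemma hit_measurable[measurable]: "Measurable.pred M (hit K l n)"
proof -
  have "Measurable.pred M (\<lambda>\<omega>. \<exists>i\<in>{..n}. t i \<omega> \<le> K \<and> l \<le> norm (X i \<omega>))" by measurable
  moreover have "hit K l n = (\<lambda>\<omega>. \<exists>i\<in>{..n}. t i \<omega> \<le> K \<and> l \<le> norm (X i \<omega>))"
    by (auto simp: hit_def fun_eq_iff)
  ultimately show ?thesis by simp
qed

text \<open>The steps begun by time \<open>K\<close> telescope, and the last one overshoots by at
  most \<open>T\<close>. The bound is independent of the number of steps.\<close>

lemma sum_steps_le:
  assumes "0 \<le> K"
  shows "(\<Sum>m<n. if t m \<omega> \<le> K then h (X m \<omega>) else 0) \<le> K + T"
proof -
  \<comment> \<open>The minimum is what the induction carries: up to \<open>K\<close> the sum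
    follows the grid time, afterwards it stays constant.\<close>
  have "(\<Sum>m<n. if t m \<omega> \<le> K then h (X m \<omega>) else 0) \<le> min (t n \<omega>) (K + T)"
  proof (induction n)
    case (Suc n)
    show ?case
    proof (cases "t n \<omega> \<le> K")
      case True
      then show ?thesis using Suc t_Suc_le[of n \<omega>] by (simp add: t_Suc)
    next
      case False
      then show ?thesis using Suc t_less[of n \<omega>] by simp
    qed
  qed (use assms T_pos in \<open>simp add: t_0\<close>)
  then show ?thesis by simp
qed

text \<open>Until the chain first exceeds the level \<open>l\<close>, its discounted power is a supermartingale up to
  the delay terms, which only involve the earlier window \<open>t \<le> K - \<tau>\<close>.\<close>

lemma hit_bound_sum:
  assumes c: "increment_bound TYPE('m) T k c" and K: "0 \<le> K" and l: "0 < l"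
  defines "C \<equiv> lyap_const k c"
  shows "(\<integral>\<^sup>+\<omega>. ennreal (of_bool (alive K l n \<omega>) * (exp (- C * t n \<omega>) * norm (X n \<omega>) ^ (2 * k + 2))
        + exp (- C * K) * l ^ (2 * k + 2) * of_bool (hit K l n \<omega>)) \<partial>M)
    \<le> (\<integral>\<^sup>+\<omega>. ennreal (\<bar>\<Xi> \<omega>\<bar> ^ (2 * k + 2)) \<partial>M)
      + (\<Sum>m<n. \<integral>\<^sup>+\<omega>. ennreal (of_bool (alive K l m \<omega>) * (C * h (X m \<omega>) * (1 + norm (Y m \<omega>) ^ (2 * k + 2)))) \<partial>M)"
proof (induction n)
  have C0: "0 \<le> C" unfolding C_def using c by (intro lyap_const_nonneg) (simp add: increment_bound_def)
  \<comment> \<open>A path at or above level \<open>l\<close> inside the window carries at least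
    this much discounted power, because its time is at most \<open>K\<close>.\<close>
  have first: "exp (- C * K) * l ^ (2 * k + 2) \<le> exp (- C * t n \<omega>) * norm (X n \<omega>) ^ (2 * k + 2)"
    if "t n \<omega> \<le> K" "l \<le> norm (X n \<omega>)" for n \<omega>
    using that l C0 by (intro mult_mono power_mono) (auto simp: mult_left_mono)
  note [measurable] = h_measurable
  {
    case 0
    have "of_bool (alive K l 0 \<omega>) * (exp (- C * t 0 \<omega>) * norm (X 0 \<omega>) ^ (2 * k + 2))
        + exp (- C * K) * l ^ (2 * k + 2) * of_bool (hit K l 0 \<omega>) \<le> \<bar>\<Xi> \<omega>\<bar> ^ (2 * k + 2)"
      if \<omega>: "\<omega> \<in> space M" for \<omega>
    proof -
      have "norm (X 0 \<omega>) ^ (2 * k + 2) \<le> \<bar>\<Xi> \<omega>\<bar> ^ (2 * k + 2)"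
        using \<Xi>_bound[OF \<omega>, of 0] tau_pos by (intro power_mono) (auto simp: X_0)
      moreover have "exp (- C * t 0 \<omega>) * norm (X 0 \<omega>) ^ (2 * k + 2) = norm (X 0 \<omega>) ^ (2 * k + 2)"
        by (simp add: t_0)
      moreover have "0 \<le> \<bar>\<Xi> \<omega>\<bar> ^ (2 * k + 2)" by simp
      ultimately show ?thesis
        using first[of 0 \<omega>] K by (cases "l \<le> norm (X 0 \<omega>)") (auto simp: alive_def hit_def t_0)
    qed
    then show ?case by (auto intro!: nn_integral_mono ennreal_leI)
  next
    case (Suc n)
    let ?V = "\<lambda>n \<omega>. exp (- C * t n \<omega>) * norm (X n \<omega>) ^ (2 * k + 2)"
    let ?p = "exp (- C * K) * l ^ (2 * k + 2)"
    let ?D = "\<lambda>\<omega>. C * h (X n \<omega>) * (1 + norm (Y n \<omega>) ^ (2 * k + 2))"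
    have am[measurable]: "Measurable.pred M (alive K l n)" for n
      using measurable_from_subalg[OF subalgebra_pre_sigma[OF stopping_time_t] alive_adapted] .
    \<comment> \<open>A path alive at \<open>n\<close> stays alive, or hits, in which case its new
      power pays for the indicator by \<open>first\<close>, or leaves the window, in which case a
      nonnegative term is dropped. Earlier hits are merely carried along.\<close>
    have pw: "of_bool (alive K l (Suc n) \<omega>) * ?V (Suc n) \<omega> + ?p * of_bool (hit K l (Suc n) \<omega>)
        \<le> of_bool (alive K l n \<omega>) * ?V (Suc n) \<omega> + ?p * of_bool (hit K l n \<omega>)" for \<omega>
    proof -
      have p0: "0 \<le> ?p" and V0: "0 \<le> ?V (Suc n) \<omega>" using l by auto
      have t: "t i \<omega> \<le> t (Suc n) \<omega>" if "i \<le> n" for i using that by (intro t_mono) simp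
      consider (a) "alive K l (Suc n) \<omega>" | (b) "\<not> alive K l (Suc n) \<omega>" "hit K l n \<omega>"
        | (c) "\<not> alive K l (Suc n) \<omega>" "\<not> hit K l n \<omega>" "hit K l (Suc n) \<omega>"
        | (d) "\<not> hit K l (Suc n) \<omega>" "\<not> alive K l (Suc n) \<omega>" by auto
      then show ?thesis
      proof cases
        case a
        then have "alive K l n \<omega>" "\<not> hit K l (Suc n) \<omega>"
          using t[OF order_refl] by (auto simp: alive_def hit_def not_le le_Suc_eq)
        then show ?thesis using a p0 by simp
      next
        case b
        then show ?thesis using p0 V0 by simp
      next
        case c
        then have Sn: "t (Suc n) \<omega> \<le> K" "l \<le> norm (X (Suc n) \<omega>)" by (auto simp: hit_def le_Suc_eq)
        have "norm (X i \<omega>) < l" if "i \<le> n" for i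
          using c(2) that t[OF that] Sn(1) unfolding hit_def by (meson not_le order_trans)
        then have "alive K l n \<omega>" using t[OF order_refl] Sn by (auto simp: alive_def)
        then show ?thesis using c first[OF Sn] by simp
      next
        case d
        then show ?thesis using p0 V0 by simp
      qed
    qed
    have V0: "0 \<le> ?V n \<omega>" "0 \<le> ?D \<omega>" "0 \<le> ?p" for n \<omega>
      using C0 h_pos[THEN less_imp_le] l
      by (intro mult_nonneg_nonneg add_nonneg_nonneg zero_le_power; simp)+
    have add: "(\<integral>\<^sup>+\<omega>. ennreal (of_bool (alive K l n \<omega>) * u \<omega> + ?p * of_bool (hit K l n \<omega>)) \<partial>M) =
        (\<integral>\<^sup>+\<omega>. ennreal (of_bool (alive K l n \<omega>) * u \<omega>) \<partial>M) + (\<integral>\<^sup>+\<omega>. ennreal (?p * of_bool (hit K l n \<omega>)) \<partial>M)"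
      if [measurable]: "u \<in> borel_measurable M" and "\<And>\<omega>. 0 \<le> u \<omega>" for u
      using that V0 by (subst nn_integral_add[symmetric]) (auto simp: ennreal_plus[symmetric] simp del: ennreal_plus)
    have "(\<integral>\<^sup>+\<omega>. ennreal (of_bool (alive K l (Suc n) \<omega>) * ?V (Suc n) \<omega> + ?p * of_bool (hit K l (Suc n) \<omega>)) \<partial>M)
        \<le> (\<integral>\<^sup>+\<omega>. ennreal (of_bool (alive K l n \<omega>) * ?V (Suc n) \<omega> + ?p * of_bool (hit K l n \<omega>)) \<partial>M)"
      using pw by (intro nn_integral_mono ennreal_leI)
    also have "\<dots> = (\<integral>\<^sup>+\<omega>. ennreal (of_bool (alive K l n \<omega>) * ?V (Suc n) \<omega>) \<partial>M)
        + (\<integral>\<^sup>+\<omega>. ennreal (?p * of_bool (hit K l n \<omega>)) \<partial>M)"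
      by (rule add) (use V0 in \<open>auto\<close>)
    also have "(\<integral>\<^sup>+\<omega>. ennreal (of_bool (alive K l n \<omega>) * ?V (Suc n) \<omega>) \<partial>M)
        \<le> (\<integral>\<^sup>+\<omega>. ennreal (of_bool (alive K l n \<omega>) * (?V n \<omega> + ?D \<omega>)) \<partial>M)"
    proof -
      \<comment> \<open>The discount at the next grid time is already known now, so it can go into
        the weight together with the indicator.\<close>
      let ?w = "\<lambda>\<omega>. of_bool (alive K l n \<omega>) * exp (- C * t (Suc n) \<omega>)"
      have w1: "exp (- C * t (Suc n) \<omega>) \<le> 1" for \<omega> using C0 t_nonneg by simp
      note [measurable] = alive_adapted t_Suc_adapted
      have wm: "?w \<in> borel_measurable (pre_sigma (t n))" by measurable
      have "(\<integral>\<^sup>+\<omega>. ennreal (of_bool (alive K l n \<omega>) * ?V (Suc n) \<omega>) \<partial>M)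
          = (\<integral>\<^sup>+\<omega>. ennreal (?w \<omega> * norm (X (Suc n) \<omega>) ^ (2 * k + 2)) \<partial>M)"
        by (simp add: mult.assoc)
      also have "\<dots> \<le> (\<integral>\<^sup>+\<omega>. ennreal (?w \<omega> * ((1 + C * h (X n \<omega>)) * norm (X n \<omega>) ^ (2 * k + 2) + ?D \<omega>)) \<partial>M)"
        unfolding C_def by (rule step_bound[OF c wm[unfolded C_def]]) (use w1[unfolded C_def] in \<open>auto simp: of_bool_def\<close>)
      also have "\<dots> \<le> (\<integral>\<^sup>+\<omega>. ennreal (of_bool (alive K l n \<omega>) * (?V n \<omega> + ?D \<omega>)) \<partial>M)"
      proof (intro nn_integral_mono ennreal_leI)
        fix \<omega>
        \<comment> \<open>The inequality 1 + x \<le> exp x turns one step of growth into exactly the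
          discount gained between the two grid times.\<close>
        have "exp (- C * t (Suc n) \<omega>) * (1 + C * h (X n \<omega>)) \<le> exp (- C * t (Suc n) \<omega>) * exp (C * h (X n \<omega>))"
          by (intro mult_left_mono) simp_all
        also have "\<dots> = exp (- C * t n \<omega>)"
          by (simp add: exp_add[symmetric] t_Suc algebra_simps)
        finally have "exp (- C * t (Suc n) \<omega>) * (1 + C * h (X n \<omega>)) * norm (X n \<omega>) ^ (2 * k + 2) \<le> ?V n \<omega>"
          by (intro mult_right_mono) auto
        moreover have "exp (- C * t (Suc n) \<omega>) * ?D \<omega> \<le> ?D \<omega>"
          using w1 V0(2) by (intro mult_left_le_one_le) auto
        moreover have "exp (- C * t (Suc n) \<omega>) * ((1 + C * h (X n \<omega>)) * norm (X n \<omega>) ^ (2 * k + 2) + ?D \<omega>)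
            = exp (- C * t (Suc n) \<omega>) * (1 + C * h (X n \<omega>)) * norm (X n \<omega>) ^ (2 * k + 2) + exp (- C * t (Suc n) \<omega>) * ?D \<omega>"
          by (subst distrib_left) (simp only: mult.assoc)
        ultimately have "exp (- C * t (Suc n) \<omega>) * ((1 + C * h (X n \<omega>)) * norm (X n \<omega>) ^ (2 * k + 2) + ?D \<omega>) \<le> ?V n \<omega> + ?D \<omega>"
          by linarith
        then show "?w \<omega> * ((1 + C * h (X n \<omega>)) * norm (X n \<omega>) ^ (2 * k + 2) + ?D \<omega>)
            \<le> of_bool (alive K l n \<omega>) * (?V n \<omega> + ?D \<omega>)"
          by (cases "alive K l n \<omega>") auto
      qed
      finally show ?thesis .
    qed
    also have "(\<integral>\<^sup>+\<omega>. ennreal (of_bool (alive K l n \<omega>) * (?V n \<omega> + ?D \<omega>)) \<partial>M) =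
        (\<integral>\<^sup>+\<omega>. ennreal (of_bool (alive K l n \<omega>) * ?V n \<omega>) \<partial>M) + (\<integral>\<^sup>+\<omega>. ennreal (of_bool (alive K l n \<omega>) * ?D \<omega>) \<partial>M)"
      using V0 by (subst nn_integral_add[symmetric])
        (auto simp: ennreal_plus[symmetric] distrib_left simp del: ennreal_plus)
    also have "(\<integral>\<^sup>+\<omega>. ennreal (of_bool (alive K l n \<omega>) * ?V n \<omega>) \<partial>M) + (\<integral>\<^sup>+\<omega>. ennreal (of_bool (alive K l n \<omega>) * ?D \<omega>) \<partial>M)
        + (\<integral>\<^sup>+\<omega>. ennreal (?p * of_bool (hit K l n \<omega>)) \<partial>M) =
        (\<integral>\<^sup>+\<omega>. ennreal (of_bool (alive K l n \<omega>) * ?V n \<omega> + ?p * of_bool (hit K l n \<omega>)) \<partial>M)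
        + (\<integral>\<^sup>+\<omega>. ennreal (of_bool (alive K l n \<omega>) * ?D \<omega>) \<partial>M)"
      by (subst add) (use V0 in \<open>auto simp: ac_simps\<close>)
    also have "\<dots> \<le> (\<integral>\<^sup>+\<omega>. ennreal (\<bar>\<Xi> \<omega>\<bar> ^ (2 * k + 2)) \<partial>M)
      + (\<Sum>m<n. \<integral>\<^sup>+\<omega>. ennreal (of_bool (alive K l m \<omega>) * (C * h (X m \<omega>) * (1 + norm (Y m \<omega>) ^ (2 * k + 2)))) \<partial>M)
      + (\<integral>\<^sup>+\<omega>. ennreal (of_bool (alive K l n \<omega>) * ?D \<omega>) \<partial>M)"
      by (intro add_right_mono Suc)
    finally show ?case by (simp add: ac_simps)
  }
qed

end

section \<open>Moments of the running maximum\<close>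

context em_scheme
begin

text \<open>Removes \<open>n\<close> from the bound: alive paths are still inside the window, so one
  \<open>B\<close> dominates all delayed values, and the step sizes left as weights are summed by
  \<open>sum_steps_le\<close>.\<close>

lemma hit_bound:
  assumes c: "increment_bound TYPE('m) T k c" and K: "0 \<le> K" and l: "0 < l"
    and B[measurable]: "B \<in> borel_measurable M" and B_nonneg: "\<And>\<omega>. 0 \<le> B \<omega>"
    and YB: "\<And>m \<omega>. m < n \<Longrightarrow> \<omega> \<in> space M \<Longrightarrow> t m \<omega> \<le> K \<Longrightarrow> norm (Y m \<omega>) \<le> B \<omega>"
  defines "C \<equiv> lyap_const k c"
  shows "ennreal (exp (- C * K) * l ^ (2 * k + 2)) * emeasure M {\<omega> \<in> space M. hit K l n \<omega>}
    \<le> (\<integral>\<^sup>+\<omega>. ennreal (\<bar>\<Xi> \<omega>\<bar> ^ (2 * k + 2)) \<partial>M)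
      + ennreal (C * (K + T)) * (\<integral>\<^sup>+\<omega>. ennreal (1 + B \<omega> ^ (2 * k + 2)) \<partial>M)"
proof -
  have C0: "0 \<le> C" unfolding C_def using c by (intro lyap_const_nonneg) (simp add: increment_bound_def)
  have h0: "0 \<le> h x" for x using h_pos[of x] by simp
  note [measurable] = h_measurable
  have am[measurable]: "Measurable.pred M (alive K l n)" for n
    using measurable_from_subalg[OF subalgebra_pre_sigma[OF stopping_time_t] alive_adapted] .
  have "ennreal (exp (- C * K) * l ^ (2 * k + 2)) * emeasure M {\<omega> \<in> space M. hit K l n \<omega>}
      = (\<integral>\<^sup>+\<omega>. ennreal (exp (- C * K) * l ^ (2 * k + 2)) * indicator {\<omega> \<in> space M. hit K l n \<omega>} \<omega> \<partial>M)"
    by (rule nn_integral_cmult_indicator[symmetric]) measurable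
  also have "\<dots> \<le> (\<integral>\<^sup>+\<omega>. ennreal (of_bool (alive K l n \<omega>) * (exp (- C * t n \<omega>) * norm (X n \<omega>) ^ (2 * k + 2))
        + exp (- C * K) * l ^ (2 * k + 2) * of_bool (hit K l n \<omega>)) \<partial>M)"
    by (intro nn_integral_mono) (auto simp: indicator_def intro!: ennreal_leI)
  also have "\<dots> \<le> (\<integral>\<^sup>+\<omega>. ennreal (\<bar>\<Xi> \<omega>\<bar> ^ (2 * k + 2)) \<partial>M)
      + (\<Sum>m<n. \<integral>\<^sup>+\<omega>. ennreal (of_bool (alive K l m \<omega>) * (C * h (X m \<omega>) * (1 + norm (Y m \<omega>) ^ (2 * k + 2)))) \<partial>M)"
    unfolding C_def by (rule hit_bound_sum[OF c K l])
  also have "(\<Sum>m<n. \<integral>\<^sup>+\<omega>. ennreal (of_bool (alive K l m \<omega>) * (C * h (X m \<omega>) * (1 + norm (Y m \<omega>) ^ (2 * k + 2)))) \<partial>M)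
      = (\<integral>\<^sup>+\<omega>. (\<Sum>m<n. ennreal (of_bool (alive K l m \<omega>) * (C * h (X m \<omega>) * (1 + norm (Y m \<omega>) ^ (2 * k + 2))))) \<partial>M)"
    by (rule nn_integral_sum[symmetric]) measurable
  also have "\<dots> \<le> (\<integral>\<^sup>+\<omega>. ennreal (C * (K + T)) * ennreal (1 + B \<omega> ^ (2 * k + 2)) \<partial>M)"
  proof (intro nn_integral_mono)
    fix \<omega> assume \<omega>: "\<omega> \<in> space M"
    have p0: "0 \<le> 1 + B \<omega> ^ (2 * k + 2)" using B_nonneg[of \<omega>] by simp
    have "(\<Sum>m<n. ennreal (of_bool (alive K l m \<omega>) * (C * h (X m \<omega>) * (1 + norm (Y m \<omega>) ^ (2 * k + 2)))))
        \<le> (\<Sum>m<n. ennreal (C * (1 + B \<omega> ^ (2 * k + 2)) * (if t m \<omega> \<le> K then h (X m \<omega>) else 0)))"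
    proof (intro sum_mono ennreal_leI)
      fix m assume m: "m \<in> {..<n}"
      show "of_bool (alive K l m \<omega>) * (C * h (X m \<omega>) * (1 + norm (Y m \<omega>) ^ (2 * k + 2)))
          \<le> C * (1 + B \<omega> ^ (2 * k + 2)) * (if t m \<omega> \<le> K then h (X m \<omega>) else 0)"
      proof (cases "alive K l m \<omega>")
        case True
        then have tK: "t m \<omega> \<le> K" by (simp add: alive_def)
        have "norm (Y m \<omega>) ^ (2 * k + 2) \<le> B \<omega> ^ (2 * k + 2)"
          using YB[OF _ \<omega> tK] m by (intro power_mono) auto
        then have "C * h (X m \<omega>) * (1 + norm (Y m \<omega>) ^ (2 * k + 2)) \<le> C * h (X m \<omega>) * (1 + B \<omega> ^ (2 * k + 2))"
          using C0 h0 by (intro mult_left_mono) auto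
        then show ?thesis using True tK by (simp only: mult_ac if_True of_bool_eq mult_1_left)
      next
        case False
        then show ?thesis using C0 h0 p0 by simp
      qed
    qed
    also have "\<dots> = ennreal (C * (1 + B \<omega> ^ (2 * k + 2)) * (\<Sum>m<n. if t m \<omega> \<le> K then h (X m \<omega>) else 0))"
      using C0 h0 p0 by (subst sum_ennreal) (auto simp: sum_distrib_left)
    also have "\<dots> \<le> ennreal (C * (1 + B \<omega> ^ (2 * k + 2)) * (K + T))"
      using C0 p0 by (intro ennreal_leI mult_left_mono sum_steps_le K) auto
    also have "\<dots> = ennreal (C * (K + T)) * ennreal (1 + B \<omega> ^ (2 * k + 2))"
      using C0 p0 K T_pos by (subst ennreal_mult[symmetric]) (auto simp: mult_ac)
    finally show "(\<Sum>m<n. ennreal (of_bool (alive K l m \<omega>) * (C * h (X m \<omega>) * (1 + norm (Y m \<omega>) ^ (2 * k + 2)))))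
        \<le> ennreal (C * (K + T)) * ennreal (1 + B \<omega> ^ (2 * k + 2))" .
  qed
  also have "\<dots> = ennreal (C * (K + T)) * (\<integral>\<^sup>+\<omega>. ennreal (1 + B \<omega> ^ (2 * k + 2)) \<partial>M)"
    by (rule nn_integral_cmult) measurable
  finally show ?thesis by (simp add: add_left_mono)
qed

text \<open>Grid values past \<open>K\<close> count as 0. The cap \<open>n\<close> makes this a
  finite maximum; all bounds are uniform in \<open>n\<close>, and monotone convergence removes the
  cap.\<close>

definition "running_max K n \<omega> = Max ((\<lambda>i. if t i \<omega> \<le> K then norm (X i \<omega>) else 0) ` {..n})"

lemma running_max_measurable[measurable]: "running_max K n \<in> borel_measurable M"
  unfolding running_max_def[abs_def] by (intro borel_measurable_Max) (auto intro: measurable_If)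

lemma norm_le_running_max: "i \<le> n \<Longrightarrow> t i \<omega> \<le> K \<Longrightarrow> norm (X i \<omega>) \<le> running_max K n \<omega>"
  unfolding running_max_def by (rule Max_ge) force+

lemma running_max_nonneg: "0 \<le> running_max K n \<omega>"
proof -
  have "0 \<le> (if t 0 \<omega> \<le> K then norm (X 0 \<omega>) else 0)" by simp
  also have "\<dots> \<le> running_max K n \<omega>" unfolding running_max_def by (rule Max_ge) force+
  finally show ?thesis .
qed

lemma running_max_mono: "m \<le> n \<Longrightarrow> running_max K m \<omega> \<le> running_max K n \<omega>"
  unfolding running_max_def by (intro Max_mono image_mono) auto

lemma le_running_max_iff: "0 < l \<Longrightarrow> l \<le> running_max K n \<omega> \<longleftrightarrow> hit K l n \<omega>"
  unfolding running_max_def hit_def by (subst Max_ge_iff) (auto split: if_splits)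

text \<open>Base of the induction over windows: the steps are positive, so only the initial value
  has time at most 0.\<close>

lemma running_max_0_le:
  assumes "\<omega> \<in> space M"
  shows "running_max 0 n \<omega> \<le> \<bar>\<Xi> \<omega>\<bar>"
proof -
  have *: "(if t i \<omega> \<le> 0 then norm (X i \<omega>) else 0) \<le> \<bar>\<Xi> \<omega>\<bar>" for i
  proof (cases i)
    case 0
    then show ?thesis using \<Xi>_bound[OF assms, of 0] tau_pos by (simp add: t_0 X_0)
  next
    case (Suc j)
    then show ?thesis using t_less[of j \<omega>] t_nonneg[of j \<omega>] by simp
  qed
  show ?thesis unfolding running_max_def
  proof (rule Max.boundedI)
    fix a assume "a \<in> (\<lambda>i. if t i \<omega> \<le> 0 then norm (X i \<omega>) else 0) ` {..n}"
    then show "a \<le> \<bar>\<Xi> \<omega>\<bar>" using * by (elim imageE) (simp only:)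
  qed auto
qed

lemma norm_Y_le_running_max:
  assumes "\<omega> \<in> space M" "m \<le> n" "t m \<omega> \<le> K + \<tau>"
  shows "norm (Y m \<omega>) \<le> \<bar>\<Xi> \<omega>\<bar> + running_max K n \<omega>"
proof -
  consider "norm (Y m \<omega>) \<le> \<Xi> \<omega>" | i where "i < m" "t i \<omega> \<le> K" "Y m \<omega> = X i \<omega>"
    using norm_Y_le[OF assms(1,3)] by auto
  then show ?thesis
  proof cases
    case 1
    then show ?thesis using running_max_nonneg[of K n \<omega>] by simp
  next
    case 2
    then show ?thesis using norm_le_running_max[of i n \<omega> K] assms(2) by simp
  qed
qed

text \<open>\<open>hit_bound\<close> solved for the tail and inserted in
  \<open>moment_from_tail\<close>: the exponential undoes the discount, and the bracket is the
  right-hand side of \<open>hit_bound\<close> with the previous running maximum plus \<Xi> as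
  \<open>B\<close>. Here \<open>x\<close> and \<open>b\<close> bound their moments of order 2k+2.
  Neither \<open>n\<close> nor the step function occurs.\<close>

definition "next_moment K k c x b =
  1 + 2 ^ (2 * k + 1) * (exp (lyap_const k c * (K + \<tau>)) * (x + lyap_const k c * (K + \<tau> + T) * (1 + 2 ^ (2 * k + 2) * (x + b))))"

text \<open>One window further at the cost of two powers: moments of order 2k+2 up to
  \<open>K\<close> bound those of order 2k up to \<open>K + \<tau>\<close>.\<close>

lemma running_max_moment_step:
  assumes c: "increment_bound TYPE('m) T k c" and K: "0 \<le> K" and x0: "0 \<le> x" and b0: "0 \<le> b"
    and x: "(\<integral>\<^sup>+\<omega>. ennreal (\<bar>\<Xi> \<omega>\<bar> ^ (2 * k + 2)) \<partial>M) \<le> ennreal x"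
    and b: "(\<integral>\<^sup>+\<omega>. ennreal (running_max K n \<omega> ^ (2 * k + 2)) \<partial>M) \<le> ennreal b"
  shows "(\<integral>\<^sup>+\<omega>. ennreal (running_max (K + \<tau>) n \<omega> ^ (2 * k)) \<partial>M) \<le> ennreal (next_moment K k c x b)"
proof -
  let ?C = "lyap_const k c" and ?B = "\<lambda>\<omega>. \<bar>\<Xi> \<omega>\<bar> + running_max K n \<omega>"
  let ?q = "2 * k + 2"
  have C0: "0 \<le> ?C" using c by (intro lyap_const_nonneg) (simp add: increment_bound_def)
  have K': "0 \<le> K + \<tau>" using K tau_pos by simp
  have [measurable]: "\<Xi> \<in> borel_measurable M" using all_moments_measurable[OF \<Xi>_moments] .
  define D where "D = x + ?C * (K + \<tau> + T) * (1 + 2 ^ ?q * (x + b))"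
  have D0: "0 \<le> D" using C0 K' T_pos x0 b0 by (simp add: D_def)
  have B: "(\<integral>\<^sup>+\<omega>. ennreal (1 + ?B \<omega> ^ ?q) \<partial>M) \<le> ennreal (1 + 2 ^ ?q * (x + b))"
  proof -
    have "(\<integral>\<^sup>+\<omega>. ennreal (1 + ?B \<omega> ^ ?q) \<partial>M)
        \<le> (\<integral>\<^sup>+\<omega>. 1 + ennreal (2 ^ ?q) * (ennreal (\<bar>\<Xi> \<omega>\<bar> ^ ?q) + ennreal (running_max K n \<omega> ^ ?q)) \<partial>M)"
    proof (intro nn_integral_mono)
      fix \<omega>
      note r0 = running_max_nonneg[of K n \<omega>]
      have "1 + ?B \<omega> ^ ?q \<le> 1 + 2 ^ ?q * (\<bar>\<Xi> \<omega>\<bar> ^ ?q + running_max K n \<omega> ^ ?q)"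
        using r0 by (intro add_left_mono add_power_le) auto
      then have "ennreal (1 + ?B \<omega> ^ ?q) \<le> ennreal (1 + 2 ^ ?q * (\<bar>\<Xi> \<omega>\<bar> ^ ?q + running_max K n \<omega> ^ ?q))"
        by (rule ennreal_leI)
      also have "\<dots> = 1 + ennreal (2 ^ ?q) * (ennreal (\<bar>\<Xi> \<omega>\<bar> ^ ?q) + ennreal (running_max K n \<omega> ^ ?q))"
        using r0 by (simp add: ennreal_plus ennreal_mult del: power_Suc power_add_numeral)
      finally show "ennreal (1 + ?B \<omega> ^ ?q) \<le> 1 + ennreal (2 ^ ?q) * (ennreal (\<bar>\<Xi> \<omega>\<bar> ^ ?q) + ennreal (running_max K n \<omega> ^ ?q))" .
    qed
    also have "\<dots> = 1 + ennreal (2 ^ ?q) * ((\<integral>\<^sup>+\<omega>. ennreal (\<bar>\<Xi> \<omega>\<bar> ^ ?q) \<partial>M) + (\<integral>\<^sup>+\<omega>. ennreal (running_max K n \<omega> ^ ?q) \<partial>M))"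
      by (simp add: nn_integral_add nn_integral_cmult emeasure_space_1)
    also have "\<dots> \<le> 1 + ennreal (2 ^ ?q) * (ennreal x + ennreal b)"
      by (intro add_left_mono mult_left_mono add_mono x b) simp
    also have "\<dots> = ennreal (1 + 2 ^ ?q * (x + b))"
      using x0 b0 by (simp add: ennreal_plus ennreal_mult)
    finally show ?thesis .
  qed
  have "(\<integral>\<^sup>+\<omega>. ennreal (running_max (K + \<tau>) n \<omega> ^ (2 * k)) \<partial>M) \<le> ennreal (1 + 2 ^ (2 * k + 1) * (exp (?C * (K + \<tau>)) * D))"
  proof (rule moment_from_tail)
    fix l :: real assume l: "1 \<le> l"
    then have l0: "0 < l" by simp
    have "ennreal (exp (- ?C * (K + \<tau>)) * l ^ ?q) * emeasure M {\<omega> \<in> space M. hit (K + \<tau>) l n \<omega>}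
      \<le> (\<integral>\<^sup>+\<omega>. ennreal (\<bar>\<Xi> \<omega>\<bar> ^ ?q) \<partial>M)
      + ennreal (?C * (K + \<tau> + T)) * (\<integral>\<^sup>+\<omega>. ennreal (1 + ?B \<omega> ^ ?q) \<partial>M)"
    proof (rule hit_bound[OF c K' l0])
      show "0 \<le> ?B \<omega>" for \<omega> using running_max_nonneg[of K n \<omega>] by simp
      show "norm (Y m \<omega>) \<le> ?B \<omega>" if "m < n" "\<omega> \<in> space M" "t m \<omega> \<le> K + \<tau>" for m \<omega>
        using norm_Y_le_running_max[of \<omega> m n K] that by simp
    qed simp
    also have "\<dots> \<le> ennreal x + ennreal (?C * (K + \<tau> + T)) * ennreal (1 + 2 ^ ?q * (x + b))"
      by (intro add_mono mult_left_mono x B) simp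
    also have "\<dots> = ennreal D"
      unfolding D_def using C0 K' T_pos x0 b0 by (simp add: ennreal_plus ennreal_mult)
    finally have tail: "ennreal (exp (- ?C * (K + \<tau>)) * l ^ ?q) * emeasure M {\<omega> \<in> space M. hit (K + \<tau>) l n \<omega>} \<le> ennreal D" .
    have "ennreal (l ^ ?q) * emeasure M {\<omega> \<in> space M. l \<le> running_max (K + \<tau>) n \<omega>}
      = ennreal (exp (?C * (K + \<tau>))) * (ennreal (exp (- ?C * (K + \<tau>)) * l ^ ?q) * emeasure M {\<omega> \<in> space M. hit (K + \<tau>) l n \<omega>})"
    proof -
      have "exp (?C * (K + \<tau>)) * exp (- ?C * (K + \<tau>)) = 1"
        by (simp add: exp_minus_inverse)
      then have "l ^ ?q = exp (?C * (K + \<tau>)) * (exp (- ?C * (K + \<tau>)) * l ^ ?q)"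
        by (simp only: mult.assoc[symmetric] mult_1_left)
      then have "ennreal (l ^ ?q) = ennreal (exp (?C * (K + \<tau>)) * (exp (- ?C * (K + \<tau>)) * l ^ ?q))"
        by (rule arg_cong)
      also have "\<dots> = ennreal (exp (?C * (K + \<tau>))) * ennreal (exp (- ?C * (K + \<tau>)) * l ^ ?q)"
        using l0 by (intro ennreal_mult) auto
      finally have "ennreal (l ^ ?q) = ennreal (exp (?C * (K + \<tau>))) * ennreal (exp (- ?C * (K + \<tau>)) * l ^ ?q)" .
      then show ?thesis by (simp only: le_running_max_iff[OF l0] mult.assoc)
    qed
    also have "\<dots> \<le> ennreal (exp (?C * (K + \<tau>))) * ennreal D"
      by (intro mult_left_mono tail) simp
    also have "\<dots> = ennreal (exp (?C * (K + \<tau>)) * D)" using D0 by (simp add: ennreal_mult)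
    finally show "ennreal (l ^ (2 * k + 2)) * emeasure M {\<omega> \<in> space M. l \<le> running_max (K + \<tau>) n \<omega>} \<le> ennreal (exp (?C * (K + \<tau>)) * D)" .
  qed (use running_max_nonneg D0 in auto)
  then show ?thesis by (simp only: next_moment_def D_def)
qed

end

lemma uniform_grid_limit:
  fixes T s :: real
  assumes T: "0 < T" and s: "s \<in> {0..T}"
  shows "\<exists>r. r \<longlonglongrightarrow> s \<and> (\<forall>i. \<exists>j\<le>Suc i. r i = real j * (T / real (Suc i)))"
proof -
  let ?r = "\<lambda>i. T * (\<lfloor>real (Suc i) * (s / T)\<rfloor> / real (Suc i))"
  have lim: "?r \<longlonglongrightarrow> s"
    using tendsto_mult[OF tendsto_const floor_grid_tendsto, of T "s / T"] T by simp
  have grid: "\<exists>j\<le>Suc i. ?r i = real j * (T / real (Suc i))" for i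
  proof -
  have s01: "0 \<le> s / T" "s / T \<le> 1" using s T by (auto simp: field_simps)
  have "0 \<le> real (Suc i) * (s / T)" "real (Suc i) * (s / T) \<le> real (Suc i) * 1"
    by (rule mult_nonneg_nonneg[OF of_nat_0_le_iff s01(1)])
       (rule mult_left_mono[OF s01(2) of_nat_0_le_iff])
  from this[THEN floor_mono]
  have "0 \<le> \<lfloor>real (Suc i) * (s / T)\<rfloor>" "\<lfloor>real (Suc i) * (s / T)\<rfloor> \<le> int (Suc i)"
    by (simp_all only: mult_1_right floor_of_nat floor_zero)
  then obtain j where j: "\<lfloor>real (Suc i) * (s / T)\<rfloor> = int j" "j \<le> Suc i"
    by (metis nonneg_int_cases of_nat_le_iff)
  show ?thesis
    unfolding j(1) by (rule exI[of _ j]) (simp add: j(2))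
  qed
  show ?thesis by (intro exI[of _ ?r] conjI allI lim grid)
qed

section \<open>Induction over delay windows, and the running supremum of the Brownian motion\<close>

context brownian
begin

text \<open>Stated outside the scheme locale, for a whole family of step functions, so that the
  constant is chosen before the member of the family.\<close>

lemma grid_moments:
  fixes hh :: "'i \<Rightarrow> real ^ 'm \<Rightarrow> real"
  assumes scheme: "\<And>i. i \<in> I \<Longrightarrow> em_scheme M F W f g (hh i) \<xi> \<Xi> \<tau> T L" and \<Xi>: "all_moments \<Xi>"
  shows "\<exists>C\<ge>0. \<forall>i\<in>I. \<forall>n. (\<integral>\<^sup>+\<omega>. ennreal (em_scheme.running_max W f g (hh i) \<xi> \<tau> (real j * \<tau>) n \<omega> ^ (2 * k)) \<partial>M) \<le> ennreal C"
\<comment> \<open>The power has to vary, as window \<open>Suc j\<close> at \<open>k\<close> relies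
  on window \<open>j\<close> at \<open>k + 1\<close>.\<close>
proof (induction j arbitrary: k)
  case 0
  obtain C where C: "(\<integral>\<^sup>+\<omega>. ennreal (\<bar>\<Xi> \<omega>\<bar> ^ (2 * k)) \<partial>M) = ennreal C" "0 \<le> C"
    using all_momentsD[OF \<Xi>, of "2 * k"] by (metis ennreal_cases infinity_ennreal_def less_irrefl)
  show ?case
  proof (intro exI[of _ C] conjI ballI allI C(2))
    fix i n assume "i \<in> I"
    then interpret em_scheme M F W f g "hh i" \<xi> \<Xi> \<tau> T L by (rule scheme)
    have "(\<integral>\<^sup>+\<omega>. ennreal (running_max (real 0 * \<tau>) n \<omega> ^ (2 * k)) \<partial>M) \<le> (\<integral>\<^sup>+\<omega>. ennreal (\<bar>\<Xi> \<omega>\<bar> ^ (2 * k)) \<partial>M)"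
      using running_max_0_le running_max_nonneg by (intro nn_integral_mono ennreal_leI power_mono) auto
    then show "(\<integral>\<^sup>+\<omega>. ennreal (running_max (real 0 * \<tau>) n \<omega> ^ (2 * k)) \<partial>M) \<le> ennreal C" using C by simp
  qed
next
  case (Suc j)
  obtain c where c: "increment_bound TYPE('m) T k c" using increment_bound_exists by blast
  then have c0: "0 \<le> c" by (simp add: increment_bound_def)
  obtain x where x: "(\<integral>\<^sup>+\<omega>. ennreal (\<bar>\<Xi> \<omega>\<bar> ^ (2 * k + 2)) \<partial>M) = ennreal x" "0 \<le> x"
    using all_momentsD[OF \<Xi>, of "2 * k + 2"] by (metis ennreal_cases infinity_ennreal_def less_irrefl)
  obtain b where b: "0 \<le> b" "\<And>i n. i \<in> I \<Longrightarrow>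
      (\<integral>\<^sup>+\<omega>. ennreal (em_scheme.running_max W f g (hh i) \<xi> \<tau> (real j * \<tau>) n \<omega> ^ (2 * (k + 1))) \<partial>M) \<le> ennreal b"
    using Suc.IH[of "k + 1"] by blast
  define C where "C = em_scheme.next_moment \<tau> T L (real j * \<tau>) k c x b"
  have step: "(\<integral>\<^sup>+\<omega>. ennreal (em_scheme.running_max W f g (hh i) \<xi> \<tau> (real (Suc j) * \<tau>) n \<omega> ^ (2 * k)) \<partial>M) \<le> ennreal C"
    if i: "i \<in> I" for i n
  proof -
    interpret em_scheme M F W f g "hh i" \<xi> \<Xi> \<tau> T L by (rule scheme[OF i])
    have K: "0 \<le> real j * \<tau>" using tau_pos by simp
    have "(\<integral>\<^sup>+\<omega>. ennreal (running_max (real j * \<tau> + \<tau>) n \<omega> ^ (2 * k)) \<partial>M) \<le> ennreal C"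
      unfolding C_def
      by (rule running_max_moment_step[OF c K x(2) b(1)]) (use x(1) b(2)[OF i, of n] in simp_all)
    then show ?thesis by (simp add: distrib_right add.commute)
  qed
  then show ?case
    \<comment> \<open>The sign of \<open>C\<close> could only be read off from an instance of the
      scheme, and \<open>I\<close> may be empty.\<close>
    by (intro exI[of _ "max 0 C"] conjI ballI allI) (auto simp: ennreal_max_0)
qed

text \<open>The delay is taken to be \<open>T\<close>, so that a single window already covers
  [0, T]; coefficients are constant, and the squared norm of the identity matrix is a sufficient
  growth constant.\<close>

lemma em_scheme_brownian:
  assumes "0 < T"
  shows "em_scheme M F W (\<lambda>_ _. 0) (\<lambda>_ _. mat 1 :: real ^ 'd ^ 'd) (\<lambda>_. T / real (Suc i)) (\<lambda>_ _. 0) (\<lambda>_. 0) T T ((norm (mat 1 :: real ^ 'd ^ 'd))\<^sup>2)"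
proof unfold_locales
  show "T / real (Suc i) \<le> T" using assms by (simp add: field_simps)
  show "(norm (x + s *\<^sub>R 0))\<^sup>2 \<le> (norm x)\<^sup>2 + 2 * s * ((norm (mat 1 :: real ^ 'd ^ 'd))\<^sup>2 * (1 + (norm x)\<^sup>2 + (norm y)\<^sup>2))"
    if "0 \<le> s" for s and x y :: "real ^ 'd" using that by simp
  show "(norm (mat 1 :: real ^ 'd ^ 'd))\<^sup>2 \<le> (norm (mat 1 :: real ^ 'd ^ 'd))\<^sup>2 * (1 + (norm x)\<^sup>2 + (norm y)\<^sup>2)"
    for x y :: "real ^ 'd" by (intro mult_le_cancel_left1[THEN iffD2]) auto
  show "all_moments (\<lambda>_. 0)" by (rule all_moments_const)
qed (use assms in \<open>auto simp: case_prod_unfold\<close>)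

text \<open>The scheme for \<open>dY = dW\<close> with constant steps samples the Brownian motion itself, so the grid
  estimate also controls its running supremum.\<close>

lemma brownian_sup_moments:
  assumes T: "0 < T"
  shows "\<exists>V C. V \<in> borel_measurable M \<and> (\<forall>\<omega>\<in>space M. \<forall>s\<in>{0..T}. ennreal (norm (W s \<omega>) ^ (2 * k)) \<le> V \<omega>)
    \<and> (\<integral>\<^sup>+\<omega>. V \<omega> \<partial>M) \<le> ennreal C \<and> 0 \<le> C"
proof -
  let ?g = "\<lambda>(_ :: real ^ 'd) (_ :: real ^ 'd). mat 1 :: real ^ 'd ^ 'd" and ?f = "\<lambda>(_ :: real ^ 'd) (_ :: real ^ 'd). 0 :: real ^ 'd"
  let ?h = "\<lambda>i (_ :: real ^ 'd). T / real (Suc i)" and ?x = "\<lambda>(_ :: 'w) (_ :: real). 0 :: real ^ 'd"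
  define S where "S i = em_scheme.running_max W ?f ?g (?h i) ?x T T (Suc i)" for i
  obtain C where C: "0 \<le> C" "\<And>i. (\<integral>\<^sup>+\<omega>. ennreal (S i \<omega> ^ (2 * k)) \<partial>M) \<le> ennreal C"
    using grid_moments[where I=UNIV and hh="?h" and f="?f" and g="?g" and j=1 and k=k, OF em_scheme_brownian[OF T] all_moments_const]
    unfolding S_def by (metis UNIV_I mult_1 of_nat_1)
  have Sm[measurable]: "S i \<in> borel_measurable M" for i
    unfolding S_def by (rule em_scheme.running_max_measurable[OF em_scheme_brownian[OF T]])
  have WS: "norm (W (real j * (T / real (Suc i))) \<omega>) \<le> S i \<omega>" if \<omega>: "\<omega> \<in> space M" and j: "j \<le> Suc i" for i j \<omega>
  proof -
    interpret em_scheme M F W ?f ?g "?h i" ?x "\<lambda>_. 0" T T "(norm (mat 1 :: real ^ 'd ^ 'd))\<^sup>2"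
      by (rule em_scheme_brownian[OF T])
    have tj: "t j \<omega> = real j * (T / real (Suc i))" for j
    proof (induction j)
      case (Suc j)
      then show ?case unfolding t_Suc by (simp add: algebra_simps add_divide_distrib)
    qed (simp add: t_0 del: of_nat_Suc)
    have Xj: "X j \<omega> = W (t j \<omega>) \<omega>" for j
      by (induction j) (simp_all add: X_0 t_0 W_0[OF \<omega>] X_Suc del: of_nat_Suc)
    have "real j * T \<le> real (Suc i) * T" using T j by (intro mult_right_mono) auto
    then have "t j \<omega> \<le> T" unfolding tj by (simp add: field_simps)
    from norm_le_running_max[OF j this] show ?thesis unfolding Xj tj S_def .
  qed
  \<comment> \<open>The meshes \<open>T / real (Suc i)\<close> are not nested, so a lower limit and
    Fatou's lemma take the place of monotone convergence. The result is measurable by construction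
    and dominates every value of the path.\<close>
  let ?V = "\<lambda>\<omega>. liminf (\<lambda>i. ennreal (S i \<omega> ^ (2 * k)))"
  have "ennreal (norm (W s \<omega>) ^ (2 * k)) \<le> ?V \<omega>" if \<omega>: "\<omega> \<in> space M" and s: "s \<in> {0..T}" for s \<omega>
  proof -
    obtain r where r: "r \<longlonglongrightarrow> s" "\<And>i. \<exists>j\<le>Suc i. r i = real j * (T / real (Suc i))"
      using uniform_grid_limit[OF T s] by blast
    have "(\<lambda>i. ennreal (norm (W (r i) \<omega>) ^ (2 * k))) \<longlonglongrightarrow> ennreal (norm (W s \<omega>) ^ (2 * k))"
    proof (intro tendsto_ennrealI tendsto_intros continuous_on_tendsto_compose[OF W_continuous[OF \<omega>] r(1)])
      have "r i \<in> {0..}" for i using r(2)[of i] T by auto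
      then show "\<forall>\<^sub>F i in sequentially. r i \<in> {0..}" by simp
    qed (use s in simp)
    then have "ennreal (norm (W s \<omega>) ^ (2 * k)) = liminf (\<lambda>i. ennreal (norm (W (r i) \<omega>) ^ (2 * k)))"
      by (rule lim_imp_Liminf[OF trivial_limit_sequentially, symmetric])
    also have "\<dots> \<le> ?V \<omega>"
    proof (intro Liminf_mono always_eventually allI ennreal_leI power_mono)
      fix i
      obtain j where "j \<le> Suc i" "r i = real j * (T / real (Suc i))" using r(2) by blast
      then show "norm (W (r i) \<omega>) \<le> S i \<omega>" using WS[OF \<omega>] by simp
    qed simp
    finally show ?thesis .
  qed
  moreover have "(\<integral>\<^sup>+\<omega>. ?V \<omega> \<partial>M) \<le> ennreal C"
  proof -
    have "(\<integral>\<^sup>+\<omega>. ?V \<omega> \<partial>M) \<le> liminf (\<lambda>i. \<integral>\<^sup>+\<omega>. ennreal (S i \<omega> ^ (2 * k)) \<partial>M)"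
      by (rule nn_integral_liminf) measurable
    also have "\<dots> \<le> liminf (\<lambda>i. ennreal C)" by (intro Liminf_mono always_eventually allI C)
    also have "\<dots> = ennreal C" by (simp add: Liminf_const)
    finally show ?thesis .
  qed
  ultimately show ?thesis using C(1) by (intro exI[of _ ?V] exI[of _ C]) auto
qed

end

section \<open>The continuous-time approximation\<close>

text \<open>Replaces a supremum over an interval by a countable one, from which measurability can be
  read off.\<close>

lemma SUP_continuous_grid:
  fixes u :: "real \<Rightarrow> ennreal"
  assumes T: "0 < T" and u: "continuous_on {0..T} u"
  shows "(SUP s\<in>{0..T}. u s) = (SUP i. SUP j\<in>{..Suc i}. u (real j * (T / real (Suc i))))"
proof (rule antisym)
  have grid_in: "real j * (T / real (Suc i)) \<in> {0..T}" if "j \<le> Suc i" for i j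
  proof -
    have "real j * T \<le> real (Suc i) * T" using T that by (intro mult_right_mono) auto
    then show ?thesis using T by (simp add: field_simps)
  qed
  show "(SUP s\<in>{0..T}. u s) \<le> (SUP i. SUP j\<in>{..Suc i}. u (real j * (T / real (Suc i))))" (is "_ \<le> ?R")
  proof (rule SUP_least)
    fix s assume s: "s \<in> {0..T}"
    obtain r where r: "r \<longlonglongrightarrow> s" "\<And>i. \<exists>j\<le>Suc i. r i = real j * (T / real (Suc i))"
      using uniform_grid_limit[OF T s] by blast
    have in_T: "r i \<in> {0..T}" for i using r(2)[of i] grid_in by auto
    have "(\<lambda>i. u (r i)) \<longlonglongrightarrow> u s"
      using continuous_on_tendsto_compose[OF u r(1) s] in_T by simp
    moreover have "u (r i) \<le> ?R" for i
    proof -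
      obtain j where "j \<le> Suc i" "r i = real j * (T / real (Suc i))" using r(2) by blast
      then show ?thesis by (intro SUP_upper2[of i UNIV] SUP_upper2[of j]) auto
    qed
    ultimately show "u s \<le> ?R" by (intro LIMSEQ_le_const2[of "\<lambda>i. u (r i)"]) auto
  qed
  show "?R \<le> (SUP s\<in>{0..T}. u s)"
    by (intro SUP_least SUP_upper grid_in) auto
qed

context em_scheme
begin

definition "Xc \<omega> = em_cont f g h \<tau> (\<xi> \<omega>) (\<lambda>s. W s \<omega>)"

lemma Xc_step:
  assumes "t n \<omega> \<le> s" "s \<le> t (Suc n) \<omega>"
  shows "Xc \<omega> s = (X n \<omega> + (s - t n \<omega>) *\<^sub>R f (X n \<omega>) (Y n \<omega>))
    + g (X n \<omega>) (Y n \<omega>) *v (W s \<omega> - W (t n \<omega>) \<omega>)"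
  using em_cont_step[OF h_pos tau_pos, where f=f and g=g and \<xi>="\<xi> \<omega>" and w="\<lambda>s. W s \<omega>" and n=n and t=s]
    em_bar_time[OF h_pos tau_pos, where f=f and g=g and \<xi>="\<xi> \<omega>" and w="\<lambda>s. W s \<omega>" and n=n] assms
  by (simp add: t_def X_def Y_def Xc_def)

text \<open>Monotone convergence makes the supremum over all \<open>n\<close> finite almost surely.
  If all grid times stayed below \<open>K\<close>, every value would count in it, so all values
  would lie in one closed ball; there the continuous positive \<open>h\<close> attains a positive
  minimum, and the grid times grow at least linearly.\<close>

lemma attains:
  assumes C: "\<And>n. (\<integral>\<^sup>+\<omega>. ennreal (running_max K n \<omega> ^ 2) \<partial>M) \<le> ennreal C"
  shows "AE \<omega> in M. \<exists>N. K \<le> t N \<omega>"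
proof -
  let ?S = "\<lambda>\<omega>. SUP n. ennreal (running_max K n \<omega> ^ 2)"
  have "(\<integral>\<^sup>+\<omega>. ?S \<omega> \<partial>M) = (SUP n. \<integral>\<^sup>+\<omega>. ennreal (running_max K n \<omega> ^ 2) \<partial>M)"
    using running_max_mono running_max_nonneg
    by (intro nn_integral_monotone_convergence_SUP) (auto simp: incseq_def le_fun_def intro!: ennreal_leI power_mono)
  also have "\<dots> \<le> ennreal C" by (intro SUP_least C)
  finally have "(\<integral>\<^sup>+\<omega>. ?S \<omega> \<partial>M) \<noteq> \<infinity>" by (auto simp: top_unique)
  then have "AE \<omega> in M. ?S \<omega> \<noteq> \<infinity>" by (intro nn_integral_PInf_AE) measurable
  then show ?thesis
  proof eventually_elim
    case (elim \<omega>)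
    show ?case
    proof (rule ccontr)
      assume "\<nexists>N. K \<le> t N \<omega>"
      then have less: "t N \<omega> < K" for N by (simp add: not_le)
      obtain c where c: "?S \<omega> = ennreal c" "0 \<le> c" using elim by (cases "?S \<omega>") auto
      have X: "norm (X n \<omega>) \<le> sqrt c" for n
      proof -
        have "ennreal (running_max K n \<omega> ^ 2) \<le> ennreal c" unfolding c(1)[symmetric] by (rule SUP_upper) simp
        then have "running_max K n \<omega> ^ 2 \<le> c" using c(2) by simp
        then have "running_max K n \<omega> \<le> sqrt c" by (rule real_le_rsqrt)
        then show ?thesis using norm_le_running_max[of n n \<omega> K] less[of n] by simp
      qed
      have "\<exists>x\<in>cball 0 (sqrt c). \<forall>y\<in>cball 0 (sqrt c). h x \<le> h y"
        using c(2) h_continuous by (intro continuous_attains_inf) (auto intro: continuous_on_subset)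
      then obtain x where x: "\<And>y. y \<in> cball 0 (sqrt c) \<Longrightarrow> h x \<le> h y" by blast
      have lin: "real n * h x \<le> t n \<omega>" for n
      proof (induction n)
        case (Suc n)
        have "h x \<le> h (X n \<omega>)" using X[of n] by (intro x) simp
        then show ?case using Suc by (simp add: t_Suc algebra_simps)
      qed (simp add: t_0)
      obtain n where "K < real n * h x" using reals_Archimedean3[OF h_pos] by blast
      then show False using lin[of n] less[of n] by simp
    qed
  qed
qed

lemma Xc_continuous:
  assumes \<omega>: "\<omega> \<in> space M"
  shows "continuous_on {0..t N \<omega>} (Xc \<omega>)"
proof (induction N)
  case (Suc N)
  have "continuous_on {t N \<omega>..t (Suc N) \<omega>} (\<lambda>s. (X N \<omega> + (s - t N \<omega>) *\<^sub>R f (X N \<omega>) (Y N \<omega>))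
    + g (X N \<omega>) (Y N \<omega>) *v (W s \<omega> - W (t N \<omega>) \<omega>))"
    by (intro continuous_intros bounded_linear.continuous_on[OF matrix_vector_mul_bounded_linear]
        continuous_on_subset[OF W_continuous[OF \<omega>]]) (use t_nonneg[of N \<omega>] in auto)
  then have "continuous_on {t N \<omega>..t (Suc N) \<omega>} (Xc \<omega>)"
    by (rule continuous_on_eq) (metis Xc_step atLeastAtMost_iff)
  then have "continuous_on ({0..t N \<omega>} \<union> {t N \<omega>..t (Suc N) \<omega>}) (Xc \<omega>)"
    by (intro continuous_on_closed_Un Suc) auto
  moreover have "{0..t N \<omega>} \<union> {t N \<omega>..t (Suc N) \<omega>} = {0..t (Suc N) \<omega>}"
    using t_nonneg[of N \<omega>] t_less[of N \<omega>] by auto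
  ultimately show ?case by simp
qed (simp add: t_0)

text \<open>Only a version is claimed, because the formula by grid steps describes the approximation
  up to \<open>T\<close> only on paths whose grid reaches \<open>T\<close>.\<close>

lemma sup_norm_measurable_version:
  assumes p: "0 < p" and att: "AE \<omega> in M. \<exists>N. T \<le> t N \<omega>"
  shows "\<exists>H\<in>borel_measurable M. AE \<omega> in M. (SUP s\<in>{0..T}. ennreal (norm (Xc \<omega> s) powr p)) = H \<omega>"
proof -
  define Z where "Z s n \<omega> = (X n \<omega> + (s - t n \<omega>) *\<^sub>R f (X n \<omega>) (Y n \<omega>))
    + g (X n \<omega>) (Y n \<omega>) *v (W s \<omega> - W (t n \<omega>) \<omega>)" for s n \<omega>
  \<comment> \<open>Where the grid never passes \<open>s\<close> this index is an arbitrary number;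
    such paths form a null set by \<open>att\<close>.\<close>
  define idx where "idx s \<omega> = (LEAST n. s < t (Suc n) \<omega>)" for s \<omega>
  have [measurable]: "idx s \<in> measurable M (count_space UNIV)" for s
    unfolding idx_def[abs_def] by measurable
  have Zm: "Z s n \<in> borel_measurable M" if s: "0 \<le> s" for s n
  proof -
    note [measurable] = coefficient_measurable[OF X_measurable[of n] Y_measurable[of n]] W_measurable[OF s]
      from_pre_sigma[OF W_stopping_time_measurable[OF stopping_time_t t_nonneg], of n]
    show ?thesis unfolding Z_def[abs_def]
      by (intro borel_measurable_add matrix_vector_mult_measurable) measurable
  qed
  have Zi[measurable]: "(\<lambda>\<omega>. Z (max 0 s) (idx (max 0 s) \<omega>) \<omega>) \<in> borel_measurable M" for s
    by (rule measurable_compose_countable[OF Zm]) auto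
  let ?H = "\<lambda>\<omega>. SUP i. SUP j\<in>{..Suc i}. ennreal (norm (Z (max 0 (real j * (T / real (Suc i)))) (idx (max 0 (real j * (T / real (Suc i)))) \<omega>) \<omega>) powr p)"
  have "?H \<in> borel_measurable M" by measurable
  moreover have "AE \<omega> in M. (SUP s\<in>{0..T}. ennreal (norm (Xc \<omega> s) powr p)) = ?H \<omega>"
    using att AE_space
  proof eventually_elim
    case (elim \<omega>)
    then obtain N where N: "T \<le> t N \<omega>" by blast
    have eq: "Xc \<omega> s = Z s (idx s \<omega>) \<omega>" if s: "s \<in> {0..T}" for s
    proof -
      have ex: "s < t (Suc N) \<omega>" using s N t_less[of N \<omega>] by simp
      then have 1: "s < t (Suc (idx s \<omega>)) \<omega>" unfolding idx_def by (rule LeastI)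
      have "t (idx s \<omega>) \<omega> \<le> s"
      proof (cases "idx s \<omega>")
        case (Suc j)
        then have "\<not> s < t (Suc j) \<omega>" using not_less_Least[of j "\<lambda>m. s < t (Suc m) \<omega>"] by (simp add: idx_def)
        then show ?thesis using Suc by simp
      qed (use s in \<open>simp add: t_0\<close>)
      then show ?thesis using 1 by (simp add: Xc_step Z_def)
    qed
    have "continuous_on {0..T} (Xc \<omega>)"
      using N by (intro continuous_on_subset[OF Xc_continuous[OF elim(2), of N]]) auto
    then have "continuous_on {0..T} (\<lambda>s. ennreal (norm (Xc \<omega> s) powr p))"
      using p by (intro continuous_on_ennreal continuous_on_powr' continuous_intros) auto
    from SUP_continuous_grid[OF T_pos this]
    have "(SUP s\<in>{0..T}. ennreal (norm (Xc \<omega> s) powr p)) =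
        (SUP i. SUP j\<in>{..Suc i}. ennreal (norm (Xc \<omega> (real j * (T / real (Suc i)))) powr p))" .
    also have "\<dots> = ?H \<omega>"
    proof (intro SUP_cong refl)
      fix i j assume "j \<in> {..Suc i}"
      then have "real j * T \<le> real (Suc i) * T" using T_pos by (intro mult_right_mono) auto
      then have in_T: "real j * (T / real (Suc i)) \<in> {0..T}" using T_pos by (simp add: field_simps)
      then have "max 0 (real j * (T / real (Suc i))) = real j * (T / real (Suc i))" by simp
      then show "ennreal (norm (Xc \<omega> (real j * (T / real (Suc i)))) powr p) =
        ennreal (norm (Z (max 0 (real j * (T / real (Suc i)))) (idx (max 0 (real j * (T / real (Suc i)))) \<omega>) \<omega>) powr p)"
        by (simp only: eq[OF in_T])
    qed
    finally show ?case .
  qed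
  ultimately show ?thesis by (intro bexI[of _ ?H])
qed

text \<open>Inside a step \<open>drift_bound\<close> is applied to the elapsed part of the step.
  Drift part and diffusion coefficient satisfy the same bound \<open>sq\<close>, and the increment
  of \<open>W\<close> is estimated by its values at both ends.\<close>

lemma norm_Xc_le:
  assumes \<omega>: "\<omega> \<in> space M" and s: "t n \<omega> \<le> s" "s \<le> t (Suc n) \<omega>" and K: "t n \<omega> \<le> K"
  shows "norm (Xc \<omega> s) \<le> 2 * growth * (1 + \<bar>\<Xi> \<omega>\<bar> + running_max K n \<omega>) * (1 + norm (W s \<omega>) + norm (W (t n \<omega>) \<omega>))"
proof -
  define B where "B = \<bar>\<Xi> \<omega>\<bar> + running_max K n \<omega>"
  have B0: "0 \<le> B" using running_max_nonneg[of K n \<omega>] by (simp add: B_def)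
  have XB: "norm (X n \<omega>) \<le> B" using norm_le_running_max[OF order_refl K] by (simp add: B_def)
  have YB: "norm (Y n \<omega>) \<le> B"
    unfolding B_def using K tau_pos by (intro norm_Y_le_running_max[OF \<omega> order_refl]) simp
  have sq: "v \<le> 2 * growth * (1 + B)" if v: "v\<^sup>2 \<le> growth * mass n \<omega>" for v
  proof (rule power2_le_imp_le)
    have "mass n \<omega> \<le> 1 + B\<^sup>2 + B\<^sup>2" using XB YB by (intro add_mono power_mono) auto
    also have "\<dots> \<le> 2 * (1 + B)\<^sup>2" using B0 by (simp add: power2_eq_square algebra_simps)
    finally have "growth * mass n \<omega> \<le> growth * (2 * (1 + B)\<^sup>2)"
      using growth_ge(1) by (intro mult_left_mono) auto
    also have "\<dots> \<le> (2 * growth) * growth * (2 * (1 + B)\<^sup>2)"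
      using growth_ge(1) by (intro mult_right_mono) auto
    also have "\<dots> = (2 * growth * (1 + B))\<^sup>2" by (simp add: power2_eq_square)
    finally show "v\<^sup>2 \<le> (2 * growth * (1 + B))\<^sup>2" using v by simp
  qed (use growth_ge(1) B0 in simp)
  have drift: "norm (X n \<omega> + (s - t n \<omega>) *\<^sub>R f (X n \<omega>) (Y n \<omega>)) \<le> 2 * growth * (1 + B)"
  proof (rule sq)
    have u: "0 \<le> s - t n \<omega>" "s - t n \<omega> \<le> h (X n \<omega>)" using s by (auto simp: t_Suc)
    have "2 * (s - t n \<omega>) * (L * mass n \<omega>) \<le> 2 * T * (L * mass n \<omega>)"
      using u h_le[of "X n \<omega>"] L_nonneg by (intro mult_right_mono) auto
    moreover have "(norm (X n \<omega>))\<^sup>2 \<le> mass n \<omega>" by simp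
    moreover have "(1 + 2 * T * L) * mass n \<omega> = mass n \<omega> + 2 * T * (L * mass n \<omega>)"
      by (simp only: distrib_right mult_1_left mult.assoc)
    moreover have "(1 + 2 * T * L) * mass n \<omega> \<le> growth * mass n \<omega>"
      by (intro mult_right_mono growth_ge) simp
    ultimately show "(norm (X n \<omega> + (s - t n \<omega>) *\<^sub>R f (X n \<omega>) (Y n \<omega>)))\<^sup>2 \<le> growth * mass n \<omega>"
      using drift_bound[OF u, of "Y n \<omega>"] by linarith
  qed
  have "norm (g (X n \<omega>) (Y n \<omega>) *v (W s \<omega> - W (t n \<omega>) \<omega>)) \<le> norm (g (X n \<omega>) (Y n \<omega>)) * norm (W s \<omega> - W (t n \<omega>) \<omega>)"
    by (rule norm_matrix_vector_mult_le)
  also have "\<dots> \<le> 2 * growth * (1 + B) * (norm (W s \<omega>) + norm (W (t n \<omega>) \<omega>))"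
    using growth_ge(1) B0 by (intro mult_mono norm_triangle_ineq4 sq diffusion_le_growth) auto
  finally have "norm (g (X n \<omega>) (Y n \<omega>) *v (W s \<omega> - W (t n \<omega>) \<omega>)) \<le> 2 * growth * (1 + B) * (norm (W s \<omega>) + norm (W (t n \<omega>) \<omega>))" .
  with drift have "norm (Xc \<omega> s) \<le> 2 * growth * (1 + B) + 2 * growth * (1 + B) * (norm (W s \<omega>) + norm (W (t n \<omega>) \<omega>))"
    unfolding Xc_step[OF s] by (rule norm_triangle_le[OF add_mono])
  also have "\<dots> = 2 * growth * (1 + B) * (1 + norm (W s \<omega>) + norm (W (t n \<omega>) \<omega>))"
    by (simp add: algebra_simps)
  finally show ?thesis by (simp add: B_def add.assoc)
qed

text \<open>The power \<open>p\<close> is raised to 2k, and \<open>power_mult_power_le\<close>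
  separates the running maximum from \<open>W\<close> by doubling the exponent, whence moments of
  order 4k on all sides. \<open>V\<close> is counted twice, for \<open>W\<close> at the current time
  and at the last grid time.\<close>

lemma sup_moment_bound:
  assumes p: "0 < p" "p \<le> 2 * real k" and K: "T \<le> K"
    and att: "AE \<omega> in M. \<exists>N. T \<le> t N \<omega>"
    and x: "(\<integral>\<^sup>+\<omega>. ennreal (\<bar>\<Xi> \<omega>\<bar> ^ (2 * (2 * k))) \<partial>M) \<le> ennreal x" "0 \<le> x"
    and b: "\<And>n. (\<integral>\<^sup>+\<omega>. ennreal (running_max K n \<omega> ^ (2 * (2 * k))) \<partial>M) \<le> ennreal b" "0 \<le> b"
    and V[measurable]: "V \<in> borel_measurable M"
    and WV: "\<And>\<omega> s. \<omega> \<in> space M \<Longrightarrow> s \<in> {0..T} \<Longrightarrow> ennreal (norm (W s \<omega>) ^ (2 * (2 * k))) \<le> V \<omega>"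
    and v: "(\<integral>\<^sup>+\<omega>. V \<omega> \<partial>M) \<le> ennreal v" "0 \<le> v"
  shows "(\<integral>\<^sup>+\<omega>. (SUP s\<in>{0..T}. ennreal (norm (Xc \<omega> s) powr p)) \<partial>M)
    \<le> ennreal (1 + (2 * growth) ^ (2 * k) * 3 ^ (2 * (2 * k)) * (2 + x + b + 2 * v))"
proof -
  define q where "q = 2 * (2 * k)"
  define D where "D = (2 * growth) ^ (2 * k) * 3 ^ q"
  have D0: "0 \<le> D" using growth_ge(1) by (simp add: D_def)
  let ?S = "\<lambda>\<omega>. SUP n. ennreal (running_max K n \<omega> ^ q)"
  have [measurable]: "\<Xi> \<in> borel_measurable M" using all_moments_measurable[OF \<Xi>_moments] .
  have pw: "ennreal (norm (Xc \<omega> s) powr p) \<le> 1 + ennreal D * (2 + ennreal (\<bar>\<Xi> \<omega>\<bar> ^ q) + ?S \<omega> + 2 * V \<omega>)"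
    if \<omega>: "\<omega> \<in> space M" and N: "T \<le> t N \<omega>" and s: "s \<in> {0..T}" for \<omega> N s
  proof -
    have "s < t (Suc N) \<omega>" using s N t_less[of N \<omega>] by simp
    then obtain n where n: "t n \<omega> \<le> s" "s < t (Suc n) \<omega>" using ex_step[of s "Suc N" \<omega>] s by auto
    define B w where "B = 1 + \<bar>\<Xi> \<omega>\<bar> + running_max K n \<omega>" and "w = 1 + norm (W s \<omega>) + norm (W (t n \<omega>) \<omega>)"
    note r0 = running_max_nonneg[of K n \<omega>]
    have B0: "0 \<le> B" using r0 by (simp add: B_def)
    have w0: "0 \<le> w" by (simp add: w_def)
    have "norm (Xc \<omega> s) powr p \<le> 1 + norm (Xc \<omega> s) ^ (2 * k)"
    proof (cases "norm (Xc \<omega> s) \<le> 1")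
      case True
      then have "norm (Xc \<omega> s) powr p \<le> 1 powr p" using p by (intro powr_mono2) auto
      then show ?thesis by (simp add: add_increasing2)
    next
      case False
      then have "norm (Xc \<omega> s) powr p \<le> norm (Xc \<omega> s) powr (real (2 * k))"
        using p by (intro powr_mono) auto
      also have "\<dots> = norm (Xc \<omega> s) ^ (2 * k)"
        using False by (intro powr_realpow) linarith
      finally show ?thesis by simp
    qed
    also have "norm (Xc \<omega> s) ^ (2 * k) \<le> (2 * growth * B * w) ^ (2 * k)"
      unfolding B_def w_def using n s K by (intro power_mono norm_Xc_le[OF \<omega>]) auto
    also have "(2 * growth * B * w) ^ (2 * k) = (2 * growth) ^ (2 * k) * (B ^ (2 * k) * w ^ (2 * k))"
      by (simp add: power_mult_distrib mult.assoc)
    also have "\<dots> \<le> (2 * growth) ^ (2 * k) * (B ^ q + w ^ q)"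
    proof (intro mult_left_mono)
      have "2 * k + 2 * k = q" by (simp add: q_def)
      then show "B ^ (2 * k) * w ^ (2 * k) \<le> B ^ q + w ^ q"
        using power_mult_power_le[OF B0 w0, of "2 * k" "2 * k"] by simp
    qed (use growth_ge(1) in simp)
    also have "\<dots> \<le> (2 * growth) ^ (2 * k) * (3 ^ q * (1 + \<bar>\<Xi> \<omega>\<bar> ^ q + running_max K n \<omega> ^ q)
        + 3 ^ q * (1 + norm (W s \<omega>) ^ q + norm (W (t n \<omega>) \<omega>) ^ q))"
      unfolding B_def w_def using growth_ge(1) r0 by (intro mult_left_mono add_mono power_sum3_le) auto
    also have "\<dots> = D * (2 + \<bar>\<Xi> \<omega>\<bar> ^ q + running_max K n \<omega> ^ q + (norm (W s \<omega>) ^ q + norm (W (t n \<omega>) \<omega>) ^ q))"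
      by (simp add: D_def algebra_simps)
    finally have "norm (Xc \<omega> s) powr p \<le>
        1 + D * (2 + \<bar>\<Xi> \<omega>\<bar> ^ q + running_max K n \<omega> ^ q + (norm (W s \<omega>) ^ q + norm (W (t n \<omega>) \<omega>) ^ q))"
      by simp
    then have "ennreal (norm (Xc \<omega> s) powr p) \<le>
        ennreal (1 + D * (2 + \<bar>\<Xi> \<omega>\<bar> ^ q + running_max K n \<omega> ^ q + (norm (W s \<omega>) ^ q + norm (W (t n \<omega>) \<omega>) ^ q)))"
      by (rule ennreal_leI)
    also have "\<dots> = 1 + ennreal D * (2 + ennreal (\<bar>\<Xi> \<omega>\<bar> ^ q) + ennreal (running_max K n \<omega> ^ q)
        + (ennreal (norm (W s \<omega>) ^ q) + ennreal (norm (W (t n \<omega>) \<omega>) ^ q)))"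
      using D0 r0 by (simp add: ennreal_plus ennreal_mult)
    also have "\<dots> \<le> 1 + ennreal D * (2 + ennreal (\<bar>\<Xi> \<omega>\<bar> ^ q) + ?S \<omega> + (V \<omega> + V \<omega>))"
      unfolding q_def using n s t_nonneg[of n \<omega>]
      by (intro add_left_mono mult_left_mono add_mono order_refl WV \<omega> SUP_upper) auto
    finally show ?thesis by (simp add: mult_2)
  qed
  have "(\<integral>\<^sup>+\<omega>. (SUP s\<in>{0..T}. ennreal (norm (Xc \<omega> s) powr p)) \<partial>M)
      \<le> (\<integral>\<^sup>+\<omega>. 1 + ennreal D * (2 + ennreal (\<bar>\<Xi> \<omega>\<bar> ^ q) + ?S \<omega> + 2 * V \<omega>) \<partial>M)"
    by (rule nn_integral_mono_AE) (use att AE_space in \<open>eventually_elim, auto intro!: SUP_least pw\<close>)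
  also have "\<dots> = 1 + ennreal D * (2 + (\<integral>\<^sup>+\<omega>. ennreal (\<bar>\<Xi> \<omega>\<bar> ^ q) \<partial>M) + (\<integral>\<^sup>+\<omega>. ?S \<omega> \<partial>M) + 2 * (\<integral>\<^sup>+\<omega>. V \<omega> \<partial>M))"
    by (simp add: nn_integral_add nn_integral_cmult emeasure_space_1)
  also have "(\<integral>\<^sup>+\<omega>. ?S \<omega> \<partial>M) = (SUP n. \<integral>\<^sup>+\<omega>. ennreal (running_max K n \<omega> ^ q) \<partial>M)"
    using running_max_mono running_max_nonneg
    by (intro nn_integral_monotone_convergence_SUP) (auto simp: incseq_def le_fun_def intro!: ennreal_leI power_mono)
  also have "1 + ennreal D * (2 + (\<integral>\<^sup>+\<omega>. ennreal (\<bar>\<Xi> \<omega>\<bar> ^ q) \<partial>M) + \<dots> + 2 * (\<integral>\<^sup>+\<omega>. V \<omega> \<partial>M))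
      \<le> 1 + ennreal D * (2 + ennreal x + ennreal b + 2 * ennreal v)"
    unfolding q_def by (intro add_left_mono mult_left_mono add_mono order_refl x(1) v(1) SUP_least b(1)) auto
  also have "\<dots> = ennreal (1 + D * (2 + x + b + 2 * v))"
    using D0 x(2) b(2) v(2) by (simp add: ennreal_plus ennreal_mult)
  finally show ?thesis by (simp add: D_def q_def)
qed

end

section \<open>Measurability of the data and the theorem\<close>

text \<open>\<open>W\<close> is set to 0 on the exceptional set. Null sets belong to
  \<open>F 0\<close>, so adaptedness survives; increments change only on a null set, so their law
  and their independence of the past survive as well.\<close>

lemma brownian_modification:
  fixes W :: "real \<Rightarrow> 'w \<Rightarrow> real ^ 'd"
  assumes "prob_space M" and "complete_measure M" and F: "usual_filtration M F" and W: "brownian_motion M F W"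
  obtains W' N where "N \<in> null_sets M" "brownian M F W'" "\<And>t \<omega>. \<omega> \<notin> N \<Longrightarrow> W' t \<omega> = W t \<omega>"
proof -
  interpret prob_space M by fact
  interpret complete_measure M by fact
  define N where "N = {\<omega> \<in> space M. \<not> (W 0 \<omega> = 0 \<and> continuous_on {0..} (\<lambda>t. W t \<omega>))}"
  have "AE \<omega> in M. W 0 \<omega> = 0 \<and> continuous_on {0..} (\<lambda>t. W t \<omega>)"
    using W unfolding brownian_motion_def by (intro AE_conjI) (elim conjE, assumption)+
  \<comment> \<open>Failure of continuity is not an event a priori; completeness makes it
    one.\<close>
  then have N: "N \<in> null_sets M" unfolding N_def AE_iff_null_sets .
  define W' where "W' t \<omega> = (if \<omega> \<in> N then 0 else W t \<omega>)" for t \<omega>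
  have sub: "subalgebra M (F t)" if "0 \<le> t" for t using F that unfolding usual_filtration_def by blast
  have mono: "sets (F s) \<subseteq> sets (F t)" if "0 \<le> s" "s \<le> t" for s t
    using F that unfolding usual_filtration_def by blast
  have NF: "N \<in> sets (F t)" if "0 \<le> t" for t
    using F N mono[OF order_refl that] unfolding usual_filtration_def by blast
  have WF: "W t \<in> borel_measurable (F t)" if "0 \<le> t" for t
    using W that unfolding brownian_motion_def by blast
  have W'F: "W' t \<in> borel_measurable (F t)" if "0 \<le> t" for t
    unfolding W'_def[abs_def] using NF[OF that] WF[OF that] by measurable
  have WM: "W t \<in> borel_measurable M" "W' t \<in> borel_measurable M" if "0 \<le> t" for t
    using measurable_from_subalg[OF sub[OF that]] WF[OF that] W'F[OF that] by blast+
  have dW: "(\<lambda>\<omega>. W t \<omega> - W s \<omega>) \<in> borel_measurable M"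
    and dW': "(\<lambda>\<omega>. W' t \<omega> - W' s \<omega>) \<in> borel_measurable M" if "0 \<le> s" "s < t" for s t
    using that by (intro borel_measurable_diff WM; simp)+
  have AE_N: "AE \<omega> in M. \<omega> \<notin> N" using N by (rule AE_not_in)
  have "brownian M F W'"
  proof unfold_locales
    fix s t :: real assume s: "0 \<le> s" and st: "s < t"
    let ?V = "\<lambda>W. sets (vimage_algebra (space M) (\<lambda>\<omega>. W t \<omega> - W s \<omega>) borel)"
    have ind: "indep_set (sets (F s)) (?V W)"
      using W s st unfolding brownian_motion_def by blast
    have V: "?V U = {(\<lambda>\<omega>. U t \<omega> - U s \<omega>) -` A \<inter> space M | A. A \<in> sets borel}" for U :: "real \<Rightarrow> 'w \<Rightarrow> real ^ 'd"
      by (rule sets_vimage_algebra2) simp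
    show "indep_set (sets (F s)) (?V W')"
      unfolding indep_sets2_eq
    proof (intro conjI ballI)
      show "sets (F s) \<subseteq> events" using sub[OF s] by (simp add: subalgebra_def)
      show "?V W' \<subseteq> events" unfolding V using measurable_sets[OF dW'[OF s st]] by auto
      fix a b assume a: "a \<in> sets (F s)" and "b \<in> ?V W'"
      then obtain A where A: "A \<in> sets borel" and b: "b = (\<lambda>\<omega>. W' t \<omega> - W' s \<omega>) -` A \<inter> space M"
        unfolding V by auto
      let ?c = "(\<lambda>\<omega>. W t \<omega> - W s \<omega>) -` A \<inter> space M"
      have aM: "a \<in> events" using a sub[OF s] by (auto simp: subalgebra_def)
      have bM: "b \<in> events" unfolding b by (rule measurable_sets[OF dW'[OF s st] A])
      have cM: "?c \<in> events" by (rule measurable_sets[OF dW[OF s st] A])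
      have bc: "AE \<omega> in M. \<omega> \<in> b \<longleftrightarrow> \<omega> \<in> ?c"
        using AE_N by eventually_elim (simp add: b W'_def)
      have "prob (a \<inter> b) = prob (a \<inter> ?c)"
        using bc by (intro finite_measure_eq_AE) (auto simp: aM bM cM elim: eventually_mono)
      also have "\<dots> = prob a * prob ?c"
        using ind a A unfolding indep_sets2_eq V by blast
      also have "prob ?c = prob b"
        using bc by (intro finite_measure_eq_AE) (auto simp: bM cM elim: eventually_mono)
      finally show "prob (a \<inter> b) = prob a * prob b" .
    qed
    fix i
    have vl: "(\<lambda>z. z $ i) \<in> borel_measurable (borel :: (real ^ 'd) measure)"
      by (intro borel_measurable_continuous_onI continuous_intros)
    have "distributed M lborel (\<lambda>\<omega>. (W t \<omega> - W s \<omega>) $ i) (normal_density 0 (sqrt (t - s)))"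
      using W s st unfolding brownian_motion_def by blast
    moreover have "distr M lborel (\<lambda>\<omega>. (W' t \<omega> - W' s \<omega>) $ i) = distr M lborel (\<lambda>\<omega>. (W t \<omega> - W s \<omega>) $ i)"
      using AE_N measurable_compose[OF dW[OF s st] vl] measurable_compose[OF dW'[OF s st] vl]
      by (intro distr_cong_AE) (auto simp: W'_def elim: eventually_mono)
    ultimately show "distributed M lborel (\<lambda>\<omega>. (W' t \<omega> - W' s \<omega>) $ i) (normal_density 0 (sqrt (t - s)))"
      using measurable_compose[OF dW'[OF s st] vl] by (simp add: distributed_def)
  next
    fix \<omega> assume \<omega>: "\<omega> \<in> space M"
    show "W' 0 \<omega> = 0" using \<omega> by (auto simp: W'_def N_def)
    show "continuous_on {0..} (\<lambda>t. W' t \<omega>)"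
      using \<omega> by (cases "\<omega> \<in> N") (simp add: W'_def, simp add: W'_def, simp add: N_def)
  qed (use sub mono W'F in auto)
  then show ?thesis by (rule that[OF N]) (simp add: W'_def)
qed

text \<open>Evaluation is 1-Lipschitz for the uniform distance, hence preimages of open sets are
  open.\<close>

lemma eval_measurable_path_borel:
  assumes \<theta>: "\<theta> \<in> {-\<tau>..0}"
  shows "(\<lambda>\<phi>. \<phi> \<theta>) \<in> measurable (path_borel \<tau> :: (real \<Rightarrow> 'a :: metric_space) measure) borel"
proof (rule borel_measurableI)
  let ?C = "cfunspace (top_of_set {-\<tau>..0}) (euclidean_metric :: 'a metric)"
  have opens: "{U. openin (mtopology_of ?C) U} \<subseteq> Pow (mspace ?C)"
    using openin_subset by fastforce
  have sp: "space (path_borel \<tau> :: (real \<Rightarrow> 'a) measure) = mspace ?C"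
    using opens by (simp add: path_borel_def Let_def space_measure_of del: mspace_cfunspace)
  interpret C: Metric_space "mspace ?C" "mdist ?C" by (rule Metric_space_mspace_mdist)
  fix S :: "'a set" assume S: "open S"
  have "openin (mtopology_of ?C) ((\<lambda>\<phi>. \<phi> \<theta>) -` S \<inter> mspace ?C)"
    unfolding mtopology_of_def C.openin_mtopology
  proof (intro conjI allI impI)
    fix \<phi> assume \<phi>: "\<phi> \<in> (\<lambda>\<phi>. \<phi> \<theta>) -` S \<inter> mspace ?C"
    then obtain r where r: "0 < r" "\<And>y. dist y (\<phi> \<theta>) < r \<Longrightarrow> y \<in> S"
      using S unfolding open_dist by auto
    have "\<psi> \<in> (\<lambda>\<phi>. \<phi> \<theta>) -` S \<inter> mspace ?C" if "\<psi> \<in> C.mball \<phi> r" for \<psi>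
    proof -
      have \<psi>: "\<psi> \<in> mspace ?C" "mdist ?C \<phi> \<psi> < r" using that by (simp_all only: C.in_mball)
      have "mdist euclidean_metric (\<phi> \<theta>) (\<psi> \<theta>) \<le> mdist ?C \<phi> \<psi>"
        using \<phi> \<psi>(1) \<theta> by (intro mdist_cfunspace_imp_mdist_le[OF _ _ order_refl]) auto
      then have "dist (\<psi> \<theta>) (\<phi> \<theta>) < r" using \<psi>(2) by (simp add: dist_commute)
      then show ?thesis using r(2) \<psi>(1) by simp
    qed
    then show "\<exists>r>0. C.mball \<phi> r \<subseteq> (\<lambda>\<phi>. \<phi> \<theta>) -` S \<inter> mspace ?C" using r(1) by blast
  qed simp
  then show "(\<lambda>\<phi>. \<phi> \<theta>) -` S \<inter> space (path_borel \<tau>) \<in> sets (path_borel \<tau>)"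
    unfolding sp using opens by (auto simp: path_borel_def Let_def simp del: mspace_cfunspace intro!: in_measure_of)
qed

lemma initial_datum_measurable:
  assumes "initial_datum M F0 \<tau> \<xi>" "\<theta> \<in> {-\<tau>..0}"
  shows "(\<lambda>\<omega>. \<xi> \<omega> \<theta>) \<in> borel_measurable F0"
proof -
  have "(\<lambda>\<omega>. restrict (\<xi> \<omega>) {-\<tau>..0}) \<in> measurable F0 (path_borel \<tau>)"
    using assms(1) by (simp add: initial_datum_def)
  from measurable_compose[OF this eval_measurable_path_borel[OF assms(2)]] assms(2)
  show ?thesis by (simp add: restrict_apply')
qed

text \<open>\<^const>\<open>path_norm\<close> is replaced by a supremum over a countable grid, which is visibly measurable.\<close>

lemma initial_datum_norm_bound:
  fixes \<xi> :: "'w \<Rightarrow> real \<Rightarrow> 'a :: real_normed_vector"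
  assumes M: "prob_space M" and sub: "subalgebra M F0" and \<xi>: "initial_datum M F0 \<tau> \<xi>" and \<tau>: "0 < \<tau>"
  obtains \<Xi> where "prob_space.all_moments M \<Xi>"
    "\<And>\<omega> \<theta>. \<omega> \<in> space M \<Longrightarrow> \<theta> \<in> {-\<tau>..0} \<Longrightarrow> norm (\<xi> \<omega> \<theta>) \<le> \<Xi> \<omega>"
proof -
  interpret prob_space M by fact
  have sp: "space F0 = space M" using sub by (simp add: subalgebra_def)
  have cont: "continuous_on {-\<tau>..0} (\<xi> \<omega>)" if "\<omega> \<in> space M" for \<omega>
    using initial_datum_continuous[OF \<xi>] that sp by simp
  \<comment> \<open>A grid on [0, \<tau>] reflected at 0, to fit
    \<open>SUP_continuous_grid\<close>.\<close>
  define S where "S \<omega> = (SUP i. SUP j\<in>{..Suc i}. ennreal (norm (\<xi> \<omega> (- (real j * (\<tau> / real (Suc i)))))))" for \<omega>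
  have grid_in: "- (real j * (\<tau> / real (Suc i))) \<in> {-\<tau>..0}" if "j \<in> {..Suc i}" for i j
  proof -
    have "real j * \<tau> \<le> real (Suc i) * \<tau>" using \<tau> that by (intro mult_right_mono) auto
    then show ?thesis using \<tau> by (simp add: field_simps)
  qed
  have Sm[measurable]: "S \<in> borel_measurable M"
  proof -
    have "(\<lambda>\<omega>. ennreal (norm (\<xi> \<omega> (- (real j * (\<tau> / real (Suc i))))))) \<in> borel_measurable M"
      if "j \<in> {..Suc i}" for i j
      using measurable_from_subalg[OF sub initial_datum_measurable[OF \<xi> grid_in[OF that]]] by measurable
    then show ?thesis unfolding S_def[abs_def] by (intro borel_measurable_SUP) auto
  qed
  have S: "S \<omega> = (SUP s\<in>{0..\<tau>}. ennreal (norm (\<xi> \<omega> (- s))))" if "\<omega> \<in> space M" for \<omega>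
    unfolding S_def
    by (rule SUP_continuous_grid[symmetric, OF \<tau>])
       (intro continuous_on_ennreal continuous_on_norm continuous_on_compose2[OF cont[OF that]] continuous_intros, auto)
  have pn: "norm (\<xi> \<omega> \<theta>) \<le> path_norm \<tau> (\<xi> \<omega>)" if "\<omega> \<in> space M" "\<theta> \<in> {-\<tau>..0}" for \<omega> \<theta>
  proof -
    have "compact ((\<lambda>\<theta>. norm (\<xi> \<omega> \<theta>)) ` {-\<tau>..0})"
      using cont[OF that(1)] by (intro compact_continuous_image continuous_on_norm) auto
    then have "bdd_above ((\<lambda>\<theta>. norm (\<xi> \<omega> \<theta>)) ` {-\<tau>..0})"
      by (intro bounded_imp_bdd_above compact_imp_bounded)
    then show ?thesis unfolding path_norm_def by (intro cSUP_upper that(2))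
  qed
  have S_le: "S \<omega> \<le> ennreal (path_norm \<tau> (\<xi> \<omega>))" if "\<omega> \<in> space M" for \<omega>
    unfolding S[OF that] by (intro SUP_least ennreal_leI pn that) auto
  have S_fin: "S \<omega> = ennreal (enn2real (S \<omega>))" if "\<omega> \<in> space M" for \<omega>
    using le_less_trans[OF S_le[OF that] ennreal_less_top] by simp
  have pn0: "0 \<le> path_norm \<tau> (\<xi> \<omega>)" if "\<omega> \<in> space M" for \<omega>
    using pn[OF that, of 0] \<tau> order_trans[OF norm_ge_zero] by simp
  show ?thesis
  proof (rule that)
    show "norm (\<xi> \<omega> \<theta>) \<le> enn2real (S \<omega>)" if \<omega>: "\<omega> \<in> space M" and \<theta>: "\<theta> \<in> {-\<tau>..0}" for \<omega> \<theta>
    proof -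
      have "ennreal (norm (\<xi> \<omega> (- (- \<theta>)))) \<le> S \<omega>"
        unfolding S[OF \<omega>] using \<theta> by (intro SUP_upper) auto
      then have "ennreal (norm (\<xi> \<omega> \<theta>)) \<le> ennreal (enn2real (S \<omega>))" using S_fin[OF \<omega>] by simp
      then show ?thesis by simp
    qed
    show "all_moments (\<lambda>\<omega>. enn2real (S \<omega>))"
    proof (rule all_moments_evenI)
      fix k
      have "(\<integral>\<^sup>+\<omega>. ennreal (\<bar>enn2real (S \<omega>)\<bar> ^ (2 * k + 2)) \<partial>M) \<le> (\<integral>\<^sup>+\<omega>. ennreal (path_norm \<tau> (\<xi> \<omega>) powr (2 * real k + 2)) \<partial>M)"
      proof (intro nn_integral_mono ennreal_leI)
        fix \<omega> assume \<omega>: "\<omega> \<in> space M"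
        have "enn2real (S \<omega>) \<le> path_norm \<tau> (\<xi> \<omega>)"
          using S_le[OF \<omega>] S_fin[OF \<omega>] pn0[OF \<omega>] by (metis ennreal_le_iff)
        then have "\<bar>enn2real (S \<omega>)\<bar> ^ (2 * k + 2) \<le> path_norm \<tau> (\<xi> \<omega>) ^ (2 * k + 2)"
          by (intro power_mono) auto
        also have "\<dots> = path_norm \<tau> (\<xi> \<omega>) powr real (2 * k + 2)"
        proof (cases "path_norm \<tau> (\<xi> \<omega>) = 0")
          case False
          then show ?thesis using pn0[OF \<omega>] by (intro powr_realpow[symmetric]) simp
        qed simp
        finally show "\<bar>enn2real (S \<omega>)\<bar> ^ (2 * k + 2) \<le> path_norm \<tau> (\<xi> \<omega>) powr (2 * real k + 2)"
          by (simp add: add.commute)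
      qed
      also have "\<dots> < \<infinity>" using \<xi> unfolding initial_datum_def by (auto simp: add_nonneg_nonneg)
      finally show "(\<integral>\<^sup>+\<omega>. ennreal (\<bar>enn2real (S \<omega>)\<bar> ^ (2 * k + 2)) \<partial>M) < \<infinity>" .
    qed measurable
  qed
qed

lemma (in complete_measure) borel_measurable_AE_eq:
  assumes H: "H \<in> borel_measurable M" and eq: "AE x in M. G x = H x"
  shows "G \<in> borel_measurable M"
proof (rule measurableI)
  fix A :: "'b set" assume A: "A \<in> sets borel"
  show "G -` A \<inter> space M \<in> sets M"
  proof (rule in_sets_AE[OF _ measurable_sets[OF H A]])
    show "AE x in M. (x \<in> H -` A \<inter> space M) = (x \<in> G -` A \<inter> space M)"
      using eq by eventually_elim simp
  qed auto
qed simp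

text \<open>Expanding the square gives \<open>2 * s\<close> times the inner product of
  \<open>x\<close> with the drift plus s/2 times the squared norm of the drift; for
  \<open>s \<le> h \<delta> x\<close> the left-hand side of Assumption B dominates that bracket. The
  sum of the four constants serves every bound, and it is free of \<delta> because those of
  Assumption B are.\<close>

lemma one_step_growth_constant:
  assumes A: "assumption_A f g" and B: "assumption_B T f h"
  obtains L where "0 \<le> L"
    "\<And>\<delta> s x y. \<delta> \<in> {0<..<1} \<Longrightarrow> 0 \<le> s \<Longrightarrow> s \<le> h \<delta> x \<Longrightarrow>
      (norm (x + s *\<^sub>R f x y))\<^sup>2 \<le> (norm x)\<^sup>2 + 2 * s * (L * (1 + (norm x)\<^sup>2 + (norm y)\<^sup>2))"
    "\<And>x y. (norm (g x y))\<^sup>2 \<le> L * (1 + (norm x)\<^sup>2 + (norm y)\<^sup>2)"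
proof -
  obtain a b where a: "0 \<le> a" "0 \<le> b" "\<And>x y. (norm (g x y))\<^sup>2 \<le> a * ((norm x)\<^sup>2 + (norm y)\<^sup>2) + b"
    using A unfolding assumption_A_def by blast
  obtain c d where c: "0 < c" "0 < d" "\<And>\<delta> x y. \<delta> \<in> {0<..<1} \<Longrightarrow>
      x \<bullet> f x y + 1/2 * h \<delta> x * (norm (f x y))\<^sup>2 \<le> c * ((norm x)\<^sup>2 + (norm y)\<^sup>2) + d"
    using B unfolding assumption_B_def by blast
  have lin: "u * r + v \<le> (a + b + c + d) * (1 + r)" if "0 \<le> r" "u \<le> a + b + c + d" "v \<le> a + b + c + d" for u v r
    using mult_right_mono[OF that(2,1)] that(3) by (simp add: distrib_left)
  show ?thesis
  proof (rule that[of "a + b + c + d"])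
    show "0 \<le> a + b + c + d" using a c by simp
    show "(norm (g x y))\<^sup>2 \<le> (a + b + c + d) * (1 + (norm x)\<^sup>2 + (norm y)\<^sup>2)" for x y
      using a(3)[of x y] lin[of "(norm x)\<^sup>2 + (norm y)\<^sup>2" a b] a(1,2) c(1,2) by (simp add: add.assoc)
    fix \<delta> s x y assume \<delta>: "\<delta> \<in> {0<..<1}" and s: "0 \<le> s" "s \<le> h \<delta> x"
    have "(norm (x + s *\<^sub>R f x y))\<^sup>2 = (norm x)\<^sup>2 + 2 * s * (x \<bullet> f x y + 1/2 * s * (norm (f x y))\<^sup>2)"
      unfolding power2_norm_eq_inner
      by (simp add: inner_add_left inner_add_right inner_commute[of "f x y" x] algebra_simps)
    also have "\<dots> \<le> (norm x)\<^sup>2 + 2 * s * (x \<bullet> f x y + 1/2 * h \<delta> x * (norm (f x y))\<^sup>2)"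
      using s by (intro add_left_mono mult_left_mono mult_right_mono) auto
    also have "\<dots> \<le> (norm x)\<^sup>2 + 2 * s * ((a + b + c + d) * (1 + (norm x)\<^sup>2 + (norm y)\<^sup>2))"
      using c(3)[OF \<delta>, of x y] lin[of "(norm x)\<^sup>2 + (norm y)\<^sup>2" c d] a(1,2) c(1,2) s
      by (intro add_left_mono mult_left_mono) (auto simp: add.assoc)
    finally show "(norm (x + s *\<^sub>R f x y))\<^sup>2 \<le> (norm x)\<^sup>2 + 2 * s * ((a + b + c + d) * (1 + (norm x)\<^sup>2 + (norm y)\<^sup>2))" .
  qed
qed

theorem theorem4p4:
  fixes M :: "'w measure"
    and F :: "real \<Rightarrow> 'w measure"
    and W :: "real \<Rightarrow> 'w \<Rightarrow> real ^ 'd"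
    and f :: "real ^ 'm \<Rightarrow> real ^ 'm \<Rightarrow> real ^ 'm"
    and g :: "real ^ 'm \<Rightarrow> real ^ 'm \<Rightarrow> real ^ 'd ^ 'm"
    and h :: "real \<Rightarrow> real ^ 'm \<Rightarrow> real"
    and \<xi> :: "'w \<Rightarrow> real \<Rightarrow> real ^ 'm"
    and \<tau> T :: real
  assumes "prob_space M" and "complete_measure M"
    and "usual_filtration M F"
    and "brownian_motion M F W"
    and "0 < \<tau>" and "0 < T"
    and "case_prod f \<in> borel_measurable borel"
    and "case_prod g \<in> borel_measurable borel"
    and "initial_datum M (F 0) \<tau> \<xi>"
    and "assumption_A f g"
    and "assumption_B T f h"
  shows "(\<forall>\<delta>\<in>{0<..<1}. attainable M f g (h \<delta>) \<tau> \<xi> W T) \<and>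
    (\<forall>p>0. \<exists>C>0. \<forall>\<delta>\<in>{0<..<1}.
       (\<lambda>\<omega>. SUP t\<in>{0..T}. ennreal (norm (em_cont f g (h \<delta>) \<tau> (\<xi> \<omega>) (\<lambda>t. W t \<omega>) t) powr p))
         \<in> borel_measurable M \<and>
       (\<integral>\<^sup>+\<omega>. (SUP t\<in>{0..T}. ennreal (norm (em_cont f g (h \<delta>) \<tau> (\<xi> \<omega>) (\<lambda>t. W t \<omega>) t) powr p)) \<partial>M)
         \<le> ennreal C)"
proof -
  interpret complete_measure M by fact
  obtain W' N where N: "N \<in> null_sets M" and W': "brownian M F W'"
    and eq: "\<And>t \<omega>. \<omega> \<notin> N \<Longrightarrow> W' t \<omega> = W t \<omega>"
    using brownian_modification[OF assms(1-4)] by metis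
  interpret brownian M F W' by (rule W')
  have AE_N: "AE \<omega> in M. \<omega> \<notin> N" using N by (rule AE_not_in)
  obtain \<Xi> where \<Xi>: "all_moments \<Xi>"
    "\<And>\<omega> \<theta>. \<omega> \<in> space M \<Longrightarrow> \<theta> \<in> {-\<tau>..0} \<Longrightarrow> norm (\<xi> \<omega> \<theta>) \<le> \<Xi> \<omega>"
    using initial_datum_norm_bound[OF assms(1) subalgebra_F assms(9,5)] by auto
  obtain L where L: "0 \<le> L"
    "\<And>\<delta> s x y. \<delta> \<in> {0<..<1} \<Longrightarrow> 0 \<le> s \<Longrightarrow> s \<le> h \<delta> x \<Longrightarrow>
      (norm (x + s *\<^sub>R f x y))\<^sup>2 \<le> (norm x)\<^sup>2 + 2 * s * (L * (1 + (norm x)\<^sup>2 + (norm y)\<^sup>2))"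
    "\<And>x y. (norm (g x y))\<^sup>2 \<le> L * (1 + (norm x)\<^sup>2 + (norm y)\<^sup>2)"
    using one_step_growth_constant[OF assms(10,11)] by blast
  have scheme: "em_scheme M F W' f g (h \<delta>) \<xi> \<Xi> \<tau> T L" if \<delta>: "\<delta> \<in> {0<..<1}" for \<delta>
  proof unfold_locales
    have h: "continuous_on UNIV (h \<delta>)" "\<And>x. 0 < h \<delta> x" "\<And>x. h \<delta> x \<le> \<delta> * T"
      using assms(11) \<delta> by (auto simp: assumption_B_def)
    show "continuous_on UNIV (h \<delta>)" "0 < h \<delta> x" for x by fact+
    show "h \<delta> x \<le> T" for x
      using order_trans[OF h(3)[of x] mult_left_le_one_le[of T \<delta>]] \<delta> \<open>0 < T\<close> by simp
    show "continuous_on {-\<tau>..0} (\<xi> \<omega>)" if "\<omega> \<in> space M" for \<omega>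
      using initial_datum_continuous[OF assms(9)] that space_F_nonneg[of 0] by simp
    show "(\<lambda>\<omega>. \<xi> \<omega> \<theta>) \<in> borel_measurable (F 0)" if "\<theta> \<in> {-\<tau>..0}" for \<theta>
      by (rule initial_datum_measurable[OF assms(9) that])
  qed (use assms(5-8) L(1) L(2)[OF \<delta>] L(3) \<Xi> in auto)
  \<comment> \<open>A whole number of windows covering \<open>T\<close>, since moments are
    controlled at multiples of \<tau>.\<close>
  obtain j :: nat where j: "T < real j * \<tau>" using reals_Archimedean3[OF \<open>0 < \<tau>\<close>] by blast
  define K where "K = real j * \<tau>"
  note grid = grid_moments[where hh=h and I="{0<..<1}" and j=j, OF scheme \<Xi>(1), folded K_def]
  have att: "AE \<omega> in M. \<exists>n. T \<le> em_scheme.t W' f g (h \<delta>) \<xi> \<tau> n \<omega>" if \<delta>: "\<delta> \<in> {0<..<1}" for \<delta>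
  proof -
    interpret em_scheme M F W' f g "h \<delta>" \<xi> \<Xi> \<tau> T L by (rule scheme[OF \<delta>])
    obtain C where "\<And>n. (\<integral>\<^sup>+\<omega>. ennreal (running_max K n \<omega> ^ (2 * 1)) \<partial>M) \<le> ennreal C"
      using grid[of 1] \<delta> by blast
    from attains[OF this[unfolded mult_1_right]] show ?thesis
      using j unfolding K_def by (elim eventually_mono) (meson less_imp_le order_trans)
  qed
  show ?thesis
  proof (intro conjI ballI allI impI)
    fix \<delta> :: real assume \<delta>: "\<delta> \<in> {0<..<1}"
    interpret em_scheme M F W' f g "h \<delta>" \<xi> \<Xi> \<tau> T L by (rule scheme[OF \<delta>])
    show "attainable M f g (h \<delta>) \<tau> \<xi> W T"
      unfolding attainable_def using att[OF \<delta>] AE_N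
      by eventually_elim (simp add: t_def eq)
  next
    fix p :: real assume p: "0 < p"
    obtain k :: nat where k: "p \<le> real k" using real_arch_simple by blast
    then have pk: "p \<le> 2 * real k" by simp
    obtain x where x: "(\<integral>\<^sup>+\<omega>. ennreal (\<bar>\<Xi> \<omega>\<bar> ^ (2 * (2 * k))) \<partial>M) = ennreal x" "0 \<le> x"
      using all_momentsD[OF \<Xi>(1), of "2 * (2 * k)"] by (metis ennreal_cases infinity_ennreal_def less_irrefl)
    obtain b where b: "0 \<le> b" "\<And>\<delta> n. \<delta> \<in> {0<..<1} \<Longrightarrow>
        (\<integral>\<^sup>+\<omega>. ennreal (em_scheme.running_max W' f g (h \<delta>) \<xi> \<tau> K n \<omega> ^ (2 * (2 * k))) \<partial>M) \<le> ennreal b"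
      using grid[of "2 * k"] by blast
    obtain V v where V: "V \<in> borel_measurable M"
      "\<And>\<omega> s. \<omega> \<in> space M \<Longrightarrow> s \<in> {0..T} \<Longrightarrow> ennreal (norm (W' s \<omega>) ^ (2 * (2 * k))) \<le> V \<omega>"
      "(\<integral>\<^sup>+\<omega>. V \<omega> \<partial>M) \<le> ennreal v" "0 \<le> v"
      using brownian_sup_moments[OF \<open>0 < T\<close>, of "2 * k"] by blast
    define C where "C = 1 + (2 * em_scheme.growth T L) ^ (2 * k) * 3 ^ (2 * (2 * k)) * (2 + x + b + 2 * v)"
    have step: "(\<lambda>\<omega>. SUP t\<in>{0..T}. ennreal (norm (em_cont f g (h \<delta>) \<tau> (\<xi> \<omega>) (\<lambda>t. W t \<omega>) t) powr p)) \<in> borel_measurable M \<and>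
       (\<integral>\<^sup>+\<omega>. (SUP t\<in>{0..T}. ennreal (norm (em_cont f g (h \<delta>) \<tau> (\<xi> \<omega>) (\<lambda>t. W t \<omega>) t) powr p)) \<partial>M) \<le> ennreal C \<and> 0 < C"
      if \<delta>: "\<delta> \<in> {0<..<1}" for \<delta>
    proof -
      interpret em_scheme M F W' f g "h \<delta>" \<xi> \<Xi> \<tau> T L by (rule scheme[OF \<delta>])
      let ?G = "\<lambda>\<omega>. SUP t\<in>{0..T}. ennreal (norm (em_cont f g (h \<delta>) \<tau> (\<xi> \<omega>) (\<lambda>t. W t \<omega>) t) powr p)"
      have G: "AE \<omega> in M. ?G \<omega> = (SUP s\<in>{0..T}. ennreal (norm (Xc \<omega> s) powr p))"
        using AE_N by eventually_elim (simp add: Xc_def eq)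
      obtain H where H: "H \<in> borel_measurable M" "AE \<omega> in M. (SUP s\<in>{0..T}. ennreal (norm (Xc \<omega> s) powr p)) = H \<omega>"
        using sup_norm_measurable_version[OF p att[OF \<delta>]] by blast
      \<comment> \<open>Nothing is known of the original supremum on \<open>N\<close> or where the
        grid stops short of \<open>T\<close>; agreement almost everywhere with \<open>H\<close>
        suffices in a complete space.\<close>
      have "AE \<omega> in M. ?G \<omega> = H \<omega>" using G H(2) by eventually_elim simp
      with H(1) have "?G \<in> borel_measurable M" by (rule borel_measurable_AE_eq)
      moreover have "(\<integral>\<^sup>+\<omega>. ?G \<omega> \<partial>M) = (\<integral>\<^sup>+\<omega>. (SUP s\<in>{0..T}. ennreal (norm (Xc \<omega> s) powr p)) \<partial>M)"
        by (rule nn_integral_cong_AE[OF G])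
      moreover have "\<dots> \<le> ennreal C"
        unfolding C_def using j x V b(1) b(2)[OF \<delta>]
        by (intro sup_moment_bound[OF p pk _ att[OF \<delta>], where K=K and V=V]) (auto simp: K_def)
      moreover have "0 < C"
        unfolding C_def using growth_ge(1) x b V by (intro add_pos_nonneg mult_nonneg_nonneg) auto
      ultimately show ?thesis by simp
    qed
    \<comment> \<open>\<open>C\<close> does not involve \<delta>, but its positivity is established
      inside an instance of the scheme; any admissible \<delta> will do.\<close>
    have "0 < C" using step[of "1/2"] by simp
    with step show "\<exists>C>0. \<forall>\<delta>\<in>{0<..<1}.
       (\<lambda>\<omega>. SUP t\<in>{0..T}. ennreal (norm (em_cont f g (h \<delta>) \<tau> (\<xi> \<omega>) (\<lambda>t. W t \<omega>) t) powr p)) \<in> borel_measurable M \<and>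
       (\<integral>\<^sup>+\<omega>. (SUP t\<in>{0..T}. ennreal (norm (em_cont f g (h \<delta>) \<tau> (\<xi> \<omega>) (\<lambda>t. W t \<omega>) t) powr p)) \<partial>M) \<le> ennreal C"
      by blast
  qed
qed

end
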